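(* Let $p$ be an odd prime, $q$ a power of $p$, and $m\geq2$ an integer; put $N=\frac{q^m-1}{q-1}$. Let $K=\mathbb{F}_q(t)$, let $f(X)=X^{N}+X+t\in K[X]$, and let $L_f/K$ be the splitting field of $f$. Suppose $d\in K^*$ is such that $g(X)=f(X)+d^2$ has distinct roots, and let $C$ be the smooth projective curve $Y^2=g(X)$ over $K$. Then: (1) $\mathrm{Gal}(L_f/K)\cong \mathrm{PGL}(m,\mathbb{F}_q)$; (2) $|C(L_f)|\geq 2\frac{q^m-1}{q-1}$. *)

theory Defs
  imports
    "HOL-Algebra.Algebraic_Closure_Type"
    "HOL-Algebra.Bij"
    "HOL-Algebra.Coset"
    "HOL-Algebra.Generated_Fields"
    "HOL-Computational_Algebra.Fraction_Field"
    "HOL-Library.Cardinality"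
    "HOL-Library.Equipollence"
    "Jordan_Normal_Form.Matrix"
begin

definition ratfun_t :: "'a::field poly fract" where
  "ratfun_t = Fract [:0, 1:] 1"

definition splitting_field :: "'k::field poly \<Rightarrow> 'k alg_closure set" where
  "splitting_field f =
     generate_field ring_of_type_algebra
       (range to_ac \<union> {x. poly (map_poly to_ac f) x = 0})"

text \<open>For subfields \<open>K \<subseteq> L\<close> of an ambient field type: the automorphisms of \<open>L\<close> that fix \<open>K\<close>
  pointwise, as extensional functions on \<open>L\<close>, under composition.\<close>

definition galois_group :: "'l::field set \<Rightarrow> 'l set \<Rightarrow> ('l \<Rightarrow> 'l) monoid" where
  "galois_group K L =
     (let R = ring_of_type_algebra\<lparr>carrier := L\<rparr>
      in (BijGroup L)\<lparr>carrier := {\<sigma> \<in> extensional L. \<sigma> \<in> ring_iso R R \<and> (\<forall>x\<in>K. \<sigma> x = x)}\<rparr>)"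

definition GL :: "'a::field itself \<Rightarrow> nat \<Rightarrow> 'a mat monoid" where
  "GL ty m = units_of (ring_mat ty m ())"

definition scalar_matrices :: "'a::field itself \<Rightarrow> nat \<Rightarrow> 'a mat set" where
  "scalar_matrices ty m = {a \<cdot>\<^sub>m 1\<^sub>m m | a. a \<noteq> (0::'a)}"

definition PGL :: "'a::field itself \<Rightarrow> nat \<Rightarrow> 'a mat set monoid" where
  "PGL ty m = GL ty m Mod scalar_matrices ty m"

text \<open>
  The smooth projective curve \<open>Y\<^sup>2 = g(X)\<close>, for \<open>g\<close> with distinct roots in characteristic other
  than two.  The closure of the affine curve in the ordinary projective plane is in general
  singular at infinity; the smooth model is
  \<open>Y\<^sup>2 = Z\<^bsup>2h\<^esup> g(X/Z)\<close> in the weighted projective plane \<open>P(1, h, 1)\<close> with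
  \<open>h = \<lceil>deg g / 2\<rceil>\<close>.  Its chart \<open>Z \<noteq> 0\<close> is the affine curve, and it has one further point
  \<open>Z = 0\<close> if the degree is odd, and the two points \<open>[1 : \<plusminus>\<surd>c : 0]\<close> if it is even, with \<open>c\<close> the
  leading coefficient.

  \<open>curve_points g L\<close> is the set of points over a subfield \<open>L\<close> containing the coefficients of \<open>g\<close>.
\<close>

definition curve_weight :: "'l::field poly \<Rightarrow> nat" where
  "curve_weight g = (Polynomial.degree g + 1) div 2"

definition weighted_scaling :: "nat \<Rightarrow> 'l::field set \<Rightarrow> (('l \<times> 'l \<times> 'l) \<times> ('l \<times> 'l \<times> 'l)) set" where
  "weighted_scaling h L = {((x, y, z), (c * x, c ^ h * y, c * z)) | x y z c. c \<in> L \<and> c \<noteq> 0}"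

definition curve_cone :: "'l::field poly \<Rightarrow> 'l set \<Rightarrow> ('l \<times> 'l \<times> 'l) set" where
  "curve_cone g L =
     {(x, y, z) | x y z. x \<in> L \<and> y \<in> L \<and> z \<in> L \<and> (x, y, z) \<noteq> (0, 0, 0) \<and>
        y ^ 2 = (\<Sum>i\<le>2 * curve_weight g.
                   Polynomial.coeff g i * x ^ i * z ^ (2 * curve_weight g - i))}"

definition curve_points :: "'l::field poly \<Rightarrow> 'l set \<Rightarrow> ('l \<times> 'l \<times> 'l) set set" where
  "curve_points g L = curve_cone g L // weighted_scaling (curve_weight g) L"

end

theory Submission
  imports Defs
begin

text \<open>
  Substituting \<open>X = Y\<^bsup>q-1\<^esup>\<close> and multiplying by \<open>Y\<close> turns \<open>f\<close> into \<open>E(Y) = Y\<^bsup>q^m\<^esup> + Y\<^sup>q + t Y\<close>, whose roots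
  form an \<open>m\<close>-dimensional space \<open>V\<close> over \<open>F\<^sub>q\<close>; the roots of \<open>f\<close> are the points of its projective space.
  Automorphisms of \<open>M = K(V)\<close> over \<open>K\<close> act linearly on \<open>V\<close>, so it suffices to realize all of \<open>GL(V)\<close>, and
  for this it suffices to realize all pseudoreflections.

  Fix \<open>w \<in> V\<close> nonzero, \<open>x = w\<^bsup>q-1\<^esup>\<close> and \<open>P(u) = u\<^sup>q - x u\<close>.  Then \<open>t = -(x\<^sup>N + x)\<close>, and the automorphisms of
  \<open>M\<close> fixing \<open>Mx = F\<^sub>q(x)(P(V))\<close> are exactly the pseudoreflections \<open>u \<mapsto> u + \<phi>(u) w\<close> that occur.  The
  elements of \<open>P(V)\<close> are roots of a polynomial that reduces to the separable
  \<open>Z\<^bsup>q^(m-1)\<^esup> + Z\<close> modulo \<open>x\<close>, so \<open>Mx\<close> is unramified at \<open>x = 0\<close>: there \<open>w\<close> is tamely ramified of full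
  order \<open>q - 1\<close>, and no \<open>u \<in> V\<close> outside the line of \<open>w\<close> lies in \<open>Mx\<close>.  By Galois theory and duality all
  pseudoreflections along \<open>w\<close> occur.

  For the curve, each root \<open>a\<close> of \<open>f\<close> has \<open>g(a) = d\<^sup>2\<close> and gives the two points \<open>(a, \<plusminus>d)\<close>.
\<close>

section \<open>Subfields and extension of homomorphisms\<close>

text \<open>The obstacle is to read off ramification at x = 0 without choosing a place of
  \<open>Mx\<close>. Both facts about \<open>Mx\<close> are obtained in the single ring
  \<open>Lx\<close>, the localization at x = 0 of the ring generated over F_q[x] by
  \<open>Z\<close>, the image of \<open>V\<close> under \<open>P\<close>. There x is not a unit, and
  the quotient by x is reduced because a power of the Frobenius is the identity on it. Reducedness
  does the work of normality: it removes the denominator of an element of \<open>Mx\<close> that is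
  integral at x = 0. The duality step runs on functionals. A pseudoreflection with center
  \<open>w\<close> is coded by its functional \<phi>; those with \<phi>(w) = 0 add under
  composition, and conjugating by an element with multiplier 1 + \<alpha>(w) = a scales them by a.
  Since \<open>w\<close> generates full tame ramification, every a \<noteq> 0 is such a multiplier,
  so the functionals that occur form a subspace of the dual of V / <w>. If the subspace were proper,
  it would annihilate some u off the line of \<open>w\<close>; adjusting u along \<open>w\<close>
  gives a vector fixed by everything over \<open>Mx\<close>, which therefore lies in
  \<open>Mx\<close>, a contradiction. Passing from \<open>M\<close> to the splitting field of f
  divides out exactly the scalars, because v^(q-1) determines the line of v.\<close>

definition is_subring :: "'b::field set \<Rightarrow> bool" where
  "is_subring B \<longleftrightarrow> 1 \<in> B \<and> (\<forall>a\<in>B. \<forall>b\<in>B. a - b \<in> B \<and> a * b \<in> B)"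

definition is_subfield :: "'b::field set \<Rightarrow> bool" where
  "is_subfield B \<longleftrightarrow> is_subring B \<and> (\<forall>a\<in>B. inverse a \<in> B)"

context
  fixes B :: "'b::field set"
  assumes B: "is_subring B"
begin

lemma subring_1: "1 \<in> B" and subring_diff: "a \<in> B \<Longrightarrow> b \<in> B \<Longrightarrow> a - b \<in> B"
  and subring_mult: "a \<in> B \<Longrightarrow> b \<in> B \<Longrightarrow> a * b \<in> B"
  using B by (auto simp: is_subring_def)

lemma subring_0: "0 \<in> B"
  using subring_diff[OF subring_1 subring_1] by simp

lemma subring_uminus: "a \<in> B \<Longrightarrow> - a \<in> B"
  using subring_diff[OF subring_0, of a] by simp

lemma subring_add: "a \<in> B \<Longrightarrow> b \<in> B \<Longrightarrow> a + b \<in> B"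
  using subring_diff[of a "- b"] subring_uminus by simp

lemma subring_power: "a \<in> B \<Longrightarrow> a ^ n \<in> B"
  by (induction n) (auto intro: subring_1 subring_mult)

lemma subring_sum: "(\<And>i. i \<in> I \<Longrightarrow> f i \<in> B) \<Longrightarrow> sum f I \<in> B"
  by (induction I rule: infinite_finite_induct) (auto intro: subring_0 subring_add)

end

lemmas subring_closed =
  subring_0 subring_1 subring_uminus subring_add subring_diff subring_mult subring_power
  subring_sum

lemma subfieldD: "is_subfield B \<Longrightarrow> is_subring B"
  by (simp add: is_subfield_def)

lemma subfield_inverse: "is_subfield B \<Longrightarrow> a \<in> B \<Longrightarrow> inverse a \<in> B"
  by (simp add: is_subfield_def)

lemma subfield_divide: "is_subfield B \<Longrightarrow> a \<in> B \<Longrightarrow> b \<in> B \<Longrightarrow> a / b \<in> B"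
  by (simp add: divide_inverse is_subfield_def subring_mult)

section \<open>Polynomials over a subfield and simple extensions\<close>

definition polys_over :: "'b::field set \<Rightarrow> 'b poly set" where
  "polys_over B = {p. \<forall>i. coeff p i \<in> B}"

context
  fixes B :: "'b::field set"
  assumes B: "is_subring B"
begin

lemma polys_over_0: "0 \<in> polys_over B" and polys_over_1: "1 \<in> polys_over B"
  using subring_closed[OF B] by (auto simp: polys_over_def coeff_1)

lemma polys_over_add: "p \<in> polys_over B \<Longrightarrow> r \<in> polys_over B \<Longrightarrow> p + r \<in> polys_over B"
  and polys_over_diff: "p \<in> polys_over B \<Longrightarrow> r \<in> polys_over B \<Longrightarrow> p - r \<in> polys_over B"
  and polys_over_uminus: "p \<in> polys_over B \<Longrightarrow> - p \<in> polys_over B"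
  and polys_over_mult: "p \<in> polys_over B \<Longrightarrow> r \<in> polys_over B \<Longrightarrow> p * r \<in> polys_over B"
  by (auto simp: polys_over_def coeff_mult intro!: subring_closed[OF B])

lemma polys_over_monom: "c \<in> B \<Longrightarrow> Polynomial.monom c n \<in> polys_over B"
  by (auto simp: polys_over_def subring_0[OF B])

lemma polys_over_pCons: "pCons c p \<in> polys_over B \<longleftrightarrow> c \<in> B \<and> p \<in> polys_over B"
proof -
  have "(\<forall>i. coeff (pCons c p) i \<in> B) \<longleftrightarrow> c \<in> B \<and> (\<forall>i. coeff p i \<in> B)"
    by (metis coeff_pCons_0 coeff_pCons_Suc not0_implies_Suc)
  then show ?thesis by (simp add: polys_over_def)
qed

lemma poly_in_subring: "p \<in> polys_over B \<Longrightarrow> a \<in> B \<Longrightarrow> poly p a \<in> B"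
  by (induction p) (auto simp: polys_over_pCons intro!: subring_closed[OF B])

end

lemmas polys_over_closed =
  polys_over_0 polys_over_1 polys_over_add polys_over_diff polys_over_uminus polys_over_mult
  polys_over_monom

lemma polys_over_mono: "B \<subseteq> C \<Longrightarrow> polys_over B \<subseteq> polys_over C"
  by (auto simp: polys_over_def)

text \<open>This is long division; what has to be followed through the induction on the degree is
  that all coefficients stay in \<open>B\<close>.\<close>

lemma polys_over_division:
  assumes B: "is_subfield B" and P: "P \<in> polys_over B" "P \<noteq> 0" and p: "p \<in> polys_over B"
  obtains s r where "s \<in> polys_over B" "r \<in> polys_over B" "p = P * s + r"
    "r = 0 \<or> degree r < degree P"
proof -
  note R = subfieldD[OF B]
  have "\<exists>s\<in>polys_over B. \<exists>r\<in>polys_over B. p = P * s + r \<and> (r = 0 \<or> degree r < degree P)"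
    using p
  proof (induction "degree p" arbitrary: p rule: less_induct)
    case less
    show ?case
    proof (cases "p = 0 \<or> degree p < degree P")
      case True
      then show ?thesis
        using less.prems polys_over_0[OF R] by (intro bexI[of _ 0] bexI[of _ p]) auto
    next
      case False
      then have dg: "degree P \<le> degree p" and p0: "p \<noteq> 0" by auto
      define c where "c = Polynomial.monom (lead_coeff p / lead_coeff P) (degree p - degree P)"
      have c: "c \<in> polys_over B"
        unfolding c_def using P(1) less.prems
        by (intro polys_over_monom[OF R] subfield_divide[OF B]) (auto simp: polys_over_def)
      define p' where "p' = p - P * c"
      have p': "p' \<in> polys_over B"
        unfolding p'_def using less.prems P c by (intro polys_over_closed[OF R])
      have cf0: "lead_coeff p / lead_coeff P \<noteq> 0" using P p0 by simp
      have dPc: "degree (P * c) = degree p" 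
        using P dg cf0 by (simp add: c_def degree_mult_eq degree_monom_eq monom_eq_0_iff)
      have lPc: "coeff (P * c) (degree p) = lead_coeff p"
        using dPc lead_coeff_mult[of P c] P(2) degree_monom_eq[OF cf0] by (simp add: c_def)
      have "p' = 0 \<or> degree p' < degree p"
        using dPc lPc degree_diff_le[of p "degree p" "P * c"]
        by (intro eq_zero_or_degree_less) (auto simp: p'_def)
      then obtain s r where sr: "s \<in> polys_over B" "r \<in> polys_over B" "p' = P * s + r"
        "r = 0 \<or> degree r < degree P"
        using less.hyps[OF _ p'] polys_over_0[OF R] by (metis add.right_neutral mult_zero_right)
      then have "p = P * (s + c) + r" by (simp add: p'_def algebra_simps)
      then show ?thesis using sr polys_over_add[OF R sr(1) c] by blast
    qed
  qed
  then show ?thesis using that by blast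
qed

definition algebraic_over :: "'b::field set \<Rightarrow> 'b \<Rightarrow> bool" where
  "algebraic_over B v \<longleftrightarrow> (\<exists>p\<in>polys_over B. p \<noteq> 0 \<and> poly p v = 0)"

text \<open>The ring \<open>B[v]\<close>, formed from polynomial values only. The same construction
  thus serves over a ring, for \<open>Ox\<close> over F_q[x], and over a field, where algebraic
  generators give a field.\<close>

definition adjoin :: "'b::field set \<Rightarrow> 'b \<Rightarrow> 'b set" where
  "adjoin B v = (\<lambda>p. poly p v) ` polys_over B"

lemma algebraic_over_mono: "B \<subseteq> C \<Longrightarrow> algebraic_over B v \<Longrightarrow> algebraic_over C v"
  using polys_over_mono unfolding algebraic_over_def by blast

lemma adjoin_base: assumes "is_subring B" shows "B \<subseteq> adjoin B v"
proof
  fix b assume "b \<in> B"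
  then have "[:b:] \<in> polys_over B" using assms polys_over_0 polys_over_pCons by blast
  then show "b \<in> adjoin B v" unfolding adjoin_def by (intro image_eqI[of _ _ "[:b:]"]) auto
qed

lemma adjoin_gen: assumes "is_subring B" shows "v \<in> adjoin B v"
proof -
  have "[:0, 1:] \<in> polys_over B"
    using assms polys_over_0 polys_over_pCons subring_0 subring_1 by metis
  then show ?thesis unfolding adjoin_def by (intro image_eqI[of _ _ "[:0, 1:]"]) auto
qed

lemma adjoin_least:
  assumes "is_subring C" "B \<subseteq> C" "v \<in> C"
  shows "adjoin B v \<subseteq> C"
  unfolding adjoin_def using poly_in_subring[OF assms(1)] polys_over_mono[OF assms(2)] assms(3) by blast

lemma is_subring_adjoin:
  assumes "is_subring B"
  shows "is_subring (adjoin B v)"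
  unfolding is_subring_def
proof (intro conjI ballI)
  show "1 \<in> adjoin B v" using adjoin_base[OF assms] subring_1[OF assms] by blast
  fix a b assume "a \<in> adjoin B v" "b \<in> adjoin B v"
  then obtain p r where pr: "p \<in> polys_over B" "r \<in> polys_over B" "a = poly p v" "b = poly r v"
    by (auto simp: adjoin_def)
  show "a - b \<in> adjoin B v" unfolding adjoin_def
    by (rule image_eqI[of _ _ "p - r"]) (use pr polys_over_closed[OF assms] in auto)
  show "a * b \<in> adjoin B v" unfolding adjoin_def
    by (rule image_eqI[of _ _ "p * r"]) (use pr polys_over_closed[OF assms] in auto)
qed

lemma minimal_polynomial:
  assumes B: "is_subfield B" and v: "algebraic_over B v"
  obtains P where "P \<in> polys_over B" "P \<noteq> 0" "poly P v = 0" "0 < degree P"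
    "\<And>p. p \<in> polys_over B \<Longrightarrow> poly p v = 0 \<Longrightarrow> p \<noteq> 0 \<Longrightarrow> degree P \<le> degree p"
    "\<And>p. p \<in> polys_over B \<Longrightarrow> poly p v = 0 \<Longrightarrow> \<exists>s\<in>polys_over B. p = P * s"
proof -
  define Z where "Z = (\<lambda>p. p \<in> polys_over B \<and> p \<noteq> 0 \<and> poly p v = 0)"
  obtain P where P: "Z P" and le: "\<And>p. Z p \<Longrightarrow> degree P \<le> degree p"
    using v ex_has_least_nat[of Z _ degree] unfolding algebraic_over_def Z_def by metis
  have deg: "0 < degree P"
  proof (rule ccontr)
    assume "\<not> 0 < degree P"
    then obtain c where "P = [:c:]" by (auto elim: degree_eq_zeroE)
    then show False using P by (auto simp: Z_def)
  qed
  have "\<exists>s\<in>polys_over B. p = P * s" if p: "p \<in> polys_over B" "poly p v = 0" for p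
  proof -
    obtain s r where sr: "s \<in> polys_over B" "r \<in> polys_over B" "p = P * s + r"
      "r = 0 \<or> degree r < degree P"
      using polys_over_division[OF B _ _ p(1), of P] P unfolding Z_def by blast
    have "poly r v = 0" using p(2) P sr(3) by (simp add: Z_def)
    then have "r = 0" using le[of r] sr unfolding Z_def by (meson not_le)
    then show ?thesis using sr by auto
  qed
  then show ?thesis using that[of P] P deg le by (auto simp: Z_def)
qed

text \<open>Inverses come from the Euclidean algorithm: dividing the minimal polynomial
  \<open>P\<close> by \<open>p\<close> leaves a remainder \<open>r\<close> of smaller degree with
  \<open>r(v) = - p(v) s(v)\<close>, so an inverse of \<open>r(v)\<close> yields one of
  \<open>p(v)\<close>. The remainder is nonzero, since otherwise the quotient would annihilate
  \<open>v\<close> in a degree below that of \<open>P\<close>.\<close>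

lemma is_subfield_adjoin:
  assumes B: "is_subfield B" and v: "algebraic_over B v"
  shows "is_subfield (adjoin B v)"
proof -
  note R = subfieldD[OF B]
  obtain P where P: "P \<in> polys_over B" "P \<noteq> 0" "poly P v = 0" "0 < degree P"
    and le: "\<And>p. p \<in> polys_over B \<Longrightarrow> poly p v = 0 \<Longrightarrow> p \<noteq> 0 \<Longrightarrow> degree P \<le> degree p"
    and "\<And>p. p \<in> polys_over B \<Longrightarrow> poly p v = 0 \<Longrightarrow> \<exists>s\<in>polys_over B. p = P * s"
    by (rule minimal_polynomial[OF B v]) blast
  have inv: "\<exists>b\<in>polys_over B. poly b v * poly p v = 1"
    if "p \<in> polys_over B" "p \<noteq> 0" "degree p < degree P" for p
    using that
  proof (induction "degree p" arbitrary: p rule: less_induct)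
    case less
    show ?case
    proof (cases "degree p = 0")
      case True
      then obtain c where c: "p = [:c:]" by (auto elim: degree_eq_zeroE)
      with less have "c \<in> B" "c \<noteq> 0" using polys_over_pCons[OF R] by auto
      then show ?thesis
        using c polys_over_pCons[OF R] polys_over_0[OF R] subfield_inverse[OF B]
        by (intro bexI[of _ "[:inverse c:]"]) auto
    next
      case False
      obtain s r where sr: "s \<in> polys_over B" "r \<in> polys_over B" "P = p * s + r"
        "r = 0 \<or> degree r < degree p"
        using polys_over_division[OF B less.prems(1,2) P(1)] by blast
      have s0: "poly p v \<noteq> 0" using le[of p] less.prems by auto
      have "r \<noteq> 0"
      proof
        assume "r = 0"
        then have Ps: "P = p * s" using sr by simp
        then have "poly s v = 0" "s \<noteq> 0" using P s0 by auto
        moreover have "degree P = degree p + degree s"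
          using Ps P(2) degree_mult_eq[of p s] by auto
        ultimately show False using le[OF sr(1)] False by auto
      qed
      then obtain c where c: "c \<in> polys_over B" "poly c v * poly r v = 1"
        using less.hyps[of r] sr less.prems by auto
      have "poly r v = - (poly p v * poly s v)"
        using P(3) sr(3) by (metis add_eq_0_iff poly_add poly_mult)
      then have "poly (- c * s) v * poly p v = 1" using c by (simp add: algebra_simps)
      moreover have "- c * s \<in> polys_over B" using c sr by (intro polys_over_closed[OF R])
      ultimately show ?thesis by blast
    qed
  qed
  have "inverse a \<in> adjoin B v" if a: "a \<in> adjoin B v" for a
  proof (cases "a = 0")
    case False
    obtain p where p: "p \<in> polys_over B" "a = poly p v" using a by (auto simp: adjoin_def)
    obtain s r where sr: "s \<in> polys_over B" "r \<in> polys_over B" "p = P * s + r"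
      "r = 0 \<or> degree r < degree P"
      using polys_over_division[OF B P(1,2) p(1)] by blast
    then have ar: "a = poly r v" using p P by simp
    with False sr inv[of r] obtain b where "b \<in> polys_over B" "poly b v * poly r v = 1" by force
    then have "inverse a = poly b v" using ar by (metis inverse_unique mult.commute)
    then show ?thesis using \<open>b \<in> polys_over B\<close> by (auto simp: adjoin_def)
  qed (use a in simp)
  then show ?thesis by (simp add: is_subfield_def is_subring_adjoin[OF R])
qed

fun adjoins :: "'b::field set \<Rightarrow> 'b list \<Rightarrow> 'b set" where
  "adjoins B [] = B"
| "adjoins B (v # vs) = adjoins (adjoin B v) vs"

lemma is_subring_adjoins: "is_subring B \<Longrightarrow> is_subring (adjoins B vs)"
  by (induction vs arbitrary: B) (auto intro: is_subring_adjoin)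

lemma adjoins_base: "is_subring B \<Longrightarrow> B \<subseteq> adjoins B vs"
  by (induction vs arbitrary: B) (auto dest: is_subring_adjoin adjoin_base)

lemma adjoins_gen: "is_subring B \<Longrightarrow> set vs \<subseteq> adjoins B vs"
proof (induction vs arbitrary: B)
  case (Cons v vs)
  have "v \<in> adjoins (adjoin B v) vs"
    using adjoins_base[OF is_subring_adjoin[OF Cons.prems]] adjoin_gen[OF Cons.prems] by blast
  then show ?case using Cons.IH[OF is_subring_adjoin[OF Cons.prems]] by auto
qed simp

lemma adjoins_least: "is_subring C \<Longrightarrow> B \<subseteq> C \<Longrightarrow> set vs \<subseteq> C \<Longrightarrow> adjoins B vs \<subseteq> C"
  by (induction vs arbitrary: B) (auto simp: adjoin_least)

lemma is_subfield_adjoins: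
  "is_subfield B \<Longrightarrow> \<forall>v\<in>set vs. algebraic_over B v \<Longrightarrow> is_subfield (adjoins B vs)"
proof (induction vs arbitrary: B)
  case (Cons v vs)
  have "\<forall>u\<in>set vs. algebraic_over (adjoin B v) u"
    using Cons.prems(2) algebraic_over_mono[OF adjoin_base[OF subfieldD[OF Cons.prems(1)]]] by simp
  then show ?case using Cons is_subfield_adjoin by auto
qed simp

section \<open>Homomorphisms on subrings and their extension\<close>

definition hom_on :: "'b::field set \<Rightarrow> ('b \<Rightarrow> 'c::field) \<Rightarrow> bool" where
  "hom_on B \<sigma> \<longleftrightarrow> \<sigma> 1 = 1 \<and>
     (\<forall>a\<in>B. \<forall>b\<in>B. \<sigma> (a + b) = \<sigma> a + \<sigma> b \<and> \<sigma> (a * b) = \<sigma> a * \<sigma> b)"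

lemma hom_on_subset: "hom_on B \<sigma> \<Longrightarrow> A \<subseteq> B \<Longrightarrow> hom_on A \<sigma>"
  by (auto simp: hom_on_def)

context
  fixes B :: "'b::field set" and \<sigma> :: "'b \<Rightarrow> 'c::field"
  assumes B: "is_subring B" and \<sigma>: "hom_on B \<sigma>"
begin

lemma hom_on_1: "\<sigma> 1 = 1" and hom_on_add: "a \<in> B \<Longrightarrow> b \<in> B \<Longrightarrow> \<sigma> (a + b) = \<sigma> a + \<sigma> b"
  and hom_on_mult: "a \<in> B \<Longrightarrow> b \<in> B \<Longrightarrow> \<sigma> (a * b) = \<sigma> a * \<sigma> b"
  using \<sigma> by (auto simp: hom_on_def)

lemma hom_on_0: "\<sigma> 0 = 0"
  using hom_on_add[OF subring_0[OF B] subring_0[OF B]] by (metis add.right_neutral add_left_cancel)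

lemma hom_on_uminus: "a \<in> B \<Longrightarrow> \<sigma> (- a) = - \<sigma> a"
  using hom_on_add[of a "- a"] hom_on_0 subring_uminus[OF B, of a]
  by (simp add: eq_neg_iff_add_eq_0 add.commute)

lemma hom_on_diff: "a \<in> B \<Longrightarrow> b \<in> B \<Longrightarrow> \<sigma> (a - b) = \<sigma> a - \<sigma> b"
  using hom_on_add[of a "- b"] hom_on_uminus[of b] subring_uminus[OF B, of b] by simp

lemma hom_on_power: "a \<in> B \<Longrightarrow> \<sigma> (a ^ n) = \<sigma> a ^ n"
  by (induction n) (auto simp: hom_on_1 hom_on_mult subring_power[OF B])

lemma hom_on_sum: "(\<And>i. i \<in> I \<Longrightarrow> f i \<in> B) \<Longrightarrow> \<sigma> (sum f I) = (\<Sum>i\<in>I. \<sigma> (f i))"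
  by (induction I rule: infinite_finite_induct)
     (auto simp: hom_on_0 hom_on_add subring_sum[OF B])

lemma hom_on_coeff: "coeff (map_poly \<sigma> p) i = \<sigma> (coeff p i)"
  by (simp add: coeff_map_poly hom_on_0)

lemma hom_on_map_poly_add:
  "p \<in> polys_over B \<Longrightarrow> r \<in> polys_over B \<Longrightarrow> map_poly \<sigma> (p + r) = map_poly \<sigma> p + map_poly \<sigma> r"
  by (intro poly_eqI) (auto simp: hom_on_coeff polys_over_def hom_on_add)

lemma hom_on_map_poly_diff:
  "p \<in> polys_over B \<Longrightarrow> r \<in> polys_over B \<Longrightarrow> map_poly \<sigma> (p - r) = map_poly \<sigma> p - map_poly \<sigma> r"
  by (intro poly_eqI) (auto simp: hom_on_coeff polys_over_def hom_on_diff)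

lemma hom_on_map_poly_mult:
  assumes "p \<in> polys_over B" "r \<in> polys_over B"
  shows "map_poly \<sigma> (p * r) = map_poly \<sigma> p * map_poly \<sigma> r"
proof (intro poly_eqI)
  fix n
  have c: "coeff p i \<in> B" "coeff r i \<in> B" for i using assms by (auto simp: polys_over_def)
  show "coeff (map_poly \<sigma> (p * r)) n = coeff (map_poly \<sigma> p * map_poly \<sigma> r) n"
    by (simp add: hom_on_coeff coeff_mult hom_on_sum hom_on_mult c subring_mult[OF B])
qed

end

lemma hom_on_eq_0:
  assumes B: "is_subfield B" and \<sigma>: "hom_on B \<sigma>" and a: "a \<in> B"
  shows "\<sigma> a = 0 \<longleftrightarrow> a = 0"
proof
  assume s: "\<sigma> a = 0"
  show "a = 0"
  proof (rule ccontr)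
    assume "a \<noteq> 0"
    then have "\<sigma> 1 = \<sigma> a * \<sigma> (inverse a)"
      using \<sigma> a subfield_inverse[OF B a] unfolding hom_on_def by (metis right_inverse)
    then show False using s \<sigma> by (simp add: hom_on_def)
  qed
qed (use hom_on_0[OF subfieldD[OF B] \<sigma>] in simp)

lemma hom_on_inj:
  assumes B: "is_subfield B" and \<sigma>: "hom_on B \<sigma>"
  shows "inj_on \<sigma> B"
proof (rule inj_onI)
  fix a b assume ab: "a \<in> B" "b \<in> B" "\<sigma> a = \<sigma> b"
  then have "\<sigma> (a - b) = 0" using hom_on_diff[OF subfieldD[OF B] \<sigma>] by simp
  then show "a = b" using hom_on_eq_0[OF B \<sigma>, of "a - b"] ab subring_diff[OF subfieldD[OF B]] by simp
qed

lemma hom_on_inverse: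
  assumes B: "is_subfield B" and \<sigma>: "hom_on B \<sigma>" and a: "a \<in> B"
  shows "\<sigma> (inverse a) = inverse (\<sigma> a)"
proof (cases "a = 0")
  case True
  then show ?thesis using hom_on_0[OF subfieldD[OF B] \<sigma>] by simp
next
  case False
  then have "\<sigma> a * \<sigma> (inverse a) = 1"
    using \<sigma> a subfield_inverse[OF B a] unfolding hom_on_def by (metis right_inverse)
  then show ?thesis by (metis inverse_unique)
qed

text \<open>Two polynomials with the same value at \<open>v\<close> differ by a multiple of
  \<open>P\<close>, and the transported \<open>P\<close> vanishes at \<open>v'\<close>; so sending
  \<open>p(v)\<close> to the transported \<open>p\<close> at \<open>v'\<close> is well defined. The
  last clause keeps this formula, which is what later shows that a given element is moved.\<close>

lemma extend_hom_adjoin: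
  assumes B: "is_subfield B" and \<sigma>: "hom_on B \<sigma>"
    and P: "P \<in> polys_over B" "\<And>p. p \<in> polys_over B \<Longrightarrow> poly p v = 0 \<Longrightarrow> \<exists>s\<in>polys_over B. p = P * s"
    and v': "poly (map_poly \<sigma> P) v' = 0"
  shows "\<exists>\<tau>. hom_on (adjoin B v) \<tau> \<and> (\<forall>b\<in>B. \<tau> b = \<sigma> b) \<and> \<tau> v = v' \<and>
    (\<forall>p\<in>polys_over B. \<tau> (poly p v) = poly (map_poly \<sigma> p) v')"
proof -
  note R = subfieldD[OF B]
  have wd: "poly (map_poly \<sigma> p) v' = poly (map_poly \<sigma> r) v'"
    if "p \<in> polys_over B" "r \<in> polys_over B" "poly p v = poly r v" for p r
  proof -
    have "p - r \<in> polys_over B" "poly (p - r) v = 0" using that polys_over_diff[OF R] by auto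
    then obtain s where s: "s \<in> polys_over B" "p - r = P * s" using P(2) by blast
    have "map_poly \<sigma> p - map_poly \<sigma> r = map_poly \<sigma> P * map_poly \<sigma> s"
      using hom_on_map_poly_diff[OF R \<sigma> that(1,2)] hom_on_map_poly_mult[OF R \<sigma> P(1) s(1)] s by simp
    then have "poly (map_poly \<sigma> p) v' - poly (map_poly \<sigma> r) v' = 0"
      using v' by (metis mult_zero_left poly_diff poly_mult)
    then show ?thesis by simp
  qed
  define \<tau> where "\<tau> y = poly (map_poly \<sigma> (SOME p. p \<in> polys_over B \<and> y = poly p v)) v'" for y
  have \<tau>: "\<tau> (poly p v) = poly (map_poly \<sigma> p) v'" if p: "p \<in> polys_over B" for p
  proof -
    have "\<exists>r. r \<in> polys_over B \<and> poly p v = poly r v" using p by blast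
    from someI_ex[OF this] show ?thesis unfolding \<tau>_def using wd[OF p] by metis
  qed
  have base: "\<tau> b = \<sigma> b" if "b \<in> B" for b
    using \<tau>[of "[:b:]"] that polys_over_pCons[OF R] polys_over_0[OF R]
    by (simp add: map_poly_pCons hom_on_0[OF R \<sigma>])
  have gen: "\<tau> v = v'"
    using \<tau>[of "[:0, 1:]"] polys_over_pCons[OF R] polys_over_0[OF R] subring_0[OF R] subring_1[OF R]
    by (simp add: map_poly_pCons hom_on_0[OF R \<sigma>] hom_on_1[OF R \<sigma>])
  have "hom_on (adjoin B v) \<tau>" unfolding hom_on_def
  proof (intro conjI ballI)
    show "\<tau> 1 = 1" using base subring_1[OF R] hom_on_1[OF R \<sigma>] by simp
    fix a b assume "a \<in> adjoin B v" "b \<in> adjoin B v"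
    then obtain p r where pr: "p \<in> polys_over B" "r \<in> polys_over B" "a = poly p v" "b = poly r v"
      by (auto simp: adjoin_def)
    show "\<tau> (a + b) = \<tau> a + \<tau> b"
      using \<tau>[OF pr(1)] \<tau>[OF pr(2)] \<tau>[OF polys_over_add[OF R pr(1,2)]] pr(3,4)
        hom_on_map_poly_add[OF R \<sigma> pr(1,2)] by simp
    show "\<tau> (a * b) = \<tau> a * \<tau> b"
      using \<tau>[OF pr(1)] \<tau>[OF pr(2)] \<tau>[OF polys_over_mult[OF R pr(1,2)]] pr(3,4)
        hom_on_map_poly_mult[OF R \<sigma> pr(1,2)] by simp
  qed
  then show ?thesis using base gen \<tau> by (intro exI[of _ \<tau>]) simp
qed

text \<open>One generator at a time: \<sigma> is injective, so the transported minimal polynomial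
  keeps its positive degree and has a root in the algebraically closed target.\<close>

lemma extend_hom_adjoins:
  fixes \<sigma> :: "'b::field \<Rightarrow> 'c::alg_closed_field"
  assumes "is_subfield B" "hom_on B \<sigma>" "\<forall>v\<in>set vs. algebraic_over B v"
  shows "\<exists>\<tau>. hom_on (adjoins B vs) \<tau> \<and> (\<forall>b\<in>B. \<tau> b = \<sigma> b)"
  using assms
proof (induction vs arbitrary: B \<sigma>)
    case (Cons v vs)
    note B = Cons.prems(1) and R = subfieldD[OF Cons.prems(1)]
    have av: "algebraic_over B v" using Cons.prems(3) by simp
    obtain P where P: "P \<in> polys_over B" "0 < degree P" "\<And>p. p \<in> polys_over B \<Longrightarrow> poly p v = 0 \<Longrightarrow> \<exists>s\<in>polys_over B. p = P * s"
      by (rule minimal_polynomial[OF B av]) blast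
    then have P0: "P \<noteq> 0" by auto
    have "\<sigma> (lead_coeff P) \<noteq> 0"
      using hom_on_eq_0[OF B Cons.prems(2)] P(1) P0 by (auto simp: polys_over_def)
    then have "degree (map_poly \<sigma> P) = degree P"
      by (intro map_poly_degree_eq)
    with P(2) have "0 < degree (map_poly \<sigma> P)" by simp
    from alg_closed_imp_poly_has_root[OF this] obtain v' where v': "poly (map_poly \<sigma> P) v' = 0" ..
    obtain \<tau> where \<tau>: "hom_on (adjoin B v) \<tau>" "\<forall>b\<in>B. \<tau> b = \<sigma> b"
      using extend_hom_adjoin[OF B Cons.prems(2) P(1,3) v'] by metis
    have "\<forall>u\<in>set vs. algebraic_over (adjoin B v) u"
      using Cons.prems(3) algebraic_over_mono[OF adjoin_base[OF R]] by simp
    from Cons.IH[OF is_subfield_adjoin[OF B av] \<tau>(1) this] Cons.prems(3)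
    obtain \<rho> where "hom_on (adjoins (adjoin B v) vs) \<rho>" "\<forall>b\<in>adjoin B v. \<rho> b = \<tau> b" by auto
    then show ?case using \<tau>(2) adjoin_base[OF R, of v] by (intro exI[of _ \<rho>]) auto
qed auto

section \<open>Separability and conjugates\<close>

lemma card_roots_rsquarefree:
  fixes P :: "'b::alg_closed_field poly"
  assumes "rsquarefree P"
  shows "card {a. poly P a = 0} = degree P"
proof -
  have P0: "P \<noteq> 0" using assms by (simp add: rsquarefree_def)
  obtain A where A: "size A = degree P" "P = smult (lead_coeff P) (\<Prod>x\<in>#A. [:-x, 1:])"
    using alg_closed_imp_factorization[OF P0] by blast
  have "proots (\<Prod>x\<in>#A. [:-x, 1:]) = A"
  proof (induction A)
    case (add x A)
    have "(\<Prod>x\<in>#A. [:-x, 1:]) \<noteq> 0" by (auto simp: prod_mset_zero_iff)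
    then have "proots ([:-x, 1:] * (\<Prod>x\<in>#A. [:-x, 1:])) =
        proots [:-x, 1:] + proots (\<Prod>x\<in>#A. [:-x, 1:])" by (intro proots_mult) auto
    then show ?case using add.IH by (simp del: mult_pCons_left)
  qed simp
  then have "proots P = A" using P0 by (subst A(2)) simp
  then have ord: "order a P = count A a" for a by (metis count_proots[OF P0])
  have cnt: "count A a \<le> 1" for a using assms ord[of a] by (metis rsquarefree_def le_refl zero_le_one)
  have "{a. poly P a = 0} = set_mset A"
    using ord P0 by (auto simp: order_root)
  moreover have "card (set_mset A) = size A"
  proof -
    have "count A a = 1" if "a \<in> set_mset A" for a
      using cnt[of a] that by (simp add: le_antisym)
    then show ?thesis by (simp add: size_multiset_overloaded_eq)
  qed
  ultimately show ?thesis using A by simp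
qed

lemma rsquarefree_dvd:
  assumes "rsquarefree (P * S)"
  shows "rsquarefree P"
proof -
  have "P * S \<noteq> 0" using assms by (simp add: rsquarefree_def)
  then have "order a P \<le> order a (P * S)" for a by (simp add: order_mult)
  then show ?thesis using assms \<open>P * S \<noteq> 0\<close> unfolding rsquarefree_def
    by (metis le_zero_eq mult_zero_left One_nat_def le_Suc_eq)
qed

lemma rsquarefree_if_pderiv_nonzero:
  fixes P :: "'b::field poly"
  assumes "\<And>a. poly P a = 0 \<Longrightarrow> poly (pderiv P) a \<noteq> 0" "P \<noteq> 0"
  shows "rsquarefree P"
proof -
  have "order a P \<le> 1" for a
  proof (rule ccontr)
    assume "\<not> order a P \<le> 1"
    then have "[:- a, 1:] ^ 2 dvd P" by (metis power_le_dvd order_1 Suc_1 not_less_eq_eq One_nat_def)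
    then obtain S where S: "P = [:- a, 1:] * ([:- a, 1:] * S)" by (metis dvdE mult.assoc power2_eq_square)
    have "poly P a = 0" by (simp add: S)
    moreover have "poly (pderiv P) a = 0" unfolding S pderiv_mult by simp
    ultimately show False using assms(1) by blast
  qed
  then show ?thesis using assms(2) unfolding rsquarefree_def
    by (metis One_nat_def le_Suc_eq le_zero_eq)
qed

text \<open>The half of Galois theory that is needed: only elements of \<open>B\<close> are fixed by
  all homomorphisms over \<open>B\<close>. At the first generator \<open>v\<close> with \<alpha> in
  \<open>B[v]\<close>, write \<alpha> = h(v) with deg h < deg P. By separability \<open>P\<close>
  has deg P distinct roots, too many for all of them to be zeros of the nonzero polynomial h -
  \<alpha>; some conjugate \<open>v'\<close> gives h(v') \<noteq> \<alpha>, and the resulting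
  homomorphism extends to the remaining generators.\<close>

lemma exists_hom_moving:
  fixes B :: "'b::alg_closed_field set"
  assumes "is_subfield B" "\<forall>v\<in>set vs. \<exists>E\<in>polys_over B. rsquarefree E \<and> poly E v = 0"
    and "\<alpha> \<in> adjoins B vs" "\<alpha> \<notin> B"
  shows "\<exists>\<sigma>. hom_on (adjoins B vs) \<sigma> \<and> (\<forall>b\<in>B. \<sigma> b = b) \<and> \<sigma> \<alpha> \<noteq> \<alpha>"
  using assms
proof (induction vs arbitrary: B)
    case (Cons v vs)
    note B = Cons.prems(1) and R = subfieldD[OF Cons.prems(1)]
    obtain E where E: "E \<in> polys_over B" "rsquarefree E" "poly E v = 0"
      using Cons.prems(2) by auto
    then have "algebraic_over B v" unfolding algebraic_over_def rsquarefree_def by blast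
    note B1 = is_subfield_adjoin[OF B this] and algv = this
    have sep1: "\<forall>u\<in>set vs. \<exists>E\<in>polys_over (adjoin B v). rsquarefree E \<and> poly E u = 0"
      using Cons.prems(2) polys_over_mono[OF adjoin_base[OF R, of v]] by (meson list.set_intros(2) subsetD)
    show ?case
    proof (cases "\<alpha> \<in> adjoin B v")
      case False
      then obtain \<sigma> where "hom_on (adjoins (adjoin B v) vs) \<sigma>" "\<forall>b\<in>adjoin B v. \<sigma> b = b" "\<sigma> \<alpha> \<noteq> \<alpha>"
        using Cons.IH[OF B1 sep1] Cons.prems(3) by auto
      then show ?thesis using adjoin_base[OF R, of v] by (intro exI[of _ \<sigma>]) auto
    next
      case True
      obtain P where P: "P \<in> polys_over B" "P \<noteq> 0" "poly P v = 0" "0 < degree P"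
        "\<And>p. p \<in> polys_over B \<Longrightarrow> poly p v = 0 \<Longrightarrow> \<exists>s\<in>polys_over B. p = P * s"
        by (rule minimal_polynomial[OF B algv]) blast
      obtain S where "E = P * S" using P(5) E by blast
      then have "rsquarefree P" using E rsquarefree_dvd by blast
      then have cP: "card {a. poly P a = 0} = degree P" by (rule card_roots_rsquarefree)
      obtain h0 where h0: "h0 \<in> polys_over B" "\<alpha> = poly h0 v" using True by (auto simp: adjoin_def)
      obtain s h where sh: "s \<in> polys_over B" "h \<in> polys_over B" "h0 = P * s + h"
        "h = 0 \<or> degree h < degree P"
        using polys_over_division[OF B P(1,2) h0(1)] by blast
      then have ah: "\<alpha> = poly h v" and dh: "degree h < degree P" using h0 P by auto
      have "\<exists>v'. poly P v' = 0 \<and> poly h v' \<noteq> \<alpha>"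
      proof (rule ccontr)
        assume "\<not> ?thesis"
        then have "{a. poly P a = 0} \<subseteq> {a. poly (h - [:\<alpha>:]) a = 0}" by auto
        moreover have ne: "h - [:\<alpha>:] \<noteq> 0"
        proof
          assume "h - [:\<alpha>:] = 0"
          then have "coeff h 0 = \<alpha>" by (metis coeff_pCons_0 eq_iff_diff_eq_0)
          then show False using sh(2) Cons.prems(4) by (auto simp: polys_over_def)
        qed
        ultimately have "degree P \<le> card {a. poly (h - [:\<alpha>:]) a = 0}"
          using cP card_mono[OF poly_roots_finite[OF ne]] by metis
        also have "\<dots> \<le> degree (h - [:\<alpha>:])" by (rule card_poly_roots_bound[OF ne])
        also have "\<dots> \<le> degree h" by (intro degree_diff_le) auto
        finally show False using dh by simp
      qed
      then obtain v' where v': "poly P v' = 0" "poly h v' \<noteq> \<alpha>" by blast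
      have id: "hom_on B (\<lambda>b. b)" by (simp add: hom_on_def)
      have "poly (map_poly (\<lambda>b. b) P) v' = 0" using v' by simp
      from extend_hom_adjoin[OF B id P(1,5) this]
      obtain \<tau> where \<tau>: "hom_on (adjoin B v) \<tau>" "\<forall>b\<in>B. \<tau> b = b"
        "\<forall>p\<in>polys_over B. \<tau> (poly p v) = poly p v'"
        unfolding map_poly_id' by metis
      have "\<forall>u\<in>set vs. algebraic_over (adjoin B v) u"
        using sep1 unfolding algebraic_over_def rsquarefree_def by blast
      from extend_hom_adjoins[OF B1 \<tau>(1) this]
      obtain \<rho> where \<rho>: "hom_on (adjoins (adjoin B v) vs) \<rho>" "\<forall>b\<in>adjoin B v. \<rho> b = \<tau> b"
        by metis
      have "\<rho> \<alpha> \<noteq> \<alpha>" using \<rho>(2) True \<tau>(3) sh(2) ah v'(2) by simp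
      then show ?thesis using \<rho> \<tau>(2) adjoin_base[OF R, of v] by (intro exI[of _ \<rho>]) auto
    qed
qed auto

text \<open>The source of finiteness in two pigeonhole arguments, one on the powers of t and one on
  the powers of 1/x.\<close>

lemma finite_degree_le: "finite {h :: 'a::{zero,finite} poly. degree h \<le> d}"
proof -
  have "{h :: 'a poly. degree h \<le> d} \<subseteq> Poly ` {xs. set xs \<subseteq> UNIV \<and> length xs \<le> Suc d}"
  proof
    fix h :: "'a poly" assume "h \<in> {h. degree h \<le> d}"
    then have "length (coeffs h) \<le> Suc d" by (cases "h = 0") (auto simp: length_coeffs_degree)
    then show "h \<in> Poly ` {xs. set xs \<subseteq> UNIV \<and> length xs \<le> Suc d}"
      by (intro image_eqI[of _ _ "coeffs h"]) auto
  qed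
  then show ?thesis
    by (rule finite_subset) (intro finite_imageI finite_lists_length_le finite)
qed

section \<open>The root space of the vectorial polynomial\<close>

text \<open>An axiomatic description of K = F_q(t) inside an algebraically closed field:
  \<open>\<iota>\<close> embeds the constants, \<open>t_trans\<close> makes t transcendental over
  them, and \<open>K_frac\<close> presents every element of \<open>K\<close> as a quotient of
  polynomials in t. The concrete tower of types enters only when the locale is interpreted in the
  final proof.\<close>

locale vectorial =
  fixes \<iota> :: "'a::{field,finite} \<Rightarrow> 'b::alg_closed_field" and t :: 'b and K :: "'b set" and m p k q :: nat
  assumes \<iota>: "hom_on UNIV \<iota>"
    and p: "prime p" "odd p" and card_F: "CARD('a) = q" and q_def: "q = p ^ k"
    and K: "is_subfield K" and \<iota>_K: "range \<iota> \<subseteq> K" and t_K: "t \<in> K"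
    and t_trans: "poly (map_poly \<iota> h) t = 0 \<Longrightarrow> h = 0"
    and K_frac: "a \<in> K \<Longrightarrow> \<exists>h h'. a = poly (map_poly \<iota> h) t / poly (map_poly \<iota> h') t"
    and m: "2 \<le> m"
begin

abbreviation ev :: "'a poly \<Rightarrow> 'b \<Rightarrow> 'b" where "ev h \<equiv> poly (map_poly \<iota> h)"

section \<open>The constant field and the Frobenius map\<close>

lemma UNIV_subfield: "is_subfield (UNIV :: 'a set)"
  by (simp add: is_subfield_def is_subring_def)

lemmas UNIV_subring = subfieldD[OF UNIV_subfield]

lemma \<iota>_0 [simp]: "\<iota> 0 = 0" and \<iota>_1 [simp]: "\<iota> 1 = 1"
  and \<iota>_add: "\<iota> (a + b) = \<iota> a + \<iota> b" and \<iota>_diff: "\<iota> (a - b) = \<iota> a - \<iota> b"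
  and \<iota>_uminus: "\<iota> (- a) = - \<iota> a"
  and \<iota>_mult: "\<iota> (a * b) = \<iota> a * \<iota> b" and \<iota>_power: "\<iota> (a ^ n) = \<iota> a ^ n"
  and \<iota>_inverse: "\<iota> (inverse a) = inverse (\<iota> a)"
  by (simp_all add: hom_on_0[OF UNIV_subring \<iota>] hom_on_1[OF UNIV_subring \<iota>] hom_on_add[OF UNIV_subring \<iota>]
      hom_on_diff[OF UNIV_subring \<iota>] hom_on_uminus[OF UNIV_subring \<iota>] hom_on_mult[OF UNIV_subring \<iota>]
      hom_on_power[OF UNIV_subring \<iota>] hom_on_inverse[OF UNIV_subfield \<iota>])

lemma inj_\<iota>: "inj \<iota>"
  using hom_on_inj[OF UNIV_subfield \<iota>] .

lemma \<iota>_eq_iff [simp]: "\<iota> a = \<iota> b \<longleftrightarrow> a = b"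
  using inj_\<iota> by (auto dest: injD)

lemma \<iota>_eq_0_iff [simp]: "\<iota> a = 0 \<longleftrightarrow> a = 0" and \<iota>_eq_1_iff [simp]: "\<iota> a = 1 \<longleftrightarrow> a = 1"
  using \<iota>_eq_iff[of a 0] \<iota>_eq_iff[of a 1] by simp_all

lemma ev_add: "ev (g + h) y = ev g y + ev h y" and ev_mult: "ev (g * h) y = ev g y * ev h y"
  and ev_diff: "ev (g - h) y = ev g y - ev h y"
  using hom_on_map_poly_add[OF UNIV_subring \<iota>] hom_on_map_poly_diff[OF UNIV_subring \<iota>]
    hom_on_map_poly_mult[OF UNIV_subring \<iota>] by (simp_all add: polys_over_def)

lemma ev_0 [simp]: "ev 0 y = 0" and ev_1 [simp]: "ev 1 y = 1"
  and ev_pCons [simp]: "ev (pCons c h) y = \<iota> c + y * ev h y"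
  by (simp_all add: map_poly_pCons)

lemma ev_power: "ev (h ^ n) y = ev h y ^ n"
  by (induction n) (simp_all add: ev_mult)

lemma ev_monom: "ev (Polynomial.monom c n) y = \<iota> c * y ^ n"
  by (simp add: map_poly_monom poly_monom)

lemma ev_sum: "ev (\<Sum>i\<in>I. h i) y = (\<Sum>i\<in>I. ev (h i) y)"
  by (induction I rule: infinite_finite_induct) (auto simp: ev_add)

lemma of_nat_card: "of_nat q = (0 :: 'a)"
proof -
  have "(\<Sum>y\<in>UNIV. y :: 'a) = (\<Sum>y\<in>UNIV. y + 1)"
    by (rule sum.reindex_bij_witness[of _ "\<lambda>y. y + 1" "\<lambda>y. y - 1"]) auto
  then show ?thesis by (simp add: sum.distrib card_F)
qed

lemma k_pos: "0 < k"
proof (rule ccontr)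
  assume "\<not> 0 < k"
  then have "CARD('a) = 1" using card_F q_def by simp
  then show False by (metis card_1_singletonE UNIV_I singletonD zero_neq_one)
qed

lemma CHAR_b: "CHAR('b) = p"
proof -
  have "of_nat n = \<iota> (of_nat n)" for n
    by (induction n) (simp_all add: \<iota>_add)
  then have "of_nat q = (0 :: 'b)" by (metis of_nat_card \<iota>_0)
  then have "CHAR('b) dvd p ^ k" using of_nat_eq_0_iff_char_dvd[of q, where 'a = 'b] q_def by metis
  moreover have "CHAR('b) \<noteq> 1" by (metis of_nat_CHAR of_nat_1 zero_neq_one)
  ultimately obtain j where j: "CHAR('b) = p ^ j" "j \<noteq> 0"
    using divides_primepow_nat[OF p(1), of "CHAR('b)" k] by (metis power_0)
  have "CHAR('b) > 0" using j p(1) prime_gt_0_nat by simp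
  then have "prime CHAR('b)" using prime_CHAR_semidom[where 'a = 'b] by blast
  then show ?thesis using j(1) by (simp add: prime_power_iff)
qed

lemma q_odd: "odd q" and q_ge: "3 \<le> q"
proof -
  show 1: "odd q" using q_def p by simp
  have "q \<noteq> 1" using q_def k_pos p(1) one_less_power[of p k] prime_gt_1_nat by auto
  moreover have "q \<noteq> 0" using q_def p by auto
  moreover have "q \<noteq> 2" using 1 by auto
  ultimately show "3 \<le> q" by linarith
qed

lemma frobenius_add: "(a + b :: 'b) ^ (q ^ i) = a ^ (q ^ i) + b ^ (q ^ i)"
  by (rule freshmans_dream'[where n = "k * i"]) (simp_all add: CHAR_b p q_def power_mult)

lemma frobenius_sum: "(\<Sum>j\<in>J. f j :: 'b) ^ (q ^ i) = (\<Sum>j\<in>J. f j ^ (q ^ i))"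
  by (rule freshmans_dream_sum'[where n = "k * i"]) (simp_all add: CHAR_b p q_def power_mult)

lemma frobenius_uminus: "(- a :: 'b) ^ (q ^ i) = - (a ^ (q ^ i))"
  using q_odd by simp

lemma frobenius_diff: "(a - b :: 'b) ^ (q ^ i) = a ^ (q ^ i) - b ^ (q ^ i)"
  using frobenius_add[of a "- b" i] frobenius_uminus[of b i] by simp

lemmas frobenius_add1 = frobenius_add[of _ _ 1, simplified]
  and frobenius_diff1 = frobenius_diff[of _ _ 1, simplified]
  and frobenius_sum1 = frobenius_sum[of _ _ 1, simplified]

lemma of_nat_q [simp]: "of_nat q = (0 :: 'b)"
  using of_nat_eq_0_iff_char_dvd[of q, where 'a = 'b] CHAR_b q_def k_pos
  by (metis dvd_power)

lemma power_q: "(c :: 'a) ^ q = c"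
proof (cases "c = 0")
  case False
  have "c * (\<Prod>y\<in>UNIV-{0}. c * y) = c * c ^ (q - 1) * \<Prod>(UNIV-{0})"
    by (simp add: prod.distrib mult_ac card_F)
  also have "c * c ^ (q - 1) = c ^ q"
    using q_ge by (metis One_nat_def Suc_pred' less_le_trans power_Suc zero_less_numeral)
  also have "(\<Prod>y\<in>UNIV-{0}. c * y) = (\<Prod>y\<in>UNIV-{0}. y)"
    by (rule prod.reindex_bij_witness[of _ "\<lambda>y. y / c" "\<lambda>y. c * y"]) (use False in auto)
  finally show ?thesis by simp
qed (use q_ge in auto)

lemma \<iota>_power_q [simp]: "\<iota> c ^ q = \<iota> c"
  by (metis \<iota>_power power_q)

lemma \<iota>_power_q_power [simp]: "\<iota> c ^ (q ^ i) = \<iota> c"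
  by (induction i) (simp_all add: power_mult)

text \<open>The polynomial y^q - y has at most q roots and the constants already supply q. This is
  how a ratio of two vectors is later recognized as a scalar.\<close>

lemma range_\<iota>: "range \<iota> = {y. y ^ q = y}"
proof (rule card_subset_eq)
  define G where "G = Polynomial.monom (1 :: 'b) q - Polynomial.monom 1 1"
  have "coeff G q = 1" using q_ge by (simp add: G_def)
  then have G0: "G \<noteq> 0" by auto
  have roots: "{y. y ^ q = y} = {y. poly G y = 0}" by (auto simp: G_def poly_monom)
  have dG: "degree G \<le> q"
    unfolding G_def using q_ge by (intro degree_diff_le) (auto simp: degree_monom_eq)
  show fin: "finite {y :: 'b. y ^ q = y}" using roots poly_roots_finite[OF G0] by simp
  show sub: "range \<iota> \<subseteq> {y. y ^ q = y}" by auto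
  have "card {y :: 'b. y ^ q = y} \<le> q"
    using roots card_poly_roots_bound[OF G0] dG by simp
  moreover have "card (range \<iota>) = q" using card_image[OF inj_\<iota>] card_F by simp
  ultimately show "card (range \<iota>) = card {y :: 'b. y ^ q = y}" using card_mono[OF fin sub] by simp
qed

text \<open>If \<open>y\<close> were a zero of h \<noteq> 0, every power of t = c(y) would be the
  value at \<open>y\<close> of a remainder modulo h. Over a finite field there are finitely many
  remainders, so two powers of t would agree, against its transcendence.\<close>

lemma transcendental_if_t_polynomial:
  assumes c: "ev c y = t" and h: "ev h y = 0"
  shows "h = 0"
proof (rule ccontr)
  assume h0: "h \<noteq> 0"
  have "t ^ i \<in> (\<lambda>r. ev r y) ` {r. degree r \<le> degree h}" for i
  proof -
    have "c ^ i = h * (c ^ i div h) + c ^ i mod h" by simp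
    then have "ev (c ^ i) y = ev (c ^ i mod h) y" using h by (metis add_0 ev_add ev_mult mult_zero_left)
    then have "t ^ i = ev (c ^ i mod h) y" using c by (simp add: ev_power)
    moreover have "degree (c ^ i mod h) \<le> degree h"
      using degree_mod_less[OF h0, of "c ^ i"] by auto
    ultimately show ?thesis by blast
  qed
  then have "finite (range (\<lambda>i. t ^ i))"
    by (intro finite_subset[OF _ finite_imageI[OF finite_degree_le[of "degree h"]]]) blast
  then have "\<not> inj (\<lambda>i :: nat. t ^ i)" using finite_imageD infinite_UNIV_nat by blast
  then obtain i j :: nat where ij: "t ^ i = t ^ j" "i \<noteq> j" by (auto simp: inj_def)
  then have "ev (Polynomial.monom 1 i - Polynomial.monom 1 j) t = 0" by (simp add: ev_diff ev_monom)
  then have "Polynomial.monom (1 :: 'a) i = Polynomial.monom 1 j" using t_trans by (metis eq_iff_diff_eq_0)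
  then show False using ij(2) by (metis coeff_monom zero_neq_one)
qed

section \<open>The roots of \<open>E\<close> as a vector space over F_q\<close>

definition V :: "'b set" where "V = {v. v ^ (q ^ m) + v ^ q + t * v = 0}"

definition E :: "'b poly" where
  "E = Polynomial.monom 1 (q ^ m) + Polynomial.monom 1 q + Polynomial.monom t 1"

lemma poly_E: "poly E v = v ^ (q ^ m) + v ^ q + t * v"
  by (simp add: E_def poly_monom)

lemma V_roots: "V = {v. poly E v = 0}"
  by (simp add: V_def poly_E)

lemma t_nonzero: "t \<noteq> 0"
  using t_trans[of "[:0, 1:]"] by auto

lemma q_less: "q < q ^ m"
  using power_strict_increasing[of 1 m q] m q_ge by simp

lemma degree_E: "degree E = q ^ m" and E_nonzero: "E \<noteq> 0"
proof -
  have "coeff E (q ^ m) = 1" using q_less q_ge m by (simp add: E_def)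
  then have le: "q ^ m \<le> degree E" and "E \<noteq> 0" by (auto intro: le_degree)
  then show "E \<noteq> 0" by simp
  have "degree E \<le> q ^ m" unfolding E_def
    using q_less q_ge by (intro degree_add_le) (auto intro!: order.trans[OF degree_monom_le])
  with le show "degree E = q ^ m" by simp
qed

lemma rsquarefree_E: "rsquarefree E"
proof (rule rsquarefree_if_pderiv_nonzero)
  have "of_nat (q ^ m) = (0 :: 'b)" using m by simp
  \<comment> \<open>The exponents q^m and q vanish in characteristic p, so the derivative is the
    nonzero constant t.\<close>
  then have "pderiv E = [:t:]"
    by (simp add: E_def pderiv_add pderiv_monom monom_0)
  then show "poly (pderiv E) a \<noteq> 0" for a using t_nonzero by simp
qed (rule E_nonzero)

lemma finite_V: "finite V" and card_V: "card V = q ^ m"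
  using poly_roots_finite[OF E_nonzero] card_roots_rsquarefree[OF rsquarefree_E]
  by (simp_all add: V_roots degree_E)

lemma E_over: assumes "is_subring B" "K \<subseteq> B" shows "E \<in> polys_over B"
  unfolding E_def using assms t_K subring_1
  by (intro polys_over_add[OF assms(1)] polys_over_monom[OF assms(1)]) auto

lemma V_0: "0 \<in> V" using q_ge by (simp add: V_def power_0_left)

lemma V_add: "u \<in> V \<Longrightarrow> v \<in> V \<Longrightarrow> u + v \<in> V"
proof -
  assume "u \<in> V" "v \<in> V"
  then have "(u ^ (q ^ m) + u ^ q + t * u) + (v ^ (q ^ m) + v ^ q + t * v) = 0" by (simp add: V_def)
  then show ?thesis by (simp add: V_def frobenius_add frobenius_add1 algebra_simps)
qed

lemma V_scale: "u \<in> V \<Longrightarrow> \<iota> c * u \<in> V"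
proof -
  assume "u \<in> V"
  then have "\<iota> c * (u ^ (q ^ m) + u ^ q + t * u) = 0" by (simp add: V_def)
  then show ?thesis by (simp add: V_def power_mult_distrib algebra_simps)
qed

lemma V_uminus: "u \<in> V \<Longrightarrow> - u \<in> V"
  using V_scale[of u "- 1"] by (simp add: \<iota>_uminus)

lemma V_diff: "u \<in> V \<Longrightarrow> v \<in> V \<Longrightarrow> u - v \<in> V"
  using V_add[of u "- v"] V_uminus[of v] by simp

end

section \<open>Behaviour at \<open>x = 0\<close>\<close>

text \<open>For a denominator h(x) this splits off the power of x, leaving a factor that is
  invertible at x = 0.\<close>

lemma poly_factor_monom:
  fixes h :: "'a::field poly"
  assumes "h \<noteq> 0"
  shows "\<exists>e h'. h = Polynomial.monom 1 e * h' \<and> coeff h' 0 \<noteq> 0"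
  using assms
proof (induction h)
  case (pCons c h)
  show ?case
  proof (cases "c = 0")
    case True
    with pCons obtain e h' where "h = Polynomial.monom 1 e * h'" "coeff h' 0 \<noteq> 0" by auto
    then have "pCons c h = Polynomial.monom 1 (Suc e) * h'" using True by (simp add: monom_Suc)
    then show ?thesis using \<open>coeff h' 0 \<noteq> 0\<close> by blast
  next
    case False
    then show ?thesis by (intro exI[of _ 0] exI[of _ "pCons c h"]) simp
  qed
qed simp

section \<open>Modules spanned by finite sets, and integrality\<close>

definition lin_comb :: "'b::field set \<Rightarrow> 'b set \<Rightarrow> 'b set" where
  "lin_comb R S = {\<Sum>s\<in>S. f s * s | f. \<forall>s. f s \<in> R}"

lemma lin_combI: "(\<And>s. f s \<in> R) \<Longrightarrow> (\<Sum>s\<in>S. f s * s) \<in> lin_comb R S"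
  by (auto simp: lin_comb_def)

lemma lin_comb_add:
  assumes "is_subring R" "a \<in> lin_comb R S" "b \<in> lin_comb R S"
  shows "a + b \<in> lin_comb R S"
proof -
  obtain f g where f: "\<forall>s. f s \<in> R" "a = (\<Sum>s\<in>S. f s * s)" and g: "\<forall>s. g s \<in> R" "b = (\<Sum>s\<in>S. g s * s)"
    using assms by (auto simp: lin_comb_def)
  then have "a + b = (\<Sum>s\<in>S. (f s + g s) * s)" by (simp add: sum.distrib distrib_right)
  then show ?thesis using lin_combI[of "\<lambda>s. f s + g s" R S] f g subring_add[OF assms(1)] by simp
qed

lemma lin_comb_scale:
  assumes "is_subring R" "r \<in> R" "a \<in> lin_comb R S"
  shows "r * a \<in> lin_comb R S"
proof -
  obtain f where f: "\<forall>s. f s \<in> R" "a = (\<Sum>s\<in>S. f s * s)" using assms by (auto simp: lin_comb_def)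
  then have "r * a = (\<Sum>s\<in>S. (r * f s) * s)" by (simp add: sum_distrib_left mult.assoc)
  then show ?thesis using lin_combI[of "\<lambda>s. r * f s" R S] f subring_mult[OF assms(1,2)] by simp
qed

lemma lin_comb_0: "is_subring R \<Longrightarrow> 0 \<in> lin_comb R S"
  using lin_combI[of "\<lambda>_. 0" R S] subring_0[of R] by simp

lemma lin_comb_sum:
  assumes "is_subring R" "\<And>i. i \<in> I \<Longrightarrow> a i \<in> lin_comb R S"
  shows "sum a I \<in> lin_comb R S"
  using assms(2) by (induction I rule: infinite_finite_induct) (auto simp: lin_comb_0 lin_comb_add assms(1))

lemma lin_comb_gen:
  assumes "is_subring R" "finite S" "s \<in> S"
  shows "s \<in> lin_comb R S"
proof -
  have "(\<Sum>r\<in>S. (if r = s then 1 else 0) * r) = (\<Sum>r\<in>S. if r = s then r else 0)"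
    by (intro sum.cong) auto
  then have "(\<Sum>r\<in>S. (if r = s then 1 else 0) * r) = s" using assms by simp
  moreover have "(\<Sum>r\<in>S. (if r = s then 1 else 0) * r) \<in> lin_comb R S"
    by (rule lin_combI) (simp add: subring_0[OF assms(1)] subring_1[OF assms(1)])
  ultimately show ?thesis by (simp only:)
qed

text \<open>The span of 1, ..., v^(n-1) is closed under multiplication by \<open>v\<close>, since
  the only new power v^n lies in it; Horner evaluation then never leaves the span.\<close>

lemma adjoin_integral:
  assumes B: "is_subring B" and v: "v ^ n \<in> lin_comb B ((\<lambda>j. v ^ j) ` {..<n})"
  shows "adjoin B v \<subseteq> lin_comb B ((\<lambda>j. v ^ j) ` {..<n})"
proof -
  let ?L = "lin_comb B ((\<lambda>j. v ^ j) ` {..<n})"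
  have gen: "v ^ j \<in> ?L" if "j \<le> n" for j
    using v that lin_comb_gen[OF B, of "(\<lambda>j. v ^ j) ` {..<n}" "v ^ j"] by (cases "j = n") auto
  have shift: "v * a \<in> ?L" if a: "a \<in> ?L" for a
  proof -
    obtain f where f: "\<forall>s. f s \<in> B" "a = (\<Sum>s\<in>(\<lambda>j. v ^ j) ` {..<n}. f s * s)"
      using a by (auto simp: lin_comb_def)
    have "v * a = (\<Sum>s\<in>(\<lambda>j. v ^ j) ` {..<n}. f s * (v * s))"
      by (simp add: f(2) sum_distrib_left mult.left_commute)
    moreover have "f s * (v * s) \<in> ?L" if "s \<in> (\<lambda>j. v ^ j) ` {..<n}" for s
    proof -
      obtain j where "j < n" "s = v ^ j" using \<open>s \<in> _\<close> by auto
      then show ?thesis using gen[of "Suc j"] f(1) lin_comb_scale[OF B] by simp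
    qed
    ultimately show ?thesis by (simp only: lin_comb_sum[OF B])
  qed
  have "poly g v \<in> ?L" if "g \<in> polys_over B" for g
    using that
  proof (induction g)
    case (pCons c g)
    then have "c \<in> B" "poly g v \<in> ?L" using polys_over_pCons[OF B] by auto
    then show ?case
      using lin_comb_add[OF B] lin_comb_scale[OF B, of c] gen[of 0] shift by fastforce
  qed (simp add: lin_comb_0[OF B])
  then show ?thesis by (auto simp: adjoin_def)
qed

text \<open>Transitivity of finite generation along the tower: if \<open>S\<close> generates
  \<open>B\<close> over \<open>R\<close>, the products s v^j with j < n generate
  \<open>B[v]\<close>. The generators are integral over the bottom ring \<open>R\<close>, so the
  hypothesis on them survives each enlargement of \<open>B\<close>.\<close>

lemma adjoins_finitely_generated:
  assumes R: "is_subring R" and B: "is_subring B" "R \<subseteq> B" "finite S" "S \<subseteq> B" "B \<subseteq> lin_comb R S"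
    and vs: "\<forall>v\<in>set vs. \<exists>n. v ^ n \<in> lin_comb R ((\<lambda>j. v ^ j) ` {..<n})"
  shows "\<exists>T. finite T \<and> T \<subseteq> adjoins B vs \<and> adjoins B vs \<subseteq> lin_comb R T"
  using B vs
proof (induction vs arbitrary: B S)
  case (Cons v vs)
  note B = Cons.prems(1)
  obtain n where n: "v ^ n \<in> lin_comb R ((\<lambda>j. v ^ j) ` {..<n})" using Cons.prems(6) by auto
  then have "v ^ n \<in> lin_comb B ((\<lambda>j. v ^ j) ` {..<n})"
    using Cons.prems(2) by (auto simp: lin_comb_def)
  from adjoin_integral[OF B this] have ad: "adjoin B v \<subseteq> lin_comb B ((\<lambda>j. v ^ j) ` {..<n})" .
  define T where "T = (\<lambda>(s, j). s * v ^ j) ` (S \<times> {..<n})"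
  have "finite T" using Cons.prems(3) by (simp add: T_def)
  moreover have "T \<subseteq> adjoin B v"
    using Cons.prems(4) adjoin_base[OF B, of v] adjoin_gen[OF B, of v]
      subring_mult[OF is_subring_adjoin[OF B]] subring_power[OF is_subring_adjoin[OF B]]
    by (fastforce simp: T_def)
  moreover have "adjoin B v \<subseteq> lin_comb R T"
  proof
    fix a assume "a \<in> adjoin B v"
    then obtain f where f: "\<forall>s. f s \<in> B" "a = (\<Sum>s\<in>(\<lambda>j. v ^ j) ` {..<n}. f s * s)"
      using ad by (auto simp: lin_comb_def)
    have "b * v ^ j \<in> lin_comb R T" if b: "b \<in> B" and j: "j < n" for b j
    proof -
      obtain g where g: "\<forall>s. g s \<in> R" "b = (\<Sum>s\<in>S. g s * s)"
        using Cons.prems(5) b by (auto simp: lin_comb_def)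
      have "b * v ^ j = (\<Sum>s\<in>S. g s * (s * v ^ j))"
        by (simp add: g(2) sum_distrib_right mult.assoc)
      moreover have "g s * (s * v ^ j) \<in> lin_comb R T" if "s \<in> S" for s
        using g(1) that j
        by (intro lin_comb_scale[OF R] lin_comb_gen[OF R \<open>finite T\<close>]) (auto simp: T_def)
      ultimately show ?thesis by (simp only: lin_comb_sum[OF R])
    qed
    then show "a \<in> lin_comb R T" unfolding f(2) using f(1) by (intro lin_comb_sum[OF R]) auto
  qed
  moreover have "R \<subseteq> adjoin B v" using Cons.prems(2) adjoin_base[OF B] by blast
  ultimately show ?case
    using Cons.IH[OF is_subring_adjoin[OF B], of v T] Cons.prems(6) by auto
qed auto

text \<open>The name is that of projective geometry: the maps u + \<phi>(u) w leave every line
  through the point of \<open>w\<close> invariant.\<close>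

locale center = vectorial +
  fixes w :: 'b
  assumes w: "w \<in> V" "w \<noteq> 0"
begin

section \<open>The coordinate x attached to \<open>w\<close>, and the additive polynomial
  \<open>P\<close>\<close>

definition x :: 'b where "x = w ^ (q - 1)"

definition P :: "'b \<Rightarrow> 'b" where "P u = u ^ q - x * u"

text \<open>The exponent that x collects when it is moved past successive Frobenius powers. In
  particular \<open>e 0\<close> is the N of the theorem, and \<open>e m = 0\<close> makes the
  leading coefficient in the relation for \<open>P u\<close> equal to 1.\<close>

definition e :: "nat \<Rightarrow> nat" where "e i = (\<Sum>j=i..<m. q ^ j)"

lemma w_q: "w ^ q = x * w"
  using q_ge unfolding x_def by (metis le_0_eq not_gr_zero not_numeral_le_zero power_minus_mult)

lemma x_nonzero: "x \<noteq> 0"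
  using w by (simp add: x_def)

lemma P_diff: "P (u - v) = P u - P v" and P_add: "P (u + v) = P u + P v"
  and P_scale: "P (\<iota> c * u) = \<iota> c * P u"
  by (simp_all add: P_def frobenius_diff1 frobenius_add1 power_mult_distrib algebra_simps)

lemma P_w: "P w = 0"
  by (simp add: P_def w_q)

lemma P_eq_0_iff: "P u = 0 \<longleftrightarrow> (\<exists>c. u = \<iota> c * w)"
proof
  assume "P u = 0"
  then have "(u / w) ^ q = u / w" using w x_nonzero by (simp add: P_def power_divide w_q)
  then obtain c where "u / w = \<iota> c" using range_\<iota> by blast
  then show "\<exists>c. u = \<iota> c * w" using w(2) by (metis nonzero_divide_eq_eq)
qed (auto simp: P_scale P_w)

lemma e_Suc: "i < m \<Longrightarrow> e i = q ^ i + e (Suc i)"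
  by (simp add: e_def sum.atLeast_Suc_lessThan)

text \<open>The factorization \<open>\<tau>\<^sup>m - x\<^bsup>e 0\<^esup> = (\<Sum>i<m. x\<^bsup>e (i+1)\<^esup> \<tau>\<^sup>i) (\<tau> - x)\<close> of twisted polynomials in the
  Frobenius \<open>\<tau>\<close>; it makes \<open>P u\<close>, for \<open>u \<in> V\<close>, the root of a monic polynomial over \<open>F\<^sub>q[x]\<close>.\<close>

lemma P_telescope: "(\<Sum>i<m. x ^ e (Suc i) * P u ^ (q ^ i)) = u ^ (q ^ m) - x ^ e 0 * u"
proof -
  have "(\<Sum>i<m. x ^ e (Suc i) * P u ^ (q ^ i)) =
      (\<Sum>i<m. x ^ e (Suc i) * u ^ (q ^ Suc i) - x ^ e i * u ^ (q ^ i))"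
    by (intro sum.cong refl)
       (simp add: P_def frobenius_diff e_Suc power_add power_mult_distrib algebra_simps flip: power_mult)
  also have "\<dots> = x ^ e m * u ^ (q ^ m) - x ^ e 0 * u ^ (q ^ 0)"
    by (rule sum_lessThan_telescope)
  finally show ?thesis by (simp add: e_def)
qed

text \<open>The telescoping identity at u = w, where \<open>P w = 0\<close>, reads w^(q^m) = x^N w.
  Inserting this into the equation of \<open>w\<close> in \<open>V\<close> and cancelling
  \<open>w\<close> exhibits t as a polynomial in x.\<close>

lemma t_eq: "t = - (x ^ e 0 + x)"
proof -
  have "w ^ (q ^ m) = x ^ e 0 * w"
    using P_telescope[of w] q_ge by (simp add: P_w power_0_left)
  then have "(x ^ e 0 + x + t) * w = 0" using w(1) by (simp add: V_def w_q algebra_simps)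
  then have "x ^ e 0 + x + t = 0" using w(2) by simp
  then show ?thesis by (rule minus_unique[symmetric])
qed

text \<open>The equation of \<open>u\<close> in \<open>V\<close> says u^(q^m) - x^N u + (u^q - x u)
  = 0 once t is expressed through x; the bracket is \<open>P u\<close>, and the telescoping identity
  turns the rest into a polynomial in \<open>P u\<close>.\<close>

lemma P_relation:
  assumes "u \<in> V"
  shows "P u + (\<Sum>i<m. x ^ e (Suc i) * P u ^ (q ^ i)) = 0"
proof -
  have "u ^ (q ^ m) + u ^ q + t * u = 0" using assms by (simp add: V_def)
  moreover have "t * u = - (x ^ e 0 * u) - x * u" by (subst t_eq) (simp add: algebra_simps)
  ultimately show ?thesis unfolding P_telescope by (simp add: P_def algebra_simps)
qed

lemma x_trans: "ev h x = 0 \<Longrightarrow> h = 0"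
  by (rule transcendental_if_t_polynomial[of "- (Polynomial.monom 1 (e 0) + Polynomial.monom 1 1)" x])
     (simp_all add: t_eq ev_diff ev_add ev_monom flip: diff_0)

section \<open>The ring generated over F_q[x] by the values of \<open>P\<close>\<close>

definition Z :: "'b set" where "Z = P ` V"

definition zs :: "'b list" where "zs = (SOME l. set l = Z)"

lemma set_zs: "set zs = Z"
proof -
  have "finite Z" by (simp add: Z_def finite_V)
  then show ?thesis unfolding zs_def by (rule someI_ex[OF finite_list])
qed

definition Rx :: "'b set" where "Rx = range (\<lambda>h. ev h x)"

lemma is_subring_Rx: "is_subring Rx"
proof -
  have "1 = ev 1 x" by simp
  then have "1 \<in> Rx" unfolding Rx_def by blast
  then show ?thesis
    unfolding is_subring_def Rx_def by (auto simp flip: ev_diff ev_mult)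
qed

definition Ox :: "'b set" where "Ox = adjoins Rx zs"

lemma is_subring_Ox: "is_subring Ox"
  unfolding Ox_def by (rule is_subring_adjoins[OF is_subring_Rx])

lemma Rx_Ox: "Rx \<subseteq> Ox" and Z_Ox: "Z \<subseteq> Ox"
  using adjoins_base[OF is_subring_Rx] adjoins_gen[OF is_subring_Rx, of zs] set_zs by (auto simp: Ox_def)

lemma x_Rx: "x \<in> Rx" and \<iota>_Rx: "\<iota> c \<in> Rx"
proof -
  have "x = ev [:0, 1:] x" "\<iota> c = ev [:c:] x" by simp_all
  then show "x \<in> Rx" "\<iota> c \<in> Rx" unfolding Rx_def by blast+
qed

lemma e_pos: "Suc i < m \<Longrightarrow> 0 < e (Suc i)"
  using q_ge by (simp add: e_Suc)

lemma sum_split_last: "(\<Sum>i<m. f i) = (\<Sum>i<m - 1. f i) + f (m - 1 :: nat)" for f :: "nat \<Rightarrow> 'b"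
  using m sum.lessThan_Suc[of f "m - 1"] by simp

lemma Z_relation:
  assumes "z \<in> Z"
  shows "z ^ (q ^ (m - 1)) + z = - (\<Sum>i<m - 1. x ^ e (Suc i) * z ^ (q ^ i))"
proof -
  have "z + (\<Sum>i<m. x ^ e (Suc i) * z ^ (q ^ i)) = 0" using assms P_relation by (auto simp: Z_def)
  moreover have "e (Suc (m - 1)) = 0" using m by (simp add: e_def)
  ultimately have "z + ((\<Sum>i<m - 1. x ^ e (Suc i) * z ^ (q ^ i)) + z ^ (q ^ (m - 1))) = 0"
    unfolding sum_split_last by simp
  then show ?thesis by (simp add: eq_neg_iff_add_eq_0 add_ac)
qed

lemma Z_integral:
  assumes "z \<in> Z"
  shows "z ^ (q ^ (m - 1)) \<in> lin_comb Rx ((\<lambda>j. z ^ j) ` {..<q ^ (m - 1)})"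
proof -
  let ?L = "lin_comb Rx ((\<lambda>j. z ^ j) ` {..<q ^ (m - 1)})"
  have lt: "q ^ i < q ^ (m - 1)" if "i < m - 1" for i
    using that q_ge by (intro power_strict_increasing) auto
  have gen: "z ^ j \<in> ?L" if "j < q ^ (m - 1)" for j
    using that lin_comb_gen[OF is_subring_Rx, of "(\<lambda>j. z ^ j) ` {..<q ^ (m - 1)}"] by auto
  have "- (x ^ e (Suc i)) * z ^ (q ^ i) \<in> ?L" if "i \<in> {..<m - 1}" for i
    using that lt[of i] gen[of "q ^ i"] x_Rx subring_power[OF is_subring_Rx] subring_uminus[OF is_subring_Rx]
    by (intro lin_comb_scale[OF is_subring_Rx]) auto
  then have "(\<Sum>i<m - 1. - (x ^ e (Suc i)) * z ^ (q ^ i)) \<in> ?L"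
    by (rule lin_comb_sum[OF is_subring_Rx])
  \<comment> \<open>The lone summand -z has exponent 1, which is below q^(m-1) because m \<ge>
    2.\<close>
  moreover have "- 1 * z ^ 1 \<in> ?L"
    using lt[of 0] m gen[of 1] subring_1[OF is_subring_Rx] subring_uminus[OF is_subring_Rx]
    by (intro lin_comb_scale[OF is_subring_Rx]) auto
  ultimately have "- 1 * z ^ 1 + (\<Sum>i<m - 1. - (x ^ e (Suc i)) * z ^ (q ^ i)) \<in> ?L"
    by (intro lin_comb_add[OF is_subring_Rx])
  also have "- 1 * z ^ 1 + (\<Sum>i<m - 1. - (x ^ e (Suc i)) * z ^ (q ^ i)) = z ^ (q ^ (m - 1))"
  proof -
    have "z ^ (q ^ (m - 1)) = - (\<Sum>i<m - 1. x ^ e (Suc i) * z ^ (q ^ i)) - z"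
      using Z_relation[OF assms] by (metis add_diff_cancel_right')
    then show ?thesis by (simp only:) (simp add: sum_negf)
  qed
  finally show ?thesis .
qed

lemma Ox_finitely_generated: "\<exists>S. finite S \<and> S \<subseteq> Ox \<and> Ox \<subseteq> lin_comb Rx S"
proof -
  have "Rx \<subseteq> lin_comb Rx {1}" by (auto simp: lin_comb_def)
  moreover have "{1} \<subseteq> Rx" using subring_1[OF is_subring_Rx] by simp
  ultimately show ?thesis
    unfolding Ox_def using Z_integral set_zs
    by (intro adjoins_finitely_generated[OF is_subring_Rx is_subring_Rx order_refl, of "{1}"]) auto
qed

text \<open>If \<open>1/x\<close> were in \<open>Ox\<close>, multiplication by \<open>1/x\<close> would preserve the finite set \<open>Y\<close> of combinations of
  the generators with coefficients of bounded degree, and \<open>x\<close> would be a root of unity.\<close>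

lemma inverse_x_notin_Ox: "1 / x \<notin> Ox"
proof
  assume inv: "1 / x \<in> Ox"
  obtain S where S: "finite S" "S \<subseteq> Ox" "Ox \<subseteq> lin_comb Rx S" using Ox_finitely_generated by blast
  have rep: "\<exists>g. a = (\<Sum>s\<in>S. ev (g s) x * s)" if "a \<in> Ox" for a
  proof -
    have "a \<in> lin_comb Rx S" using S(3) that by blast
    then obtain f where f: "\<forall>s. f s \<in> Rx" "a = (\<Sum>s\<in>S. f s * s)" unfolding lin_comb_def by blast
    then have "\<forall>s. \<exists>h. f s = ev h x" by (auto simp: Rx_def)
    then obtain g where "\<forall>s. f s = ev (g s) x" by metis
    then show ?thesis using f(2) by auto
  qed
  have "\<forall>s\<in>S. \<exists>g. s / x = (\<Sum>r\<in>S. ev (g r) x * r)"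
  proof
    fix s assume "s \<in> S"
    then have "s * (1 / x) \<in> Ox" using inv S(2) by (intro subring_mult[OF is_subring_Ox]) auto
    then show "\<exists>g. s / x = (\<Sum>r\<in>S. ev (g r) x * r)" using rep by simp
  qed
  then obtain G where G: "\<And>s. s \<in> S \<Longrightarrow> s / x = (\<Sum>r\<in>S. ev (G s r) x * r)" by metis
  obtain g1 where g1: "1 = (\<Sum>s\<in>S. ev (g1 s) x * s)" using rep[OF subring_1[OF is_subring_Ox]] by metis
  \<comment> \<open>One bound for the degrees occurring when s/x, for each generator s, and the
    element 1 are expanded in the generators.\<close>
  define D where "D = Max (insert 0 ((\<lambda>(s, r). degree (G s r)) ` (S \<times> S) \<union> (\<lambda>s. degree (g1 s)) ` S))"
  have D: "degree (G s r) \<le> D" "degree (g1 s) \<le> D" if "s \<in> S" "r \<in> S" for s r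
    unfolding D_def using S(1) that by (auto intro!: Max_ge)
  define Y where "Y = {\<Sum>s\<in>S. ev (g s) x * s | g. \<forall>s\<in>S. degree (g s) \<le> D}"
  have "Y \<subseteq> (\<lambda>g. \<Sum>s\<in>S. ev (g s) x * s) ` (PiE S (\<lambda>_. {h. degree h \<le> D}))"
  proof
    fix y assume "y \<in> Y"
    then obtain g where g: "y = (\<Sum>s\<in>S. ev (g s) x * s)" "\<forall>s\<in>S. degree (g s) \<le> D" by (auto simp: Y_def)
    then show "y \<in> (\<lambda>g. \<Sum>s\<in>S. ev (g s) x * s) ` (PiE S (\<lambda>_. {h. degree h \<le> D}))"
      by (intro image_eqI[of _ _ "restrict g S"]) auto
  qed
  then have finY: "finite Y"
    by (rule finite_subset) (intro finite_imageI finite_PiE S(1) finite_degree_le)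
  have "1 \<in> Y" unfolding Y_def by (intro CollectI exI[of _ g1] conjI g1 ballI D(2))
  have step: "y / x \<in> Y" if y: "y \<in> Y" for y
  proof -
    obtain g where g: "y = (\<Sum>s\<in>S. ev (g s) x * s)" "\<forall>s\<in>S. degree (g s) \<le> D" using y by (auto simp: Y_def)
    \<comment> \<open>Each coefficient is split as c + x h. Dividing by x leaves h, of no larger
      degree, while the constant multiplies s/x, which is expanded again with coefficients of degree
      at most \<open>D\<close>. So the bound does not grow.\<close>
    have "\<forall>s. \<exists>c h. g s = pCons c h" by (metis pCons_cases)
    then obtain c h where ch: "\<And>s. g s = pCons (c s) (h s)" by metis
    define g' where "g' r = (\<Sum>s\<in>S. smult (c s) (G s r)) + h r" for r
    have "y / x = (\<Sum>s\<in>S. \<iota> (c s) * (s / x)) + (\<Sum>s\<in>S. ev (h s) x * s)"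
      unfolding g(1) sum_divide_distrib ch ev_pCons sum.distrib[symmetric]
      using x_nonzero by (intro sum.cong) (auto simp: field_simps)
    also have "(\<Sum>s\<in>S. \<iota> (c s) * (s / x)) = (\<Sum>s\<in>S. \<Sum>r\<in>S. \<iota> (c s) * ev (G s r) x * r)"
      by (intro sum.cong refl) (simp add: G sum_distrib_left mult.assoc)
    also have "\<dots> = (\<Sum>r\<in>S. \<Sum>s\<in>S. \<iota> (c s) * ev (G s r) x * r)"
      by (rule sum.swap)
    also have "\<dots> + (\<Sum>s\<in>S. ev (h s) x * s) = (\<Sum>r\<in>S. ev (g' r) x * r)"
      unfolding sum.distrib[symmetric]
    proof (intro sum.cong refl)
      fix r
      have "ev (smult a b) x = \<iota> a * ev b x" for a b
        using ev_mult[of "[:a:]" b x] by simp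
      then show "(\<Sum>s\<in>S. \<iota> (c s) * ev (G s r) x * r) + ev (h r) x * r = ev (g' r) x * r"
        by (simp add: g'_def ev_add ev_sum sum_distrib_right distrib_right)
    qed
    finally have "y / x = (\<Sum>r\<in>S. ev (g' r) x * r)" .
    moreover have "degree (g' r) \<le> D" if r: "r \<in> S" for r
    proof -
      have "degree (h r) \<le> degree (g r)" unfolding ch by (simp add: degree_pCons_eq_if)
      then have "degree (h r) \<le> D" using g(2) r le_trans by blast
      moreover have "degree (\<Sum>s\<in>S. smult (c s) (G s r)) \<le> D"
        using D(1) r by (intro degree_sum_le[OF S(1)]) (auto intro: order.trans[OF degree_smult_le])
      ultimately show ?thesis unfolding g'_def by (intro degree_add_le)
    qed
    ultimately show ?thesis unfolding Y_def by (intro CollectI exI[of _ g'] conjI ballI)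
  qed
  have "1 / x ^ i \<in> Y" for i
  proof (induction i)
    case (Suc i)
    have "1 / x ^ Suc i = 1 / x ^ i / x" by simp
    then show ?case using step[OF Suc] by (simp only:)
  qed (use \<open>1 \<in> Y\<close> in simp)
  then have "finite (range (\<lambda>i. 1 / x ^ i))" by (intro finite_subset[OF _ finY]) blast
  then have "\<not> inj (\<lambda>i :: nat. 1 / x ^ i)" using finite_imageD infinite_UNIV_nat by blast
  then obtain i j :: nat where ij: "x ^ i = x ^ j" "i \<noteq> j" using x_nonzero by (auto simp: inj_def)
  then have "ev (Polynomial.monom 1 i - Polynomial.monom 1 j) x = 0" by (simp add: ev_diff ev_monom)
  then have "Polynomial.monom (1 :: 'a) i = Polynomial.monom 1 j" using x_trans by (metis eq_iff_diff_eq_0)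
  then show False using ij(2) by (metis coeff_monom zero_neq_one)
qed

lemma x_Ox: "x \<in> Ox"
  using x_Rx Rx_Ox by blast

section \<open>Localization at x = 0 and reducedness modulo x\<close>

lemma x_not_unit_Ox: "s \<in> Ox \<Longrightarrow> x * s \<noteq> \<iota> c" if "c \<noteq> 0"
proof
  assume s: "s \<in> Ox" "x * s = \<iota> c"
  have "x * (\<iota> (inverse c) * s) = inverse (\<iota> c) * (x * s)" by (simp add: \<iota>_inverse)
  also have "\<dots> = 1" using s(2) that by simp
  finally have "x * (\<iota> (inverse c) * s) = 1" .
  then have "1 / x = \<iota> (inverse c) * s" using x_nonzero by (simp add: field_simps)
  then show False
    using inverse_x_notin_Ox s(1) subring_mult[OF is_subring_Ox] \<iota>_Rx Rx_Ox by (metis subsetD)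
qed

text \<open>Denominators are the h(x) with h(0) \<noteq> 0 and nothing more, so this ring lives over
  x = 0 but keeps all places above that point together; no prime of \<open>Ox\<close> is
  chosen.\<close>

definition Lx :: "'b set" where
  "Lx = {\<theta>. \<exists>h. coeff h 0 \<noteq> 0 \<and> ev h x * \<theta> \<in> Ox}"

lemma ev_Ox: "ev h x \<in> Ox"
  using Rx_Ox by (auto simp: Rx_def)

lemma is_subring_Lx: "is_subring Lx"
  unfolding is_subring_def
proof (intro conjI ballI)
  show "1 \<in> Lx"
    unfolding Lx_def using subring_1[OF is_subring_Ox] by (auto intro!: exI[of _ 1])
  fix a b assume "a \<in> Lx" "b \<in> Lx"
  then obtain g h where gh: "coeff g 0 \<noteq> 0" "ev g x * a \<in> Ox" "coeff h 0 \<noteq> 0" "ev h x * b \<in> Ox"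
    by (auto simp: Lx_def)
  have c: "coeff (g * h) 0 \<noteq> 0" using gh by (simp add: coeff_mult_0)
  have "ev (g * h) x * (a - b) = ev h x * (ev g x * a) - ev g x * (ev h x * b)"
    by (simp add: ev_mult algebra_simps)
  also have "\<dots> \<in> Ox" by (intro subring_closed[OF is_subring_Ox] gh ev_Ox)
  finally show "a - b \<in> Lx" using c unfolding Lx_def by blast
  have "ev (g * h) x * (a * b) = (ev g x * a) * (ev h x * b)"
    by (simp add: ev_mult algebra_simps)
  also have "\<dots> \<in> Ox" by (intro subring_closed[OF is_subring_Ox] gh)
  finally show "a * b \<in> Lx" using c unfolding Lx_def by blast
qed

lemma Ox_Lx: "Ox \<subseteq> Lx"
  unfolding Lx_def by (auto intro!: exI[of _ 1])

lemma x_Lx: "x \<in> Lx"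
  using x_Ox Ox_Lx by blast

lemma ev_nonzero: "coeff h 0 \<noteq> 0 \<Longrightarrow> ev h x \<noteq> 0"
  using x_trans by force

lemma inverse_ev_Lx: "coeff h 0 \<noteq> 0 \<Longrightarrow> inverse (ev h x) \<in> Lx"
  unfolding Lx_def using ev_nonzero subring_1[OF is_subring_Ox] by (auto intro!: exI[of _ h])

text \<open>Clear the denominator of an inverse \<open>s\<close> by h(x) = c + x g(x) with c
  \<noteq> 0. From x s = 1 follows x (h(x) s - g(x)) = c, which would make x invertible already in
  \<open>Ox\<close>.\<close>

lemma x_not_unit_Lx: "s \<in> Lx \<Longrightarrow> x * s \<noteq> 1"
proof
  assume s: "s \<in> Lx" "x * s = 1"
  then obtain h where h: "coeff h 0 \<noteq> 0" "ev h x * s \<in> Ox" by (auto simp: Lx_def)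
  obtain c g where cg: "h = pCons c g" by (rule pCons_cases)
  have "x * (ev h x * s) = ev h x" using s(2) by (simp add: algebra_simps)
  then have "x * (ev h x * s - ev g x) = \<iota> c" by (simp add: cg algebra_simps)
  moreover have "ev h x * s - ev g x \<in> Ox" by (intro subring_diff[OF is_subring_Ox] h(2) ev_Ox)
  ultimately show False using x_not_unit_Ox[of c] h(1) cg by simp
qed

text \<open>The square of n = q^(m-1): modulo x the n-th power sends a generator z to -z, and doing
  this twice removes the sign.\<close>

definition Q :: nat where "Q = q ^ (2 * (m - 1))"

lemma Q_ge: "q \<le> Q"
  unfolding Q_def using m q_ge by (intro self_le_power) auto

text \<open>Modulo \<open>x\<close> the generators \<open>z\<close> of \<open>Ox\<close> satisfy \<open>z\<^bsup>q^(m-1)\<^esup> = -z\<close>, hence \<open>z\<^sup>Q = z\<close>; so the whole quotient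
  consists of fixed points of the \<open>Q\<close>-Frobenius and is reduced.\<close>

definition fixed_mod_x :: "'b set \<Rightarrow> 'b set" where
  "fixed_mod_x B = {\<theta>\<in>B. \<exists>s\<in>B. \<theta> ^ Q - \<theta> = x * s}"

lemma is_subring_fixed_mod_x:
  assumes B: "is_subring B"
  shows "is_subring (fixed_mod_x B)"
  unfolding is_subring_def
proof (intro conjI ballI)
  show "1 \<in> fixed_mod_x B"
    unfolding fixed_mod_x_def using subring_0[OF B] subring_1[OF B] by (auto intro!: bexI[of _ 0])
  fix a b assume "a \<in> fixed_mod_x B" "b \<in> fixed_mod_x B"
  then obtain r s where rs: "a \<in> B" "b \<in> B" "r \<in> B" "s \<in> B" "a ^ Q - a = x * r" "b ^ Q - b = x * s"
    by (auto simp: fixed_mod_x_def)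
  have "(a - b) ^ Q - (a - b) = x * (r - s)"
    using rs(5,6) by (simp add: Q_def frobenius_diff algebra_simps)
  then show "a - b \<in> fixed_mod_x B"
    unfolding fixed_mod_x_def using rs subring_diff[OF B] by blast
  have "(a * b) ^ Q - a * b = a ^ Q * (b ^ Q - b) + (a ^ Q - a) * b"
    by (simp add: power_mult_distrib algebra_simps)
  also have "\<dots> = x * (a ^ Q * s + r * b)" using rs(5,6) by (simp add: algebra_simps)
  finally have "(a * b) ^ Q - a * b = x * (a ^ Q * s + r * b)" .
  moreover have "a * b \<in> B" "a ^ Q * s + r * b \<in> B" using rs by (auto intro!: subring_closed[OF B])
  ultimately show "a * b \<in> fixed_mod_x B" unfolding fixed_mod_x_def by blast
qed

text \<open>For i < m-1 the exponents \<open>e (Suc i)\<close> are positive, so one factor x can be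
  taken out of every remaining term.\<close>

lemma Z_Ox_relation:
  assumes "z \<in> Z"
  obtains s where "s \<in> Ox" "z ^ (q ^ (m - 1)) + z = x * s"
proof -
  define s where "s = - (\<Sum>i<m - 1. x ^ (e (Suc i) - 1) * z ^ (q ^ i))"
  have "s \<in> Ox" unfolding s_def
    using assms Z_Ox x_Ox by (intro subring_closed[OF is_subring_Ox]) auto
  moreover have "z ^ (q ^ (m - 1)) + z = x * s"
    unfolding Z_relation[OF assms] s_def mult_minus_right sum_distrib_left
    using e_pos by (auto intro!: sum.cong simp: mult.assoc[symmetric] power_Suc[symmetric] simp del: power_Suc)
  ultimately show ?thesis using that by blast
qed

text \<open>The elements fixed modulo x form a subring because \<open>Q\<close> is a power of q, so
  it suffices to check x, the constants and \<open>Z\<close>.\<close>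

lemma fixed_mod_x_Ox: "fixed_mod_x Ox = Ox"
proof
  note T = is_subring_fixed_mod_x[OF is_subring_Ox]
  have "Q > 0" using Q_ge q_ge by simp
  have x: "x \<in> fixed_mod_x Ox"
  proof -
    have "x ^ Q - x = x * (x ^ (Q - 1) - 1)"
      using \<open>Q > 0\<close> by (simp add: right_diff_distrib flip: power_Suc)
    moreover have "x ^ (Q - 1) - 1 \<in> Ox" using x_Ox by (intro subring_closed[OF is_subring_Ox])
    ultimately show ?thesis unfolding fixed_mod_x_def using x_Ox by blast
  qed
  have c: "\<iota> c \<in> fixed_mod_x Ox" for c
    unfolding fixed_mod_x_def Q_def using \<iota>_Rx Rx_Ox subring_0[OF is_subring_Ox] by (auto intro!: bexI[of _ 0])
  have "ev h x \<in> fixed_mod_x Ox" for h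
    by (induction h) (auto intro!: subring_closed[OF T] x c)
  then have R: "Rx \<subseteq> fixed_mod_x Ox" by (auto simp: Rx_def)
  have "z \<in> fixed_mod_x Ox" if z: "z \<in> Z" for z
  proof -
    obtain s where s: "s \<in> Ox" "z ^ (q ^ (m - 1)) + z = x * s" by (rule Z_Ox_relation[OF z])
    define n where "n = q ^ (m - 1)"
    have n: "n > 0" using q_ge by (simp add: n_def)
    have Q: "Q = n * n" by (simp add: Q_def n_def mult_2 power_add)
    \<comment> \<open>The n-th power is additive, so (z^n + z)^n = z^Q + z^n and the two terms z^n
      cancel. Everything is now expressed by z^n + z, which is divisible by x.\<close>
    have "z ^ Q - z = (z ^ n + z) ^ n - (z ^ n + z)"
      by (simp add: Q frobenius_add power_mult n_def)
    also have "\<dots> = x * (x ^ (n - 1) * s ^ n - s)"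
    proof -
      have s': "z ^ n + z = x * s" using s(2) by (simp add: n_def)
      have xn: "x ^ n = x * x ^ (n - 1)" using n by (simp flip: power_Suc)
      show ?thesis unfolding s' power_mult_distrib xn by (simp add: algebra_simps)
    qed
    finally show ?thesis
      unfolding fixed_mod_x_def using s(1) x_Ox z Z_Ox
      by (auto intro!: bexI[of _ "x ^ (n - 1) * s ^ n - s"] subring_closed[OF is_subring_Ox])
  qed
  then have "adjoins Rx zs \<subseteq> fixed_mod_x Ox" by (intro adjoins_least[OF T R]) (auto simp: set_zs)
  then show "Ox \<subseteq> fixed_mod_x Ox" by (simp add: Ox_def)
qed (auto simp: fixed_mod_x_def)

text \<open>The only new point is the inverse of a denominator H, and for it the difference of
  \<open>Q\<close>-th power and element is -(H^Q - H) divided by H^(Q+1), again a multiple of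
  x.\<close>

lemma fixed_mod_x_Lx: "fixed_mod_x Lx = Lx"
proof
  note T = is_subring_fixed_mod_x[OF is_subring_Lx]
  have O: "Ox \<subseteq> fixed_mod_x Lx"
    using fixed_mod_x_Ox Ox_Lx unfolding fixed_mod_x_def by blast
  show "Lx \<subseteq> fixed_mod_x Lx"
  proof
    fix a assume "a \<in> Lx"
    then obtain h where h: "coeff h 0 \<noteq> 0" "ev h x * a \<in> Ox" by (auto simp: Lx_def)
    define H where "H = ev h x"
    have H: "H \<noteq> 0" "inverse H \<in> Lx" using ev_nonzero inverse_ev_Lx h(1) by (auto simp: H_def)
    have "H \<in> fixed_mod_x Lx" using O ev_Ox by (auto simp: H_def)
    then obtain s where s: "s \<in> Lx" "H ^ Q - H = x * s" by (auto simp: fixed_mod_x_def)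
    have "inverse H ^ Q - inverse H = - (H ^ Q - H) * (inverse H ^ Q * inverse H)"
      using H(1) by (simp add: field_simps)
    also have "\<dots> = x * (- s * (inverse H ^ Q * inverse H))" using s(2) by simp
    finally have "inverse H \<in> fixed_mod_x Lx"
      unfolding fixed_mod_x_def using H(2) s(1)
      by (auto intro!: bexI[of _ "- s * (inverse H ^ Q * inverse H)"] subring_closed[OF is_subring_Lx])
    moreover have "H * a \<in> fixed_mod_x Lx" using O h(2) by (auto simp: H_def)
    ultimately have "inverse H * (H * a) \<in> fixed_mod_x Lx" by (rule subring_mult[OF T])
    then show "a \<in> fixed_mod_x Lx" using H(1) by (simp flip: mult.assoc)
  qed
qed (auto simp: fixed_mod_x_def)

text \<open>Modulo x one has a = a^Q, and Q \<ge> q \<ge> n makes a^Q a multiple of a^n. The range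
  of n covers the exponents q - 1 and q used below.\<close>

lemma Lx_reduced:
  assumes a: "a \<in> Lx" and n: "1 \<le> n" "n \<le> q" and s: "s \<in> Lx" "a ^ n = x * s"
  shows "\<exists>r\<in>Lx. a = x * r"
proof -
  obtain r where r: "r \<in> Lx" "a ^ Q - a = x * r" using a fixed_mod_x_Lx by (auto simp: fixed_mod_x_def)
  have "a ^ Q = a ^ n * a ^ (Q - n)" using n Q_ge by (simp flip: power_add)
  then have "a = x * (s * a ^ (Q - n) - r)" using r(2) s(2) by (simp add: algebra_simps)
  moreover have "s * a ^ (Q - n) - r \<in> Lx" using a s r by (intro subring_closed[OF is_subring_Lx])
  ultimately show ?thesis by blast
qed

section \<open>The field \<open>Mx\<close> and the elements excluded from it\<close>

definition Kx :: "'b set" where "Kx = {ev g x / ev h x | g h. h \<noteq> 0}"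

lemma ev_eq_0_iff: "ev h x = 0 \<longleftrightarrow> h = 0"
  using x_trans by auto

lemma KxI: "a = ev g x / ev h x \<Longrightarrow> h \<noteq> 0 \<Longrightarrow> a \<in> Kx"
  unfolding Kx_def by blast

lemma is_subfield_Kx: "is_subfield Kx"
  unfolding is_subfield_def is_subring_def
proof (intro conjI ballI)
  show "1 \<in> Kx" by (rule KxI[of _ 1 1]) auto
  fix a assume "a \<in> Kx"
  then obtain g h where a: "a = ev g x / ev h x" "h \<noteq> 0" by (auto simp: Kx_def)
  show "inverse a \<in> Kx"
  proof (cases "g = 0")
    case True
    then show ?thesis using a \<open>a \<in> Kx\<close> by simp
  qed (use a in \<open>auto intro: KxI[of _ h g]\<close>)
  fix b assume "b \<in> Kx"
  then obtain g' h' where b: "b = ev g' x / ev h' x" "h' \<noteq> 0" by (auto simp: Kx_def)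
  have "ev h x \<noteq> 0" "ev h' x \<noteq> 0" using a(2) b(2) by (simp_all add: ev_eq_0_iff)
  then have "a - b = ev (g * h' - g' * h) x / ev (h * h') x"
    unfolding a(1) b(1) by (simp add: ev_diff ev_mult diff_frac_eq mult.commute)
  then show "a - b \<in> Kx" by (rule KxI) (use a(2) b(2) in simp)
  have "a * b = ev (g * g') x / ev (h * h') x"
    using a b by (simp add: ev_mult)
  then show "a * b \<in> Kx" by (rule KxI) (use a(2) b(2) in simp)
qed

lemma Rx_Kx: "Rx \<subseteq> Kx"
proof
  fix a assume "a \<in> Rx"
  then obtain h where "a = ev h x / ev 1 x" by (auto simp: Rx_def)
  then show "a \<in> Kx" unfolding Kx_def using one_neq_zero by blast
qed

lemma K_Kx: "K \<subseteq> Kx"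
proof
  fix a assume "a \<in> K"
  then obtain g h where gh: "a = ev g t / ev h t" using K_frac by blast
  have R: "Rx \<subseteq> Kx" by (rule Rx_Kx)
  note S = subfieldD[OF is_subfield_Kx]
  have "t \<in> Kx" unfolding t_eq using x_Rx R by (intro subring_closed[OF S]) auto
  then have "ev g t \<in> Kx" for g
    by (induction g) (use \<iota>_Rx R in \<open>auto intro!: subring_closed[OF S]\<close>)
  then show "a \<in> Kx" unfolding gh by (intro subfield_divide[OF is_subfield_Kx])
qed

definition Mx :: "'b set" where "Mx = adjoins Kx zs"

lemma is_subfield_Mx: "is_subfield Mx"
  unfolding Mx_def
proof (intro is_subfield_adjoins[OF is_subfield_Kx] ballI)
  note S = subfieldD[OF is_subfield_Kx]
  fix z assume "z \<in> set zs"
  then have z: "z \<in> Z" by (simp add: set_zs)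
  define g where "g = Polynomial.monom 1 1 + (\<Sum>i<m. Polynomial.monom (x ^ e (Suc i)) (q ^ i))"
  have "x \<in> Kx" using x_Rx Rx_Kx by blast
  have c: "coeff (Polynomial.monom a n) j \<in> Kx" if "a \<in> Kx" for a n j
    using polys_over_monom[OF S that] by (simp add: polys_over_def)
  have g: "g \<in> polys_over Kx"
    unfolding g_def polys_over_def mem_Collect_eq coeff_add coeff_sum
    by (intro allI subring_add[OF S] subring_sum[OF S] c subring_1[OF S] subring_power[OF S] \<open>x \<in> Kx\<close>)
  \<comment> \<open>Only the summand i = m-1 has this degree, and its coefficient is x^0; the
    separate linear term stays away because q^(m-1) > 1. So \<open>g\<close> is not the zero
    polynomial.\<close>
  have "coeff g (q ^ (m - 1)) = (\<Sum>i<m. if i = m - 1 then 1 else 0)"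
  proof -
    have "q ^ (m - 1) \<noteq> 1" using m q_ge by simp
    then have 1: "coeff (Polynomial.monom 1 1) (q ^ (m - 1)) = (0 :: 'b)" by (metis coeff_monom)
    have 2: "coeff (Polynomial.monom (x ^ e (Suc i)) (q ^ i)) (q ^ (m - 1)) = (if i = m - 1 then 1 else 0)" for i
      using q_ge m by (auto simp: e_def power_inject_exp)
    show ?thesis unfolding g_def coeff_add coeff_sum 1 2 by simp
  qed
  also have "\<dots> = (1 :: 'b)" using m by simp
  finally have "g \<noteq> 0" by auto
  moreover have "poly g z = 0"
    using z P_relation by (auto simp: g_def poly_sum poly_monom Z_def)
  ultimately show "algebraic_over Kx z" using g unfolding algebraic_over_def by blast
qed

lemma x_Mx: "x \<in> Mx" and K_Mx: "K \<subseteq> Mx" and Z_Mx: "Z \<subseteq> Mx"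
  using adjoins_base[OF subfieldD[OF is_subfield_Kx], of zs] adjoins_gen[OF subfieldD[OF is_subfield_Kx], of zs]
    x_Rx Rx_Kx K_Kx set_zs by (auto simp: Mx_def)

text \<open>Powers of x are the only denominators left: the elements cleared by some power of x form
  a ring containing \<open>Z\<close> and, after splitting off the power of x from a denominator,
  also F_q(x).\<close>

lemma Mx_Lx:
  assumes "a \<in> Mx"
  shows "\<exists>i. x ^ i * a \<in> Lx"
proof -
  note L = subring_closed[OF is_subring_Lx]
  have "is_subring {a. \<exists>i. x ^ i * a \<in> Lx}" (is "is_subring ?D")
    unfolding is_subring_def
  proof (intro conjI ballI)
    show "1 \<in> ?D" using L(2) by (auto intro!: exI[of _ 0])
    fix a b assume "a \<in> ?D" "b \<in> ?D"
    then obtain i j where ij: "x ^ i * a \<in> Lx" "x ^ j * b \<in> Lx" by auto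
    have "x ^ (i + j) * (a - b) = x ^ j * (x ^ i * a) - x ^ i * (x ^ j * b)"
      by (simp add: power_add algebra_simps)
    also have "\<dots> \<in> Lx" by (intro L(5,6,7) ij x_Lx)
    finally show "a - b \<in> ?D" by blast
    have "x ^ (i + j) * (a * b) = (x ^ i * a) * (x ^ j * b)" by (simp add: power_add algebra_simps)
    also have "\<dots> \<in> Lx" by (intro L(6) ij)
    finally show "a * b \<in> ?D" by blast
  qed
  moreover have "Kx \<subseteq> ?D"
  proof
    fix a assume "a \<in> Kx"
    then obtain g h where a: "a = ev g x / ev h x" "h \<noteq> 0" by (auto simp: Kx_def)
    obtain i h' where h': "h = Polynomial.monom 1 i * h'" "coeff h' 0 \<noteq> 0"
      using poly_factor_monom[OF a(2)] by blast
    have "x ^ i * a = ev g x * inverse (ev h' x)"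
      using a(1) x_nonzero by (simp add: h'(1) ev_mult ev_monom divide_inverse)
    also have "\<dots> \<in> Lx" using ev_Ox Ox_Lx inverse_ev_Lx[OF h'(2)] by (intro L(6)) auto
    finally show "a \<in> ?D" by blast
  qed
  moreover have "Z \<subseteq> ?D" using Z_Ox Ox_Lx by (auto intro!: exI[of _ 0])
  ultimately have "Mx \<subseteq> ?D" unfolding Mx_def by (intro adjoins_least) (auto simp: set_zs)
  then show ?thesis using assms by blast
qed

text \<open>Takes the place of integral closedness. For the least i with x^i a in \<open>Lx\<close>,
  a positive i would make the n-th power of x^i a divisible by x; by reducedness x^i a itself is
  divisible, and i could be lowered.\<close>

lemma integral_in_Lx:
  assumes a: "a \<in> Mx" and n: "1 \<le> n" "n \<le> q"
    and step: "\<And>i. 1 \<le> i \<Longrightarrow> x ^ i * a \<in> Lx \<Longrightarrow> \<exists>s\<in>Lx. (x ^ i * a) ^ n = x * s"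
  shows "a \<in> Lx"
proof -
  obtain i0 where "x ^ i0 * a \<in> Lx" using Mx_Lx[OF a] by blast
  define i where "i = (LEAST i. x ^ i * a \<in> Lx)"
  have i: "x ^ i * a \<in> Lx" unfolding i_def by (rule LeastI) fact
  have "i = 0"
  proof (rule ccontr)
    assume "i \<noteq> 0"
    then obtain s where "s \<in> Lx" "(x ^ i * a) ^ n = x * s" using step[OF _ i] by auto
    from Lx_reduced[OF i n this] obtain r where r: "r \<in> Lx" "x ^ i * a = x * r" by blast
    have "x ^ i = x * x ^ (i - 1)" using \<open>i \<noteq> 0\<close> by (simp flip: power_Suc)
    then have "x ^ (i - 1) * a = r" using r(2) x_nonzero by simp
    then have "x ^ (i - 1) * a \<in> Lx" using r(1) by simp
    then have "i \<le> i - 1" unfolding i_def by (rule Least_le)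
    then show False using \<open>i \<noteq> 0\<close> by simp
  qed
  then show ?thesis using i by simp
qed

text \<open>\<open>Mx\<close> is unramified at \<open>x = 0\<close>, so it contains no proper root of \<open>x\<close>.\<close>

lemma w_power_notin_Mx:
  assumes "0 < j" "j < q - 1"
  shows "w ^ j \<notin> Mx"
proof
  note L = subring_closed[OF is_subring_Lx]
  assume M: "w ^ j \<in> Mx"
  have pw: "(w ^ j) ^ (q - 1) = x ^ j" by (simp add: x_def mult.commute flip: power_mult)
  have "w ^ j \<in> Lx"
  proof (rule integral_in_Lx[OF M, of "q - 1"])
    fix i :: nat assume "1 \<le> i"
    have "(x ^ i * w ^ j) ^ (q - 1) = x ^ (i * (q - 1) + j)"
      by (simp only: power_mult_distrib pw power_add power_mult)
    also have "\<dots> = x * x ^ (i * (q - 1) + j - 1)"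
      using assms by (simp flip: power_Suc)
    finally show "\<exists>s\<in>Lx. (x ^ i * w ^ j) ^ (q - 1) = x * s" using L(7) x_Lx by blast
  qed (use q_ge in auto)
  moreover have "(w ^ j) ^ (q - 1) = x * x ^ (j - 1)" using assms pw by (simp flip: power_Suc)
  moreover have "1 \<le> q - 1" "q - 1 \<le> q" using q_ge by auto
  ultimately obtain r where r: "r \<in> Lx" "w ^ j = x * r"
    using Lx_reduced[of "w ^ j" "q - 1" "x ^ (j - 1)"] L(7)[OF x_Lx] by blast
  \<comment> \<open>Raising w^j = x r to the power q - 1 gives x^j = x^(q-1) r^(q-1). As j < q - 1,
    cancelling x^j leaves a positive power of x that is invertible.\<close>
  have "x ^ j * (x ^ (q - 1 - j) * r ^ (q - 1)) = x ^ (q - 1) * r ^ (q - 1)"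
    using assms by (simp flip: power_add mult.assoc)
  also have "\<dots> = x ^ j" using pw r(2) by (simp add: power_mult_distrib)
  finally have "x ^ (q - 1 - j) * r ^ (q - 1) = 1" using x_nonzero by simp
  moreover have "x ^ (q - 1 - j) = x * x ^ (q - 1 - j - 1)"
    using power_minus_mult[of "q - 1 - j" x] assms by (simp add: mult.commute)
  ultimately have "x * (x ^ (q - 1 - j - 1) * r ^ (q - 1)) = 1" by (simp add: mult.assoc)
  moreover have "x ^ (q - 1 - j - 1) * r ^ (q - 1) \<in> Lx" using r x_Lx by (intro L)
  ultimately show False using x_not_unit_Lx by blast
qed

text \<open>In the relation for z every summand with i \<ge> 1 is a q-th power, and the coefficient
  of z itself is 1 + x^(e 1), also a q-th power. Hence h(x)^q z = -s^q with h(0) = 1, and h(x) is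
  invertible in \<open>Lx\<close>.\<close>

lemma Z_qth_root:
  assumes z: "z \<in> Z"
  obtains y where "y \<in> Lx" "y ^ q = z"
proof -
  note L = subring_closed[OF is_subring_Lx]
  \<comment> \<open>The exponents of \<open>e\<close> after division by q: \<open>e (Suc i)\<close>
    is q times \<open>e1 i\<close>.\<close>
  define e1 where "e1 i = (\<Sum>j=i..<m - 1. q ^ j)" for i
  have e1: "e (Suc i) = e1 i * q" for i
  proof -
    have "e (Suc i) = (\<Sum>j=i..<m - 1. q ^ Suc j)"
      unfolding e_def using m sum.shift_bounds_Suc_ivl[of "\<lambda>j. q ^ j" i "m - 1"] by simp
    then show ?thesis by (simp only: e1_def sum_distrib_right power_Suc2)
  qed
  define s where "s = (\<Sum>i=1..<m. x ^ e1 i * z ^ (q ^ (i - 1)))"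
  define h :: "'a poly" where "h = 1 + Polynomial.monom 1 (e1 0)"
  have "e1 0 \<noteq> 0" using m by (simp add: e1_def sum.atLeast_Suc_lessThan)
  then have h0: "coeff h 0 \<noteq> 0" by (simp add: h_def)
  have evh: "ev h x = 1 + x ^ e1 0" by (simp add: h_def ev_add ev_monom)
  have "z + (\<Sum>i<m. x ^ e (Suc i) * z ^ (q ^ i)) = 0" using z P_relation by (auto simp: Z_def)
  also have "(\<Sum>i<m. x ^ e (Suc i) * z ^ (q ^ i)) = x ^ e 1 * z + (\<Sum>i=1..<m. x ^ e (Suc i) * z ^ (q ^ i))"
    using m by (simp add: lessThan_atLeast0 sum.atLeast_Suc_lessThan)
  also have "(\<Sum>i=1..<m. x ^ e (Suc i) * z ^ (q ^ i)) = s ^ q"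
    unfolding s_def frobenius_sum1
  proof (intro sum.cong refl)
    fix i assume "i \<in> {1..<m}"
    then have "q ^ i = q ^ (i - 1) * q" by (simp flip: power_Suc2)
    then show "x ^ e (Suc i) * z ^ (q ^ i) = (x ^ e1 i * z ^ (q ^ (i - 1))) ^ q"
      by (simp add: e1 power_mult power_mult_distrib)
  qed
  also have "x ^ e 1 = (x ^ e1 0) ^ q" using e1[of 0] by (simp add: power_mult)
  finally have *: "(ev h x) ^ q * z + s ^ q = 0"
    by (simp add: evh frobenius_add1 algebra_simps)
  define y where "y = - s * inverse (ev h x)"
  have "s \<in> Lx" unfolding s_def using x_Lx z Z_Ox Ox_Lx by (intro L) auto
  then have "y \<in> Lx" unfolding y_def using inverse_ev_Lx[OF h0] by (intro L)
  moreover have "y ^ q = z"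
  proof -
    have "(- s) ^ q = - (s ^ q)" using frobenius_uminus[of s 1] by simp
    also have "\<dots> = (ev h x) ^ q * z" using * by (simp add: eq_neg_iff_add_eq_0 add.commute minus_unique)
    finally have "y ^ q = (ev h x) ^ q * z * inverse (ev h x) ^ q"
      by (simp only: y_def power_mult_distrib)
    then show ?thesis using ev_nonzero[OF h0] by (simp add: field_simps)
  qed
  ultimately show ?thesis using that by blast
qed

text \<open>Here \<open>z = P u\<close> is a \<open>q\<close>-th power \<open>y\<^sup>q\<close> in \<open>Lx\<close>, so \<open>r = u - y\<close> satisfies \<open>r\<^sup>q = x u\<close>.  Since \<open>Lx\<close> modulo
  \<open>x\<close> is reduced, \<open>x\<close> divides \<open>r\<close>, then \<open>u\<close>, then \<open>y\<close> and \<open>z\<close>; but \<open>z\<close> is a unit modulo \<open>x\<close>.\<close>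

lemma V_notin_Mx:
  assumes u: "u \<in> V" "P u \<noteq> 0"
  shows "u \<notin> Mx"
proof
  note L = subring_closed[OF is_subring_Lx]
  assume M: "u \<in> Mx"
  define z where "z = P u"
  have z: "z \<in> Z" "z \<noteq> 0" using u by (auto simp: z_def Z_def)
  have zL: "z \<in> Lx" using z Z_Ox Ox_Lx by blast
  have uq: "u ^ q = x * u + z" by (simp add: z_def P_def)
  have uL: "u \<in> Lx"
  proof (rule integral_in_Lx[OF M, of q])
    fix i :: nat assume i: "1 \<le> i" "x ^ i * u \<in> Lx"
    have "i \<le> i * q" "1 \<le> i * q" using i q_ge by auto
    \<comment> \<open>Using u^q = x u + z, the q-th power becomes visibly divisible by x; in the
      first term x^i is kept next to u so that the cofactor lies in \<open>Lx\<close>.\<close>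
    have "(x ^ i * u) ^ q = x ^ (i * q) * (x * u + z)" by (simp add: power_mult_distrib uq power_mult)
    also have "\<dots> = x * (x ^ (i * q - i) * (x ^ i * u)) + x ^ (i * q) * z"
      using \<open>i \<le> i * q\<close> by (simp add: algebra_simps flip: power_add)
    also have "x ^ (i * q) = x * x ^ (i * q - 1)" using \<open>1 \<le> i * q\<close> by (simp flip: power_Suc)
    finally have "(x ^ i * u) ^ q = x * (x ^ (i * q - i) * (x ^ i * u) + x ^ (i * q - 1) * z)"
      by (simp add: algebra_simps)
    moreover have "x ^ (i * q - i) * (x ^ i * u) + x ^ (i * q - 1) * z \<in> Lx"
      by (rule L(4)[OF L(6)[OF L(7)[OF x_Lx] i(2)] L(6)[OF L(7)[OF x_Lx] zL]])
    ultimately show "\<exists>s\<in>Lx. (x ^ i * u) ^ q = x * s" by blast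
  qed (use q_ge in auto)
  obtain y where y: "y \<in> Lx" "y ^ q = z" by (rule Z_qth_root[OF z(1)])
  have "(u - y) ^ q = x * u" by (simp add: frobenius_diff1 uq y(2))
  then obtain r where r: "r \<in> Lx" "u - y = x * r"
    using Lx_reduced[of "u - y" q u] uL y(1) L(5) q_ge by auto
  have "x * u = x * (x * (x ^ (q - 2) * r ^ q))"
  proof -
    have "x * u = x ^ q * r ^ q" using \<open>(u - y) ^ q = x * u\<close> r(2) by (simp add: power_mult_distrib)
    also have "x ^ q = x ^ Suc (Suc (q - 2))" using q_ge by (intro arg_cong[of _ _ "\<lambda>n. x ^ n"]) simp
    finally show ?thesis by (simp add: mult.assoc)
  qed
  then have "u = x * (x ^ (q - 2) * r ^ q)" using x_nonzero by simp
  define y' where "y' = x ^ (q - 2) * r ^ q - r"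
  have y': "y' \<in> Lx" "y = x * y'"
  proof -
    show "y' \<in> Lx" unfolding y'_def by (intro L(5,6,7) r(1) x_Lx)
    have "y = u - x * r" using r(2) by (simp add: algebra_simps)
    also have "\<dots> = x * y'"
      by (subst \<open>u = x * _\<close>) (simp add: y'_def right_diff_distrib)
    finally show "y = x * y'" .
  qed
  define z' where "z' = x ^ (q - 1) * y' ^ q"
  have z': "z' \<in> Lx" unfolding z'_def using y'(1) x_Lx by (intro L)
  have zz': "z = x * z'"
  proof -
    have "z = x ^ q * y' ^ q" using y(2) y'(2) by (simp add: power_mult_distrib)
    also have "x ^ q = x * x ^ (q - 1)" using q_ge by (simp flip: power_Suc)
    finally show ?thesis by (simp add: z'_def mult.assoc)
  qed
  define n where "n = q ^ (m - 1)"
  have n: "2 \<le> n" unfolding n_def using m q_ge self_le_power[of q "m - 1"] by simp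
  define s where "s = - (\<Sum>i<m - 1. x ^ (e (Suc i) - 1) * z ^ (q ^ i - 1))"
  have s: "s \<in> Lx" unfolding s_def using x_Lx zL by (intro L)
  \<comment> \<open>Dividing the relation for z by z gives z^(n-1) + 1 as a multiple of x. Since x
    divides z and n \<ge> 2, it would also divide 1.\<close>
  have "z * (z ^ (n - 1) + 1) = z * (x * s)"
  proof -
    have "z * (z ^ (n - 1) + 1) = z ^ n + z" using n by (simp add: distrib_left flip: power_Suc)
    also have "\<dots> = - (\<Sum>i<m - 1. x ^ e (Suc i) * z ^ (q ^ i))"
      using Z_relation[OF z(1)] by (simp add: n_def)
    also have "(\<Sum>i<m - 1. x ^ e (Suc i) * z ^ (q ^ i)) =
        (\<Sum>i<m - 1. z * (x * (x ^ (e (Suc i) - 1) * z ^ (q ^ i - 1))))"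
    proof (intro sum.cong refl)
      fix i assume "i \<in> {..<m - 1}"
      then have "0 < e (Suc i)" "0 < q ^ i" using e_pos[of i] q_ge by auto
      then have "x ^ e (Suc i) = x * x ^ (e (Suc i) - 1)" "z ^ (q ^ i) = z * z ^ (q ^ i - 1)"
        by (simp_all flip: power_Suc)
      then show "x ^ e (Suc i) * z ^ (q ^ i) = z * (x * (x ^ (e (Suc i) - 1) * z ^ (q ^ i - 1)))"
        by simp
    qed
    finally show ?thesis by (simp add: s_def sum_distrib_left)
  qed
  then have "z ^ (n - 1) + 1 = x * s" using z(2) by simp
  moreover have "z ^ (n - 1) = x * (z' * z ^ (n - 2))"
  proof -
    have "z ^ (n - 1) = z * z ^ (n - 2)"
      using power_minus_mult[of "n - 1" z] n by (simp add: mult.commute numeral_2_eq_2)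
    then show ?thesis using zz' by (metis mult.assoc)
  qed
  ultimately have "x * (s - z' * z ^ (n - 2)) = 1" by (simp add: algebra_simps)
  moreover have "s - z' * z ^ (n - 2) \<in> Lx" using s z' zL by (intro L)
  ultimately show False using x_not_unit_Lx by blast
qed

end

section \<open>Pseudoreflections in the Galois group\<close>

context vectorial
begin

section \<open>Functionals, bases and coordinates on the root space\<close>

definition lin_on_V :: "('b \<Rightarrow> 'a) \<Rightarrow> bool" where
  "lin_on_V \<phi> \<longleftrightarrow> (\<forall>u\<in>V. \<forall>v\<in>V. \<phi> (u + v) = \<phi> u + \<phi> v) \<and> (\<forall>u\<in>V. \<forall>c. \<phi> (\<iota> c * u) = c * \<phi> u)"

lemma lin_on_V_add: "lin_on_V \<phi> \<Longrightarrow> u \<in> V \<Longrightarrow> v \<in> V \<Longrightarrow> \<phi> (u + v) = \<phi> u + \<phi> v"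
  and lin_on_V_scale: "lin_on_V \<phi> \<Longrightarrow> u \<in> V \<Longrightarrow> \<phi> (\<iota> c * u) = c * \<phi> u"
  by (auto simp: lin_on_V_def)

lemma lin_on_V_0: "lin_on_V \<phi> \<Longrightarrow> \<phi> 0 = 0"
  using lin_on_V_scale[of \<phi> 0 0] V_0 by simp

lemma lin_on_V_diff: "lin_on_V \<phi> \<Longrightarrow> u \<in> V \<Longrightarrow> v \<in> V \<Longrightarrow> \<phi> (u - v) = \<phi> u - \<phi> v"
  using lin_on_V_add[of \<phi> "u - v" v] V_diff by (simp add: algebra_simps)

lemma V_sum: "(\<And>i. i \<in> I \<Longrightarrow> f i \<in> V) \<Longrightarrow> (\<Sum>i\<in>I. \<iota> (g i) * f i) \<in> V"
  by (induction I rule: infinite_finite_induct) (auto intro: V_0 V_add V_scale)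

lemma lin_on_V_sum:
  assumes "lin_on_V \<phi>" "\<And>i. i \<in> I \<Longrightarrow> f i \<in> V"
  shows "\<phi> (\<Sum>i\<in>I. \<iota> (g i) * f i) = (\<Sum>i\<in>I. g i * \<phi> (f i))"
  using assms(2)
  by (induction I rule: infinite_finite_induct)
     (auto simp: lin_on_V_0 lin_on_V_add lin_on_V_scale V_sum V_scale assms(1))

definition indep :: "nat \<Rightarrow> (nat \<Rightarrow> 'b) \<Rightarrow> bool" where
  "indep n f \<longleftrightarrow> (\<forall>i<n. f i \<in> V) \<and> (\<forall>g. (\<Sum>i<n. \<iota> (g i) * f i) = 0 \<longrightarrow> (\<forall>i<n. g i = 0))"

lemma indep_V: "indep n f \<Longrightarrow> i < n \<Longrightarrow> f i \<in> V"
  by (simp add: indep_def)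

lemma indepD:
  assumes "indep n f" "(\<Sum>i<n. \<iota> (g i) * f i) = 0" "i < n"
  shows "g i = 0"
proof -
  have "\<forall>g. (\<Sum>i<n. \<iota> (g i) * f i) = 0 \<longrightarrow> (\<forall>i<n. g i = 0)" using assms(1) by (simp add: indep_def)
  then have "(\<Sum>i<n. \<iota> (g i) * f i) = 0 \<longrightarrow> (\<forall>i<n. g i = 0)" by (rule spec)
  then show ?thesis using assms(2,3) by simp
qed

lemma indep_eq:
  assumes "indep n f" "(\<Sum>i<n. \<iota> (g i) * f i) = (\<Sum>i<n. \<iota> (h i) * f i)" "i < n"
  shows "g i = h i"
proof -
  have "(\<Sum>i<n. \<iota> (g i - h i) * f i) = 0"
    using assms(2) by (simp add: \<iota>_diff left_diff_distrib sum_subtractf)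
  then have "g i - h i = 0" by (rule indepD[OF assms(1) _ assms(3), of "\<lambda>i. g i - h i"])
  then show ?thesis by simp
qed

text \<open>Dimension by counting: n vectors have at most q^n combinations, fewer than the q^m
  elements of \<open>V\<close>.\<close>

lemma indep_extend_one:
  assumes f: "indep n f" and n: "n < m"
  shows "\<exists>v. indep (Suc n) (f(n := v))"
proof -
  define S where "S = (\<lambda>g. \<Sum>i<n. \<iota> (g i) * f i) ` PiE {..<n} (\<lambda>_. UNIV)"
  have "card S \<le> card (PiE {..<n} (\<lambda>_. UNIV :: 'a set))"
    unfolding S_def by (intro card_image_le finite_PiE) auto
  also have "\<dots> = q ^ n" by (simp add: card_PiE card_F)
  also have "\<dots> < card V" using n q_ge by (simp add: card_V)
  finally have "card S < card V" .
  moreover have "finite S" unfolding S_def by (intro finite_imageI finite_PiE) auto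
  ultimately have "\<not> V \<subseteq> S" using card_mono[of S V] by linarith
  then obtain v where v: "v \<in> V" "v \<notin> S" by blast
  have vS: "v \<noteq> (\<Sum>i<n. \<iota> (g i) * f i)" for g
  proof
    assume "v = (\<Sum>i<n. \<iota> (g i) * f i)"
    then have "v = (\<Sum>i<n. \<iota> (restrict g {..<n} i) * f i)" by simp
    then have "v \<in> S" unfolding S_def by (intro image_eqI[of _ _ "restrict g {..<n}"]) auto
    then show False using v(2) by blast
  qed
  have "\<forall>i<Suc n. g i = 0" if g: "(\<Sum>i<Suc n. \<iota> (g i) * (f(n := v)) i) = 0" for g
  proof -
    have s: "(\<Sum>i<n. \<iota> (g i) * f i) + \<iota> (g n) * v = 0" using g by simp
    have "g n = 0"
    proof (rule ccontr)
      assume gn: "g n \<noteq> 0"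
      have "\<iota> (g n) * v = - (\<Sum>i<n. \<iota> (g i) * f i)" using s by (simp add: eq_neg_iff_add_eq_0 add.commute)
      then have "\<iota> (inverse (g n)) * (\<iota> (g n) * v) = \<iota> (inverse (g n)) * - (\<Sum>i<n. \<iota> (g i) * f i)" by simp
      then have "v = (\<Sum>i<n. \<iota> (- inverse (g n) * g i) * f i)"
        using gn by (simp add: \<iota>_inverse \<iota>_mult \<iota>_uminus sum_distrib_left sum_negf mult.assoc flip: mult.assoc[of "inverse _" "\<iota> (g n)" v])
      from vS this show False by (rule notE)
    qed
    moreover from this have "\<forall>i<n. g i = 0" using s indepD[OF f] by simp
    ultimately show ?thesis by (simp add: less_Suc_eq)
  qed
  then have "indep (Suc n) (f(n := v))" using indep_V[OF f] v(1) unfolding indep_def by (simp add: less_Suc_eq)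
  then show ?thesis by blast
qed

lemma indep_extend:
  assumes "indep n f" "n \<le> m"
  shows "\<exists>f'. indep m f' \<and> (\<forall>i<n. f' i = f i)"
  using assms
proof (induction "m - n" arbitrary: n f)
  case 0
  then show ?case by (intro exI[of _ f]) auto
next
  case (Suc k)
  obtain v where v: "indep (Suc n) (f(n := v))" using indep_extend_one Suc by force
  have "k = m - Suc n" "Suc n \<le> m" using Suc.hyps(2) by auto
  then obtain f' where "indep m f'" "\<forall>i<Suc n. f' i = (f(n := v)) i" using Suc.hyps(1)[OF _ v] by blast
  then show ?case by (intro exI[of _ f']) auto
qed

text \<open>Counting again: the q^m combinations of independent vectors are distinct and therefore
  exhaust \<open>V\<close>.\<close>

lemma indep_span:
  assumes f: "indep m f" and u: "u \<in> V"
  shows "\<exists>g. u = (\<Sum>i<m. \<iota> (g i) * f i)"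
proof -
  let ?F = "PiE {..<m} (\<lambda>_. UNIV :: 'a set)"
  let ?c = "\<lambda>g. \<Sum>i<m. \<iota> (g i) * f i"
  have "inj_on ?c ?F"
  proof (rule inj_onI)
    fix g h assume gh: "g \<in> ?F" "h \<in> ?F" "?c g = ?c h"
    show "g = h" by (rule PiE_ext[OF gh(1,2)]) (use indep_eq[OF f gh(3)] in auto)
  qed
  then have "card (?c ` ?F) = card V" by (simp add: card_image card_PiE card_F card_V)
  moreover have "?c ` ?F \<subseteq> V" using indep_V[OF f] by (auto intro!: V_sum)
  ultimately have "?c ` ?F = V" by (intro card_subset_eq finite_V)
  then show ?thesis using u by blast
qed

definition coord :: "(nat \<Rightarrow> 'b) \<Rightarrow> nat \<Rightarrow> 'b \<Rightarrow> 'a" where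
  "coord f i u = (SOME g. u = (\<Sum>i<m. \<iota> (g i) * f i)) i"

lemma coord_sum:
  assumes "indep m f" "u \<in> V"
  shows "(\<Sum>i<m. \<iota> (coord f i u) * f i) = u"
  unfolding coord_def using someI_ex[OF indep_span[OF assms]] by (rule sym)

lemma coord_eq:
  assumes f: "indep m f" and i: "i < m"
  shows "coord f i (\<Sum>i<m. \<iota> (g i) * f i) = g i"
  by (rule indep_eq[OF f coord_sum[OF f] i]) (use indep_V[OF f] in \<open>auto intro!: V_sum\<close>)

lemma lin_on_V_coord:
  assumes f: "indep m f" and i: "i < m"
  shows "lin_on_V (coord f i)"
  unfolding lin_on_V_def
proof (intro conjI ballI allI)
  fix u v assume uv: "u \<in> V" "v \<in> V"
  have "u + v = (\<Sum>i<m. \<iota> (coord f i u + coord f i v) * f i)"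
    by (simp add: \<iota>_add distrib_right sum.distrib coord_sum[OF f] uv)
  from arg_cong[OF this, of "coord f i"]
  show "coord f i (u + v) = coord f i u + coord f i v" by (simp only: coord_eq[OF f i])
next
  fix u c assume u: "u \<in> V"
  have "\<iota> c * u = (\<Sum>i<m. \<iota> (c * coord f i u) * f i)"
    by (subst coord_sum[OF f u, symmetric]) (simp add: \<iota>_mult sum_distrib_left mult.assoc)
  from arg_cong[OF this, of "coord f i"]
  show "coord f i (\<iota> c * u) = c * coord f i u" by (simp only: coord_eq[OF f i])
qed

lemma coord_basis:
  assumes f: "indep m f" and ij: "i < m" "j < m"
  shows "coord f i (f j) = (if i = j then 1 else 0)"
proof -
  have "f j = (\<Sum>k<m. \<iota> (if k = j then 1 else 0) * f k)"
    using ij by (simp add: if_distrib[of \<iota>] if_distrib[of "\<lambda>a. a * _"] cong: if_cong)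
  then have "coord f i (f j) = coord f i (\<Sum>k<m. \<iota> (if k = j then 1 else 0) * f k)" by simp
  then show ?thesis unfolding coord_eq[OF f ij(1)] .
qed

lemma lin_on_V_eqI:
  assumes f: "indep m f" and l: "lin_on_V \<phi>" "lin_on_V \<phi>'" "\<And>i. i < m \<Longrightarrow> \<phi> (f i) = \<phi>' (f i)"
    and u: "u \<in> V"
  shows "\<phi> u = \<phi>' u"
proof -
  have "\<phi> (\<Sum>i<m. \<iota> (coord f i u) * f i) = \<phi>' (\<Sum>i<m. \<iota> (coord f i u) * f i)"
  proof -
    have "\<phi> (\<Sum>i<m. \<iota> (coord f i u) * f i) = (\<Sum>i<m. coord f i u * \<phi> (f i))"
      by (rule lin_on_V_sum[OF l(1)]) (simp add: indep_V[OF f])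
    moreover have "\<phi>' (\<Sum>i<m. \<iota> (coord f i u) * f i) = (\<Sum>i<m. coord f i u * \<phi>' (f i))"
      by (rule lin_on_V_sum[OF l(2)]) (simp add: indep_V[OF f])
    ultimately show ?thesis using l(3) by simp
  qed
  then show ?thesis by (simp add: coord_sum[OF f u])
qed

section \<open>The splitting field of \<open>E\<close> over \<open>K\<close> and its
  automorphisms\<close>

definition vs :: "'b list" where "vs = (SOME l. set l = V)"

lemma set_vs: "set vs = V"
  unfolding vs_def by (rule someI_ex[OF finite_list[OF finite_V]])

definition M :: "'b set" where "M = adjoins K vs"

lemma V_algebraic: "is_subring B \<Longrightarrow> K \<subseteq> B \<Longrightarrow> v \<in> V \<Longrightarrow> algebraic_over B v"
  unfolding algebraic_over_def using E_over E_nonzero V_roots by blast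

lemma is_subfield_M: "is_subfield M"
  unfolding M_def using V_algebraic[OF subfieldD[OF K]] by (intro is_subfield_adjoins[OF K]) (auto simp: set_vs)

lemmas is_subring_M = subfieldD[OF is_subfield_M]

lemma K_M: "K \<subseteq> M" and V_M: "V \<subseteq> M"
  using adjoins_base[OF subfieldD[OF K]] adjoins_gen[OF subfieldD[OF K], of vs] by (auto simp: M_def set_vs)

lemma M_least: "is_subring B \<Longrightarrow> K \<subseteq> B \<Longrightarrow> V \<subseteq> B \<Longrightarrow> M \<subseteq> B"
  unfolding M_def by (rule adjoins_least) (auto simp: set_vs)

lemma \<iota>_M: "\<iota> c \<in> M" and \<iota>_K': "\<iota> c \<in> K"
  using \<iota>_K K_M by blast+

text \<open>Only the behaviour on \<open>M\<close> is prescribed, so two such maps are compared on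
  \<open>M\<close> alone. That they preserve \<open>M\<close> and are bijective on it is derived,
  since they permute the finite set \<open>V\<close>.\<close>

definition Gal :: "('b \<Rightarrow> 'b) \<Rightarrow> bool" where
  "Gal \<sigma> \<longleftrightarrow> hom_on M \<sigma> \<and> (\<forall>a\<in>K. \<sigma> a = a)"

context
  fixes \<sigma> assumes \<sigma>: "Gal \<sigma>"
begin

lemma Gal_hom: "hom_on M \<sigma>" and Gal_K: "a \<in> K \<Longrightarrow> \<sigma> a = a"
  using \<sigma> by (auto simp: Gal_def)

lemmas Gal_add = hom_on_add[OF is_subring_M Gal_hom]
  and Gal_mult = hom_on_mult[OF is_subring_M Gal_hom]
  and Gal_diff = hom_on_diff[OF is_subring_M Gal_hom]
  and Gal_power = hom_on_power[OF is_subring_M Gal_hom]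
  and Gal_0 = hom_on_0[OF is_subring_M Gal_hom]
  and Gal_1 = hom_on_1[OF is_subring_M Gal_hom]

lemma Gal_\<iota>: "\<sigma> (\<iota> c) = \<iota> c"
  using Gal_K \<iota>_K' by blast

lemma Gal_scale: "u \<in> V \<Longrightarrow> \<sigma> (\<iota> c * u) = \<iota> c * \<sigma> u"
  using Gal_mult \<iota>_M V_M Gal_\<iota> by (metis subsetD)

lemma Gal_V: assumes "u \<in> V" shows "\<sigma> u \<in> V"
proof -
  have u: "u \<in> M" using assms V_M by blast
  have t: "t \<in> M" using t_K K_M by blast
  have "\<sigma> (u ^ (q ^ m) + u ^ q + t * u) = \<sigma> u ^ (q ^ m) + \<sigma> u ^ q + t * \<sigma> u"
    using u t subring_closed[OF is_subring_M] by (simp add: Gal_add Gal_mult Gal_power Gal_K[OF t_K])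
  then show ?thesis using assms Gal_0 by (simp add: V_def)
qed

lemma Gal_inj: "inj_on \<sigma> M"
  by (rule hom_on_inj[OF is_subfield_M Gal_hom])

lemma Gal_image_V: "\<sigma> ` V = V"
proof (rule endo_inj_surj[OF finite_V])
  show "\<sigma> ` V \<subseteq> V" using Gal_V by blast
  show "inj_on \<sigma> V" using inj_on_subset[OF Gal_inj V_M] .
qed

lemma Gal_M: assumes "a \<in> M" shows "\<sigma> a \<in> M"
proof -
  have "is_subring {a \<in> M. \<sigma> a \<in> M}"
    unfolding is_subring_def using subring_closed[OF is_subring_M] Gal_1 Gal_diff Gal_mult by auto
  moreover have "K \<subseteq> {a \<in> M. \<sigma> a \<in> M}" "V \<subseteq> {a \<in> M. \<sigma> a \<in> M}" using K_M V_M Gal_K Gal_V by auto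
  ultimately have "M \<subseteq> {a \<in> M. \<sigma> a \<in> M}" by (rule M_least)
  then show ?thesis using assms by blast
qed

lemma Gal_image_M: "\<sigma> ` M = M"
proof
  show "\<sigma> ` M \<subseteq> M" using Gal_M by blast
  have "is_subring (\<sigma> ` M)"
    unfolding is_subring_def
  proof (intro conjI ballI)
    show "1 \<in> \<sigma> ` M" using Gal_1 subring_1[OF is_subring_M] by (metis imageI)
    fix a b assume "a \<in> \<sigma> ` M" "b \<in> \<sigma> ` M"
    then obtain a' b' where "a' \<in> M" "b' \<in> M" "a = \<sigma> a'" "b = \<sigma> b'" by blast
    then show "a - b \<in> \<sigma> ` M" "a * b \<in> \<sigma> ` M"
      using Gal_diff[of a' b'] Gal_mult[of a' b'] subring_diff[OF is_subring_M, of a' b']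
        subring_mult[OF is_subring_M, of a' b'] by (metis imageI)+
  qed
  then show "M \<subseteq> \<sigma> ` M"
  proof (rule M_least)
    show "K \<subseteq> \<sigma> ` M" using Gal_K K_M by (metis (no_types) image_eqI subsetD subsetI)
    show "V \<subseteq> \<sigma> ` M" using Gal_image_V V_M by blast
  qed
qed

end

lemma Gal_comp:
  assumes \<sigma>: "Gal \<sigma>" and \<tau>: "Gal \<tau>"
  shows "Gal (\<sigma> \<circ> \<tau>)"
  unfolding Gal_def hom_on_def
  by (simp add: Gal_1[OF \<sigma>] Gal_1[OF \<tau>] Gal_add[OF \<sigma>] Gal_add[OF \<tau>] Gal_mult[OF \<sigma>] Gal_mult[OF \<tau>]
      Gal_M[OF \<tau>] Gal_K[OF \<sigma>] Gal_K[OF \<tau>])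

lemma Gal_id: "Gal (\<lambda>a. a)"
  by (simp add: Gal_def hom_on_def)

lemma Gal_inverse:
  assumes \<sigma>: "Gal \<sigma>"
  shows "\<exists>\<tau>. Gal \<tau> \<and> (\<forall>a\<in>M. \<sigma> (\<tau> a) = a \<and> \<tau> (\<sigma> a) = a)"
proof -
  define \<tau> where "\<tau> = inv_into M \<sigma>"
  have st: "\<sigma> (\<tau> a) = a" "\<tau> a \<in> M" if "a \<in> M" for a
    using that Gal_image_M[OF \<sigma>] unfolding \<tau>_def by (metis f_inv_into_f inv_into_into)+
  have ts: "\<tau> (\<sigma> a) = a" if "a \<in> M" for a
    unfolding \<tau>_def using that by (rule inv_into_f_f[OF Gal_inj[OF \<sigma>]])
  have "hom_on M \<tau>" unfolding hom_on_def
  proof (intro conjI ballI)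
    show "\<tau> 1 = 1" using ts[OF subring_1[OF is_subring_M]] Gal_1[OF \<sigma>] by simp
    fix a b assume ab: "a \<in> M" "b \<in> M"
    have "a + b = \<sigma> (\<tau> a + \<tau> b)" "a * b = \<sigma> (\<tau> a * \<tau> b)"
      using ab st by (simp_all add: Gal_add[OF \<sigma>] Gal_mult[OF \<sigma>])
    then show "\<tau> (a + b) = \<tau> a + \<tau> b" "\<tau> (a * b) = \<tau> a * \<tau> b"
      using ts st(2)[OF ab(1)] st(2)[OF ab(2)] subring_closed(4,6)[OF is_subring_M] by auto
  qed
  moreover have "\<tau> a = a" if "a \<in> K" for a
    using ts[of a] that K_M Gal_K[OF \<sigma> that] by auto
  ultimately have "Gal \<tau>" by (simp add: Gal_def)
  then show ?thesis using st(1) ts by blast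
qed

lemma Gal_eqI:
  assumes "Gal \<sigma>" "Gal \<tau>" "\<And>u. u \<in> V \<Longrightarrow> \<sigma> u = \<tau> u" "a \<in> M"
  shows "\<sigma> a = \<tau> a"
proof -
  have "is_subring {a \<in> M. \<sigma> a = \<tau> a}"
    unfolding is_subring_def using subring_closed[OF is_subring_M] assms(1,2)
    by (auto simp: Gal_1 Gal_diff Gal_mult)
  moreover have "K \<subseteq> {a \<in> M. \<sigma> a = \<tau> a}" "V \<subseteq> {a \<in> M. \<sigma> a = \<tau> a}"
    using K_M V_M assms(3) by (auto simp: Gal_K[OF assms(1)] Gal_K[OF assms(2)])
  ultimately have "M \<subseteq> {a \<in> M. \<sigma> a = \<tau> a}" by (rule M_least)
  then show ?thesis using assms(4) by blast
qed

end

context center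
begin

section \<open>Automorphisms over \<open>Mx\<close> and the functionals they realize\<close>

definition GalX :: "('b \<Rightarrow> 'b) \<Rightarrow> bool" where
  "GalX \<sigma> \<longleftrightarrow> Gal \<sigma> \<and> (\<forall>a\<in>Mx. \<sigma> a = a)"

lemma Mx_M: "Mx \<subseteq> M"
proof -
  note S = subring_closed[OF is_subring_M]
  have x: "x \<in> M" unfolding x_def using w(1) V_M by (intro S) auto
  then have "ev h x \<in> M" for h by (induction h) (auto intro!: S \<iota>_M)
  then have "Kx \<subseteq> M" unfolding Kx_def by (auto intro!: subfield_divide[OF is_subfield_M])
  moreover have "Z \<subseteq> M" unfolding Z_def P_def using x V_M by (auto intro!: S)
  ultimately show ?thesis unfolding Mx_def by (intro adjoins_least[OF is_subring_M]) (auto simp: set_zs)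
qed

text \<open>\<open>M\<close> lies in the extension of \<open>Mx\<close> generated by the roots of
  the separable polynomial \<open>E\<close>, so an element outside \<open>Mx\<close> would be moved
  by some homomorphism over \<open>Mx\<close>.\<close>

lemma GalX_fixed:
  assumes a: "a \<in> M" and fixed: "\<And>\<sigma>. GalX \<sigma> \<Longrightarrow> \<sigma> a = a"
  shows "a \<in> Mx"
proof (rule ccontr)
  assume na: "a \<notin> Mx"
  note S = subfieldD[OF is_subfield_Mx]
  have MM: "M \<subseteq> adjoins Mx vs"
    using adjoins_base[OF S, of vs] adjoins_gen[OF S, of vs] K_Mx
    by (intro M_least is_subring_adjoins[OF S]) (auto simp: set_vs)
  have "\<forall>v\<in>set vs. \<exists>E\<in>polys_over Mx. rsquarefree E \<and> poly E v = 0"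
    using E_over[OF S K_Mx] rsquarefree_E V_roots set_vs by blast
  from exists_hom_moving[OF is_subfield_Mx this _ na] a MM
  obtain \<sigma> where \<sigma>: "hom_on (adjoins Mx vs) \<sigma>" "\<forall>b\<in>Mx. \<sigma> b = b" "\<sigma> a \<noteq> a" by blast
  have "GalX \<sigma>"
    unfolding GalX_def Gal_def using hom_on_subset[OF \<sigma>(1) MM] \<sigma>(2) K_Mx by blast
  then show False using fixed \<sigma>(3) by blast
qed

text \<open>Records the pseudoreflections induced over \<open>Mx\<close> by their functionals. Those
  with \<phi>(w) = 0 are the elations; in general \<open>w\<close> is multiplied by 1 +
  \<phi>(w).\<close>

definition El :: "('b \<Rightarrow> 'a) \<Rightarrow> bool" where
  "El \<phi> \<longleftrightarrow> (\<exists>\<sigma>. GalX \<sigma> \<and> (\<forall>u\<in>V. \<sigma> u = u + \<iota> (\<phi> u) * w))"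

lemma El_cong: "El \<phi> \<Longrightarrow> (\<And>u. u \<in> V \<Longrightarrow> \<phi>' u = \<phi> u) \<Longrightarrow> El \<phi>'"
  unfolding El_def by metis

text \<open>Such a \<sigma> fixes x and P(u), hence P(\<sigma> u - u) = 0, and the kernel of
  \<open>P\<close> is the line of \<open>w\<close>.\<close>

lemma GalX_El:
  assumes \<sigma>: "GalX \<sigma>"
  shows "\<exists>\<phi>. El \<phi> \<and> (\<forall>u\<in>V. \<sigma> u = u + \<iota> (\<phi> u) * w)"
proof -
  have G: "Gal \<sigma>" and fx: "\<And>a. a \<in> Mx \<Longrightarrow> \<sigma> a = a" using \<sigma> by (auto simp: GalX_def)
  have "\<exists>c. \<sigma> u = u + \<iota> c * w" if u: "u \<in> V" for u
  proof -
    have uM: "u \<in> M" and xM: "x \<in> M" using u V_M x_Mx Mx_M by auto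
    have "P u \<in> Mx" using u Z_Mx by (auto simp: Z_def)
    then have "P u = \<sigma> (u ^ q - x * u)" using fx by (simp add: P_def)
    also have "\<dots> = P (\<sigma> u)"
      using uM xM subring_closed[OF is_subring_M]
      by (simp add: P_def Gal_diff[OF G] Gal_power[OF G] Gal_mult[OF G] fx[OF x_Mx])
    finally have "P (\<sigma> u - u) = 0" by (simp add: P_diff)
    then obtain c where "\<sigma> u - u = \<iota> c * w" unfolding P_eq_0_iff by blast
    then have "\<sigma> u = u + \<iota> c * w" by (simp add: algebra_simps)
    then show ?thesis by blast
  qed
  then obtain \<phi> where l: "\<forall>u\<in>V. \<sigma> u = u + \<iota> (\<phi> u) * w" by metis
  then have "El \<phi>" unfolding El_def using \<sigma> by blast
  then show ?thesis using l by blast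
qed

lemma scaled_w_eq_iff [simp]: "\<iota> c * w = \<iota> d * w \<longleftrightarrow> c = d"
  using w(2) by simp

lemma El_lin:
  assumes "El \<phi>"
  shows "lin_on_V \<phi>"
proof -
  obtain \<sigma> where \<sigma>: "GalX \<sigma>" "\<forall>u\<in>V. \<sigma> u = u + \<iota> (\<phi> u) * w" using assms by (auto simp: El_def)
  then have G: "Gal \<sigma>" by (simp add: GalX_def)
  show ?thesis unfolding lin_on_V_def
  proof (intro conjI ballI allI)
    fix u v assume uv: "u \<in> V" "v \<in> V"
    have "\<sigma> (u + v) = \<sigma> u + \<sigma> v" using uv V_M by (intro Gal_add[OF G]) auto
    then have "\<iota> (\<phi> (u + v)) * w = \<iota> (\<phi> u + \<phi> v) * w"
      using \<sigma>(2) uv V_add[OF uv] by (simp add: \<iota>_add algebra_simps)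
    then show "\<phi> (u + v) = \<phi> u + \<phi> v" using w(2) by simp
  next
    fix u c assume u: "u \<in> V"
    have "\<sigma> (\<iota> c * u) = \<iota> c * \<sigma> u" by (rule Gal_scale[OF G u])
    then have "\<iota> (\<phi> (\<iota> c * u)) * w = \<iota> (c * \<phi> u) * w"
      using \<sigma>(2) u V_scale[OF u, of c] by (simp add: \<iota>_mult algebra_simps)
    then show "\<phi> (\<iota> c * u) = c * \<phi> u" using w(2) by simp
  qed
qed

text \<open>The group law in terms of functionals. It becomes addition when \<alpha>(w) = 0, and at
  \<open>w\<close> it says that multipliers multiply.\<close>

lemma El_comp:
  assumes "El \<alpha>" "El \<beta>"
  shows "El (\<lambda>u. \<alpha> u + \<beta> u * (1 + \<alpha> w))"
proof -
  obtain \<sigma> \<tau> where \<sigma>: "GalX \<sigma>" "\<forall>u\<in>V. \<sigma> u = u + \<iota> (\<alpha> u) * w"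
    and \<tau>: "GalX \<tau>" "\<forall>u\<in>V. \<tau> u = u + \<iota> (\<beta> u) * w"
    using assms by (auto simp: El_def)
  then have G: "Gal \<sigma>" by (simp add: GalX_def)
  have "GalX (\<sigma> \<circ> \<tau>)" using \<sigma>(1) \<tau>(1) Gal_comp by (auto simp: GalX_def)
  moreover have "(\<sigma> \<circ> \<tau>) u = u + \<iota> (\<alpha> u + \<beta> u * (1 + \<alpha> w)) * w" if u: "u \<in> V" for u
  proof -
    have "(\<sigma> \<circ> \<tau>) u = \<sigma> (u + \<iota> (\<beta> u) * w)" using \<tau>(2) u by simp
    also have "\<dots> = \<sigma> u + \<sigma> (\<iota> (\<beta> u) * w)"
      using u w(1) V_M V_scale[of w] by (intro Gal_add[OF G]) auto
    also have "\<sigma> (\<iota> (\<beta> u) * w) = \<iota> (\<beta> u) * \<sigma> w" by (rule Gal_scale[OF G w(1)])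
    finally show ?thesis using \<sigma>(2) u w(1) by (simp add: \<iota>_add \<iota>_mult algebra_simps)
  qed
  ultimately show ?thesis unfolding El_def by blast
qed

lemma El_0: "El (\<lambda>_. 0)"
  unfolding El_def GalX_def using Gal_id by auto

lemma El_inverse:
  assumes "El \<alpha>"
  shows "\<exists>\<beta>. El \<beta> \<and> (\<forall>u\<in>V. \<alpha> u + \<beta> u * (1 + \<alpha> w) = 0)"
proof -
  obtain \<sigma> where \<sigma>: "GalX \<sigma>" "\<forall>u\<in>V. \<sigma> u = u + \<iota> (\<alpha> u) * w" using assms by (auto simp: El_def)
  then have G: "Gal \<sigma>" by (simp add: GalX_def)
  obtain \<tau> where \<tau>: "Gal \<tau>" "\<forall>a\<in>M. \<sigma> (\<tau> a) = a \<and> \<tau> (\<sigma> a) = a"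
    using Gal_inverse[OF G] by blast
  have "\<tau> a = a" if "a \<in> Mx" for a
    using bspec[OF \<tau>(2), of a] that \<sigma>(1) Mx_M by (auto simp: GalX_def)
  then have "GalX \<tau>" using \<tau>(1) by (simp add: GalX_def)
  then obtain \<beta> where \<beta>: "El \<beta>" "\<forall>u\<in>V. \<tau> u = u + \<iota> (\<beta> u) * w" using GalX_El by blast
  have "\<alpha> u + \<beta> u * (1 + \<alpha> w) = 0" if u: "u \<in> V" for u
  proof -
    have "u = \<sigma> (u + \<iota> (\<beta> u) * w)" using bspec[OF \<tau>(2), of u] bspec[OF \<beta>(2) u] u V_M by auto
    also have "\<dots> = \<sigma> u + \<sigma> (\<iota> (\<beta> u) * w)"
      using u w(1) V_M V_scale[of w] by (intro Gal_add[OF G]) auto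
    also have "\<sigma> (\<iota> (\<beta> u) * w) = \<iota> (\<beta> u) * \<sigma> w" by (rule Gal_scale[OF G w(1)])
    also have "\<sigma> w = w + \<iota> (\<alpha> w) * w" using \<sigma>(2) w(1) by blast
    also have "\<sigma> u = u + \<iota> (\<alpha> u) * w" using \<sigma>(2) u by blast
    finally have "\<iota> (\<alpha> u + \<beta> u * (1 + \<alpha> w)) * w = 0" by (simp add: \<iota>_add \<iota>_mult algebra_simps)
    then show ?thesis using w(2) by simp
  qed
  then show ?thesis using \<beta>(1) by blast
qed

lemma El_multiplier_nonzero:
  assumes "El \<alpha>" shows "1 + \<alpha> w \<noteq> 0"
proof
  assume h: "1 + \<alpha> w = 0"
  obtain \<beta> where \<beta>: "El \<beta>" "\<forall>u\<in>V. \<alpha> u + \<beta> u * (1 + \<alpha> w) = 0" using El_inverse[OF assms] by blast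
  from bspec[OF \<beta>(2) w(1)] have "\<alpha> w = 0" using h by simp
  then show False using h by simp
qed

text \<open>If \<open>n\<close> multipliers occur, then \<open>w\<^sup>n\<close> is fixed, hence lies in \<open>Mx\<close>.\<close>

lemma El_multiplier_exists:
  assumes c: "c \<noteq> 0"
  obtains \<alpha> where "El \<alpha>" "1 + \<alpha> w = c"
proof -
  define \<Phi> where "\<Phi> = {1 + \<alpha> w | \<alpha>. El \<alpha>}"
  have "1 + 0 \<in> \<Phi>" unfolding \<Phi>_def by (intro CollectI exI[of _ "\<lambda>_. 0"] conjI El_0 refl)
  have nz: "d \<noteq> 0" if "d \<in> \<Phi>" for d using that El_multiplier_nonzero by (auto simp: \<Phi>_def)
  have mult: "d * d' \<in> \<Phi>" if dd: "d \<in> \<Phi>" "d' \<in> \<Phi>" for d d'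
  proof -
    obtain \<alpha> \<beta> where ab: "El \<alpha>" "d = 1 + \<alpha> w" "El \<beta>" "d' = 1 + \<beta> w" using dd by (auto simp: \<Phi>_def)
    have "d * d' = 1 + (\<alpha> w + \<beta> w * (1 + \<alpha> w))" using ab by (simp add: algebra_simps)
    then show ?thesis unfolding \<Phi>_def
      by (intro CollectI exI[of _ "\<lambda>u. \<alpha> u + \<beta> u * (1 + \<alpha> w)"] conjI El_comp ab)
  qed
  define n where "n = card \<Phi>"
  \<comment> \<open>Lagrange's theorem for the finite multiplicatively closed set
    \<open>\<Phi>\<close>: multiplication by d permutes it, so its product acquires the factor
    d^n.\<close>
  have pow: "d ^ n = 1" if d: "d \<in> \<Phi>" for d
  proof -
    have inj: "inj_on (\<lambda>c. d * c) \<Phi>" using nz[OF d] by (simp add: inj_on_def)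
    have "(\<lambda>c. d * c) ` \<Phi> = \<Phi>" by (rule endo_inj_surj[OF _ _ inj]) (use mult[OF d] in auto)
    then have "\<Prod>\<Phi> = (\<Prod>c\<in>\<Phi>. d * c)" using prod.reindex[OF inj, of "\<lambda>c. c"] by simp
    also have "\<dots> = d ^ n * \<Prod>\<Phi>" by (simp add: prod.distrib n_def)
    finally show ?thesis using nz by simp
  qed
  have wM: "w \<in> M" using w(1) V_M by blast
  have "w ^ n \<in> Mx"
  proof (rule GalX_fixed)
    show "w ^ n \<in> M" using wM by (rule subring_power[OF is_subring_M])
    fix \<sigma> assume \<sigma>: "GalX \<sigma>"
    then obtain \<phi> where l: "El \<phi>" "\<forall>u\<in>V. \<sigma> u = u + \<iota> (\<phi> u) * w" using GalX_El by blast
    have "\<sigma> w = \<iota> (1 + \<phi> w) * w" using bspec[OF l(2) w(1)] by (simp add: \<iota>_add algebra_simps)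
    moreover have "1 + \<phi> w \<in> \<Phi>" using l(1) unfolding \<Phi>_def by blast
    ultimately have "\<sigma> w ^ n = w ^ n" using pow by (simp add: power_mult_distrib flip: \<iota>_power)
    then show "\<sigma> (w ^ n) = w ^ n" using Gal_power[of \<sigma> w n] \<sigma> wM by (simp add: GalX_def)
  qed
  moreover have "0 < n" using \<open>1 + 0 \<in> \<Phi>\<close> unfolding n_def by (auto simp: card_gt_0_iff)
  ultimately have "q - 1 \<le> n" using w_power_notin_Mx[of n] not_le by blast
  moreover have "\<Phi> \<subseteq> UNIV - {0}" using nz by auto
  ultimately have "\<Phi> = UNIV - {0}"
    by (intro card_seteq) (auto simp: card_F n_def card_Diff_singleton)
  then have "c \<in> \<Phi>" using c by simp
  then show ?thesis using that unfolding \<Phi>_def by blast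
qed

definition El0 :: "('b \<Rightarrow> 'a) \<Rightarrow> bool" where "El0 \<phi> \<longleftrightarrow> El \<phi> \<and> \<phi> w = 0"

lemma El0_add: "El0 \<alpha> \<Longrightarrow> El0 \<beta> \<Longrightarrow> El0 (\<lambda>u. \<alpha> u + \<beta> u)"
  using El_comp[of \<alpha> \<beta>] by (simp add: El0_def)

text \<open>Conjugation of an elation by an element with multiplier a multiplies its functional by
  a. Together with addition this makes the realized elations a vector space over F_q.\<close>

lemma El0_scale:
  assumes l: "El0 \<phi>"
  shows "El0 (\<lambda>u. a * \<phi> u)"
proof (cases "a = 0")
  case True
  then show ?thesis using El_0 by (simp add: El0_def)
next
  case False
  obtain \<alpha> where \<alpha>: "El \<alpha>" "1 + \<alpha> w = a" by (rule El_multiplier_exists[OF False])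
  obtain \<beta> where \<beta>: "El \<beta>" "\<forall>u\<in>V. \<alpha> u + \<beta> u * (1 + \<alpha> w) = 0" using El_inverse[OF \<alpha>(1)] by blast
  have l': "El \<phi>" "\<phi> w = 0" using l by (auto simp: El0_def)
  have "El (\<lambda>u. (\<alpha> u + \<phi> u * (1 + \<alpha> w)) + \<beta> u * (1 + (\<alpha> w + \<phi> w * (1 + \<alpha> w))))"
    using El_comp[OF El_comp[OF \<alpha>(1) l'(1)] \<beta>(1)] .
  then have "El (\<lambda>u. a * \<phi> u)"
  proof (rule El_cong)
    fix u assume "u \<in> V"
    from bspec[OF \<beta>(2) this] show "a * \<phi> u = (\<alpha> u + \<phi> u * (1 + \<alpha> w)) + \<beta> u * (1 + (\<alpha> w + \<phi> w * (1 + \<alpha> w)))"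
      using \<alpha>(2) l'(2) by (simp add: algebra_simps)
  qed
  then show ?thesis using l'(2) by (simp add: El0_def)
qed

lemma El0_sum: "(\<And>i. i \<in> I \<Longrightarrow> El0 (\<phi> i)) \<Longrightarrow> El0 (\<lambda>u. \<Sum>i\<in>I. g i * \<phi> i u)"
proof (induction I rule: infinite_finite_induct)
  case (insert i I)
  then show ?case using El0_add[OF El0_scale[of "\<phi> i" "g i"]] by simp
qed (use El_0 in \<open>simp_all add: El0_def\<close>)

text \<open>If all elations with center \<open>w\<close> fix \<open>u\<close>, correct \<open>u\<close> by a multiple of \<open>w\<close> to a fixed point \<open>u'\<close> of some
  element with multiplier \<open>a \<noteq> 1\<close>.  Commutators are elations, which forces everything to fix \<open>u'\<close>.\<close>

lemma El0_separates:
  assumes u: "u \<in> V" "P u \<noteq> 0"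
  obtains \<phi> where "El0 \<phi>" "\<phi> u \<noteq> 0"
proof (rule ccontr)
  assume "\<not> thesis"
  then have kill: "\<phi> u = 0" if "El0 \<phi>" for \<phi> using that \<open>\<And>\<phi>. El0 \<phi> \<Longrightarrow> \<phi> u \<noteq> 0 \<Longrightarrow> thesis\<close> by blast
  \<comment> \<open>A multiplier other than 0 and 1 exists because q \<ge> 3.\<close>
  have "card {0, 1 :: 'a} < CARD('a)" using q_ge card_F by simp
  then have "{0, 1 :: 'a} \<noteq> UNIV" by (metis less_irrefl)
  then obtain a :: 'a where a: "a \<noteq> 0" "a \<noteq> 1" by blast
  obtain \<alpha> where \<alpha>: "El \<alpha>" "1 + \<alpha> w = a" by (rule El_multiplier_exists[OF a(1)])
  then have aw: "\<alpha> w \<noteq> 0" using a by auto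
  \<comment> \<open>The multiple of \<open>w\<close> is chosen to give \<alpha>(u') = 0.\<close>
  define u' where "u' = u + \<iota> (- \<alpha> u / \<alpha> w) * w"
  have u'V: "u' \<in> V" unfolding u'_def using u(1) w(1) by (intro V_add V_scale)
  have lin: "\<phi> u' = \<phi> u + (- \<alpha> u / \<alpha> w) * \<phi> w" if "lin_on_V \<phi>" for \<phi>
    unfolding u'_def using u(1) w(1) that by (simp add: lin_on_V_add lin_on_V_scale V_scale)
  have au': "\<alpha> u' = 0" using lin[OF El_lin[OF \<alpha>(1)]] aw by simp
  have "\<gamma> u' = 0" if \<gamma>: "El \<gamma>" for \<gamma>
  proof -
    \<comment> \<open>The functionals of the two products of \<alpha> and \<gamma>, in either order.
      Their multipliers agree, so the first product times the inverse of the second, which is the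
      commutator, has functional \<delta>1 - \<delta>2 and is an elation. At u' this difference is
      \<gamma>(u') \<alpha>(w).\<close>
    define \<delta>1 where "\<delta>1 = (\<lambda>u. \<alpha> u + \<gamma> u * (1 + \<alpha> w))"
    define \<delta>2 where "\<delta>2 = (\<lambda>u. \<gamma> u + \<alpha> u * (1 + \<gamma> w))"
    have E12: "El \<delta>1" "El \<delta>2" unfolding \<delta>1_def \<delta>2_def using El_comp \<alpha>(1) \<gamma> by blast+
    have w12: "\<delta>1 w = \<delta>2 w" by (simp add: \<delta>1_def \<delta>2_def algebra_simps)
    obtain \<beta> where \<beta>: "El \<beta>" "\<forall>u\<in>V. \<delta>2 u + \<beta> u * (1 + \<delta>2 w) = 0" using El_inverse[OF E12(2)] by blast
    have "El (\<lambda>u. \<delta>1 u - \<delta>2 u)"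
    proof (rule El_cong[OF El_comp[OF E12(1) \<beta>(1)]])
      fix u assume "u \<in> V"
      from bspec[OF \<beta>(2) this] show "\<delta>1 u - \<delta>2 u = \<delta>1 u + \<beta> u * (1 + \<delta>1 w)"
        by (simp add: w12 add_eq_0_iff)
    qed
    then have "El0 (\<lambda>u. \<delta>1 u - \<delta>2 u)" by (simp add: El0_def w12)
    from kill[OF this] lin[OF El_lin[OF \<open>El (\<lambda>u. \<delta>1 u - \<delta>2 u)\<close>]] w12 have "\<delta>1 u' - \<delta>2 u' = 0" by simp
    then have "\<gamma> u' * \<alpha> w = 0" using au' by (simp add: \<delta>1_def \<delta>2_def algebra_simps)
    then show ?thesis using aw by simp
  qed
  then have "\<sigma> u' = u'" if "GalX \<sigma>" for \<sigma>
  proof -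
    obtain \<gamma> where "El \<gamma>" "\<forall>u\<in>V. \<sigma> u = u + \<iota> (\<gamma> u) * w" using GalX_El[OF \<open>GalX \<sigma>\<close>] by blast
    then show ?thesis using u'V \<open>\<And>\<gamma>. El \<gamma> \<Longrightarrow> \<gamma> u' = 0\<close> by simp
  qed
  then have "u' \<in> Mx" using u'V V_M by (intro GalX_fixed) auto
  moreover have "P u' = P u" by (simp add: u'_def P_add P_scale P_w)
  ultimately show False using V_notin_Mx[OF u'V] u(2) by simp
qed

text \<open>If the value at \<open>f j\<close> could not be prescribed independently of those at \<open>f 1, \<dots>, f (j - 1)\<close>, every
  elation with center \<open>w\<close> would fix \<open>f j - (\<Sum>k=1..<j. L k (f j) * f k)\<close>, with \<open>L k\<close> dual to \<open>f k\<close>.\<close>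

lemma El0_surjective:
  assumes f: "indep m f" "f 0 = w" and j: "1 \<le> j" "j \<le> m"
  shows "\<exists>\<phi>. El0 \<phi> \<and> (\<forall>i\<in>{1..<j}. \<phi> (f i) = c i)"
  using j
proof (induction j arbitrary: c rule: dec_induct)
  case base
  then show ?case using El_0 by (auto simp: El0_def)
next
  case (step j)
  then have IH: "\<exists>\<phi>. El0 \<phi> \<and> (\<forall>i\<in>{1..<j}. \<phi> (f i) = c i)" for c by simp
  have fV: "f i \<in> V" if "i < m" for i using indep_V[OF f(1) that] .
  have jm: "j < m" using step.prems by simp
  have "\<exists>\<phi>. El0 \<phi> \<and> (\<forall>i\<in>{1..<j}. \<phi> (f i) = 0) \<and> \<phi> (f j) \<noteq> 0"
  proof (rule ccontr)
    assume none: "\<not> ?thesis"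
    have "\<forall>k. \<exists>\<phi>. El0 \<phi> \<and> (\<forall>i\<in>{1..<j}. \<phi> (f i) = (if i = k then 1 else 0))"
      by (intro allI IH)
    then obtain L where L: "\<And>k. El0 (L k)" "\<And>k i. i \<in> {1..<j} \<Longrightarrow> L k (f i) = (if i = k then 1 else 0)"
      by metis
    define u where "u = f j - (\<Sum>k=1..<j. \<iota> (L k (f j)) * f k)"
    have sV: "(\<Sum>k=1..<j. \<iota> (L k (f j)) * f k) \<in> V" using fV jm by (intro V_sum) auto
    then have uV: "u \<in> V" unfolding u_def using fV[OF jm] by (intro V_diff)
    have lu: "\<phi> u = \<phi> (f j) - (\<Sum>k=1..<j. L k (f j) * \<phi> (f k))" if "lin_on_V \<phi>" for \<phi>
    proof -
      have "\<phi> (\<Sum>k=1..<j. \<iota> (L k (f j)) * f k) = (\<Sum>k=1..<j. L k (f j) * \<phi> (f k))"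
        by (rule lin_on_V_sum[OF that]) (use fV jm in auto)
      then show ?thesis unfolding u_def lin_on_V_diff[OF that fV[OF jm] sV] by (simp only:)
    qed
    \<comment> \<open>The coordinate of u at f j is 1, whereas multiples of w = f 0 have coordinate
      0 there.\<close>
    have "P u \<noteq> 0"
    proof
      assume "P u = 0"
      then obtain d where d: "u = \<iota> d * w" unfolding P_eq_0_iff by blast
      have "0 < m" using m by simp
      have "coord f j u = d * coord f j (f 0)"
        unfolding d f(2) by (rule lin_on_V_scale[OF lin_on_V_coord[OF f(1) jm] w(1)])
      then have "coord f j u = 0" using coord_basis[OF f(1) jm \<open>0 < m\<close>] step.hyps by auto
      moreover have "coord f j (f k) = 0" if "k \<in> {1..<j}" for k
        using coord_basis[OF f(1) jm, of k] that jm by auto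
      then have "coord f j u = 1"
        using lu[OF lin_on_V_coord[OF f(1) jm]] coord_basis[OF f(1) jm jm] by simp
      ultimately show False by simp
    qed
    obtain \<phi> where l: "El0 \<phi>" "\<phi> u \<noteq> 0" using \<open>P u \<noteq> 0\<close> by (rule El0_separates[OF uV])
    \<comment> \<open>Subtracting the dual functionals makes \<phi>' vanish at f 1, ..., f (j-1). By
      assumption it then vanishes at f j, and its value there is \<phi>(u).\<close>
    define \<phi>' where "\<phi>' = (\<lambda>v. \<phi> v + (\<Sum>k=1..<j. - \<phi> (f k) * L k v))"
    have "El0 \<phi>'" unfolding \<phi>'_def using l(1) El0_sum[of "{1..<j}" L "\<lambda>k. - \<phi> (f k)"] L(1) by (intro El0_add) auto
    moreover have "\<phi>' (f i) = 0" if i: "i \<in> {1..<j}" for i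
    proof -
      have "(\<Sum>k=1..<j. - \<phi> (f k) * L k (f i)) = (\<Sum>k=1..<j. if i = k then - \<phi> (f k) else 0)"
        using L(2)[OF i] by (intro sum.cong) auto
      then show ?thesis using i by (simp add: \<phi>'_def)
    qed
    ultimately have "\<phi>' (f j) = 0" using none by blast
    then have "\<phi> u = 0"
      using lu[OF El_lin, of \<phi>] l(1) by (simp add: \<phi>'_def El0_def sum_negf mult.commute)
    then show False using l(2) by simp
  qed
  then obtain \<phi>1 where l1: "El0 \<phi>1" "\<forall>i\<in>{1..<j}. \<phi>1 (f i) = 0" "\<phi>1 (f j) \<noteq> 0" by blast
  obtain \<phi>0 where l0: "El0 \<phi>0" "\<forall>i\<in>{1..<j}. \<phi>0 (f i) = c i" using IH by blast
  define b where "b = (c j - \<phi>0 (f j)) / \<phi>1 (f j)"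
  have "El0 (\<lambda>u. \<phi>0 u + b * \<phi>1 u)" using El0_add[OF l0(1) El0_scale[OF l1(1)]] .
  moreover have "\<phi>0 (f i) + b * \<phi>1 (f i) = c i" if "i \<in> {1..<Suc j}" for i
    using that l0 l1 by (cases "i = j") (auto simp: b_def)
  ultimately show ?case by (intro exI[of _ "\<lambda>u. \<phi>0 u + b * \<phi>1 u"]) simp
qed

text \<open>Factor the wanted map as an element with the right multiplier followed by a correction:
  \<phi> = \<alpha> + (1 + \<alpha>(w)) \<mu> is the composition law, and equality of the
  multipliers forces \<mu>(w) = 0, so \<mu> is one of the elations already realized.\<close>

lemma El_if_lin:
  assumes l: "lin_on_V \<phi>" and a: "1 + \<phi> w \<noteq> 0"
  shows "El \<phi>"
proof -
  obtain \<alpha> where \<alpha>: "El \<alpha>" "1 + \<alpha> w = 1 + \<phi> w" by (rule El_multiplier_exists[OF a])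
  define \<mu> where "\<mu> u = (\<phi> u - \<alpha> u) / (1 + \<phi> w)" for u
  have mu: "lin_on_V \<mu>" using l El_lin[OF \<alpha>(1)] unfolding lin_on_V_def \<mu>_def
    by (auto simp: add_divide_distrib diff_divide_distrib right_diff_distrib)
  have "indep 1 (\<lambda>_. w)" using w by (auto simp: indep_def)
  from indep_extend[OF this] m obtain f where f: "indep m f" "f 0 = w" by auto
  obtain \<nu> where \<nu>: "El0 \<nu>" "\<forall>i\<in>{1..<m}. \<nu> (f i) = \<mu> (f i)"
    using El0_surjective[OF f, of m "\<lambda>i. \<mu> (f i)"] m by auto
  have "\<nu> (f i) = \<mu> (f i)" if "i < m" for i
  proof (cases "i = 0")
    case True
    then show ?thesis using \<nu>(1) \<alpha>(2) f(2) by (simp add: El0_def \<mu>_def)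
  qed (use \<nu>(2) that in auto)
  then have eq: "\<nu> u = \<mu> u" if "u \<in> V" for u
    using lin_on_V_eqI[OF f(1) _ mu _ that] El_lin \<nu>(1) by (auto simp: El0_def)
  have "El \<nu>" using \<nu>(1) by (simp add: El0_def)
  then have "El \<mu>" by (rule El_cong) (rule eq[symmetric])
  from El_comp[OF \<alpha>(1) this] show ?thesis
    by (rule El_cong) (use a \<alpha>(2) in \<open>simp add: \<mu>_def\<close>)
qed

end

section \<open>Transitivity on bases\<close>

context vectorial
begin

lemma pseudoreflection:
  assumes "w \<in> V" "w \<noteq> 0" "lin_on_V \<phi>" "1 + \<phi> w \<noteq> 0"
  shows "\<exists>\<sigma>. Gal \<sigma> \<and> (\<forall>u\<in>V. \<sigma> u = u + \<iota> (\<phi> u) * w)"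
proof -
  interpret center \<iota> t K m p k q w by unfold_locales fact+
  show ?thesis using El_if_lin[OF assms(3,4)] by (auto simp: El_def GalX_def)
qed

lemma Gal_sum:
  assumes "Gal \<sigma>" "\<And>i. i \<in> I \<Longrightarrow> f i \<in> V"
  shows "\<sigma> (\<Sum>i\<in>I. \<iota> (g i) * f i) = (\<Sum>i\<in>I. \<iota> (g i) * \<sigma> (f i))"
proof -
  have "\<iota> (g i) * f i \<in> M" if "i \<in> I" for i using V_scale[OF assms(2)[OF that]] V_M by blast
  then have "\<sigma> (\<Sum>i\<in>I. \<iota> (g i) * f i) = (\<Sum>i\<in>I. \<sigma> (\<iota> (g i) * f i))"
    by (rule hom_on_sum[OF is_subring_M Gal_hom[OF assms(1)]])
  also have "\<dots> = (\<Sum>i\<in>I. \<iota> (g i) * \<sigma> (f i))"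
    by (intro sum.cong refl Gal_scale[OF assms(1)] assms(2))
  finally show ?thesis .
qed

text \<open>A pseudoreflection along e j - f' carries f' to e j when \<phi>(f') = 1, and fixes the
  vectors e i already reached when \<phi>(e i) = 0. It is admissible because its multiplier 1 +
  \<phi>(e j - f') equals \<phi>(e j), which must therefore be nonzero.\<close>

lemma Gal_transitive_step:
  assumes e: "indep m e" and f: "indep m f" and j: "j < m"
    and \<sigma>: "Gal \<sigma>" "\<And>i. i < j \<Longrightarrow> \<sigma> (f i) = e i"
  shows "\<exists>\<tau>. Gal \<tau> \<and> (\<forall>i<Suc j. \<tau> (f i) = e i)"
proof -
  define f' where "f' = \<sigma> (f j)"
  have f'V: "f' \<in> V" unfolding f'_def using Gal_V[OF \<sigma>(1)] indep_V[OF f j] .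
  have eV: "e j \<in> V" using indep_V[OF e j] .
  note ce = lin_on_V_coord[OF e]
  show ?thesis
  proof (cases "f' = e j")
    case True
    then show ?thesis using \<sigma> by (intro exI[of _ \<sigma>]) (auto simp: f'_def less_Suc_eq)
  next
    case False
    have "\<exists>\<phi>. lin_on_V \<phi> \<and> (\<forall>i<j. \<phi> (e i) = 0) \<and> \<phi> f' = 1 \<and> \<phi> (e j) \<noteq> 0"
    proof (cases "coord e j f' = 0")
      case False
      define \<phi> where "\<phi> u = coord e j u / coord e j f'" for u
      have "lin_on_V \<phi>" using ce[OF j] unfolding lin_on_V_def \<phi>_def by (auto simp: add_divide_distrib)
      moreover have "\<phi> (e i) = 0" if "i < j" for i
        using coord_basis[OF e j, of i] that j by (simp add: \<phi>_def)
      moreover have "\<phi> (e j) \<noteq> 0" using coord_basis[OF e j j] False by (simp add: \<phi>_def)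
      ultimately show ?thesis using False by (intro exI[of _ \<phi>]) (auto simp: \<phi>_def)
    next
      case True
      \<comment> \<open>Otherwise f' would be a combination of the e i = \<sigma>(f i) with i < j,
        and f j the same combination of the earlier f i. The extra coordinate repairs the value at
        f' without disturbing the value at e j.\<close>
      have "\<exists>i<m. j < i \<and> coord e i f' \<noteq> 0"
      proof (rule ccontr)
        assume none: "\<not> ?thesis"
        define g where "g i = (if i < j then coord e i f' else 0)" for i
        have "coord e i f' = g i" if "i < m" for i
          using none that True by (cases "i = j") (auto simp: g_def)
        then have "f' = (\<Sum>i<m. \<iota> (g i) * e i)" using coord_sum[OF e f'V] by simp
        also have "\<dots> = (\<Sum>i<m. \<iota> (g i) * \<sigma> (f i))" using \<sigma>(2) by (intro sum.cong) (auto simp: g_def)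
        also have "\<dots> = \<sigma> (\<Sum>i<m. \<iota> (g i) * f i)" by (rule Gal_sum[OF \<sigma>(1), symmetric]) (simp add: indep_V[OF f])
        finally have "\<sigma> (f j) = \<sigma> (\<Sum>i<m. \<iota> (g i) * f i)" by (simp add: f'_def)
        moreover have "f j \<in> M" "(\<Sum>i<m. \<iota> (g i) * f i) \<in> M"
          using indep_V[OF f] j V_M V_sum[of "{..<m}" f g] by auto
        ultimately have "f j = (\<Sum>i<m. \<iota> (g i) * f i)" using Gal_inj[OF \<sigma>(1)] by (simp add: inj_on_eq_iff)
        then have "coord f j (f j) = g j" using coord_eq[OF f j, of g] by simp
        then show False using coord_basis[OF f j j] by (simp add: g_def)
      qed
      then obtain i where i: "i < m" "j < i" "coord e i f' \<noteq> 0" by blast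
      define \<phi> where "\<phi> u = coord e j u + coord e i u / coord e i f'" for u
      have "lin_on_V \<phi>" using ce[OF j] ce[OF i(1)] unfolding lin_on_V_def \<phi>_def
        by (auto simp: add_divide_distrib algebra_simps)
      moreover have "\<phi> (e l) = 0" if "l < j" for l
        using coord_basis[OF e j, of l] coord_basis[OF e i(1), of l] that i j by (simp add: \<phi>_def)
      moreover have "\<phi> (e j) \<noteq> 0" using coord_basis[OF e j j] coord_basis[OF e i(1) j] i by (simp add: \<phi>_def)
      ultimately show ?thesis using True i by (intro exI[of _ \<phi>]) (auto simp: \<phi>_def)
    qed
    then obtain \<phi> where l: "lin_on_V \<phi>" "\<forall>i<j. \<phi> (e i) = 0" "\<phi> f' = 1" "\<phi> (e j) \<noteq> 0" by blast
    have "1 + \<phi> (e j - f') \<noteq> 0" using l by (simp add: lin_on_V_diff eV f'V)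
    moreover have "e j - f' \<noteq> 0" using False by simp
    ultimately obtain \<rho> where \<rho>: "Gal \<rho>" "\<forall>u\<in>V. \<rho> u = u + \<iota> (\<phi> u) * (e j - f')"
      using pseudoreflection[OF V_diff[OF eV f'V] _ l(1)] by blast
    have "(\<rho> \<circ> \<sigma>) (f i) = e i" if "i < Suc j" for i
    proof (cases "i = j")
      case True
      then show ?thesis using bspec[OF \<rho>(2) f'V] l(3) by (simp add: f'_def)
    next
      case False
      then have "i < j" using that by simp
      then show ?thesis using \<rho>(2) \<sigma>(2) l(2) indep_V[OF e, of i] j by simp
    qed
    then show ?thesis using Gal_comp[OF \<rho>(1) \<sigma>(1)] by blast
  qed
qed

theorem Gal_transitive_on_bases:
  assumes e: "indep m e" and f: "indep m f"
  shows "\<exists>\<sigma>. Gal \<sigma> \<and> (\<forall>i<m. \<sigma> (f i) = e i)"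
proof -
  have "\<exists>\<sigma>. Gal \<sigma> \<and> (\<forall>i<j. \<sigma> (f i) = e i)" if "j \<le> m" for j
    using that
  proof (induction j)
    case 0
    then show ?case using Gal_id by auto
  next
    case (Suc j)
    then obtain \<sigma> where "Gal \<sigma>" "\<forall>i<j. \<sigma> (f i) = e i" by auto
    then show ?case using Gal_transitive_step[OF e f, of j \<sigma>] Suc.prems by auto
  qed
  then show ?thesis by blast
qed

end

section \<open>The Galois group of the splitting field\<close>

lemma ring_of_type_algebra_simps [simp]:
  "carrier (ring_of_type_algebra :: 'b::field ring) = UNIV"
  "\<one>\<^bsub>ring_of_type_algebra :: 'b ring\<^esub> = 1" "\<zero>\<^bsub>ring_of_type_algebra :: 'b ring\<^esub> = 0"
  "a \<oplus>\<^bsub>ring_of_type_algebra\<^esub> b = a + (b :: 'b)" "a \<otimes>\<^bsub>ring_of_type_algebra\<^esub> b = a * (b :: 'b)"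
  by (simp_all add: ring_of_type_algebra_def)

lemma ring_of_type_algebra_inverse [simp]:
  fixes a :: "'b::field"
  shows "\<ominus>\<^bsub>ring_of_type_algebra\<^esub> a = - a"
    and "a \<noteq> 0 \<Longrightarrow> inv\<^bsub>ring_of_type_algebra\<^esub> a = inverse a"
proof -
  interpret F: field "ring_of_type_algebra :: 'b ring" by (rule field_from_type_algebra)
  show "\<ominus>\<^bsub>ring_of_type_algebra\<^esub> a = - a" by (rule F.minus_equality) simp_all
  show "inv\<^bsub>ring_of_type_algebra\<^esub> a = inverse a" if "a \<noteq> 0"
    by (rule F.comm_inv_char) (use that in simp_all)
qed

abbreviation gen_field :: "'b::field set \<Rightarrow> 'b set" where
  "gen_field \<equiv> generate_field ring_of_type_algebra"

lemma is_subfield_gen_field: "is_subfield (gen_field H)"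
proof -
  have one: "1 \<in> gen_field H" using generate_field.one[of ring_of_type_algebra H] by simp
  have u: "- a \<in> gen_field H" if "a \<in> gen_field H" for a
    using generate_field.a_inv[OF that] by simp
  have i: "inverse a \<in> gen_field H" if "a \<in> gen_field H" for a
    using generate_field.m_inv[OF that] that by (cases "a = 0") auto
  have "a - b \<in> gen_field H" "a * b \<in> gen_field H" if "a \<in> gen_field H" "b \<in> gen_field H" for a b
    using generate_field.eng_add[OF that(1) u[OF that(2)]] generate_field.eng_mult[OF that] by simp_all
  then show ?thesis using one i by (simp add: is_subfield_def is_subring_def)
qed

lemma gen_field_base: "H \<subseteq> gen_field H"
  by (auto intro: generate_field.incl)

lemma gen_field_least:
  assumes "is_subfield B" "H \<subseteq> B"
  shows "gen_field H \<subseteq> B"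
proof
  fix a assume "a \<in> gen_field H"
  then show "a \<in> B"
  proof (induction rule: generate_field.induct)
    case (m_inv h)
    then show ?case using subfield_inverse[OF assms(1)] by simp
  qed (use assms(2) subring_closed(2,3,4,6)[OF subfieldD[OF assms(1)]] in auto)
qed

lemma carrier_galois_group:
  "carrier (galois_group K L) =
     {\<sigma> \<in> extensional L. hom_on L \<sigma> \<and> bij_betw \<sigma> L L \<and> (\<forall>a\<in>K. \<sigma> a = a)}"
  unfolding galois_group_def Let_def ring_iso_def Ring.ring_hom_def hom_on_def
  by (auto simp: bij_betw_imp_funcset bij_betwE)

lemma one_galois_group: "\<one>\<^bsub>galois_group K L\<^esub> = (\<lambda>a\<in>L. a)"
  by (simp add: galois_group_def BijGroup_def Let_def)

lemma mult_galois_group: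
  assumes "\<sigma> \<in> carrier (galois_group K L)" "\<tau> \<in> carrier (galois_group K L)"
  shows "\<sigma> \<otimes>\<^bsub>galois_group K L\<^esub> \<tau> = compose L \<sigma> \<tau>"
proof -
  have "\<sigma> \<in> Bij L" "\<tau> \<in> Bij L" using assms by (auto simp: carrier_galois_group Bij_def)
  then show ?thesis by (simp add: galois_group_def BijGroup_def Let_def)
qed

lemma group_galois_group:
  assumes L: "is_subring L" and KL: "K \<subseteq> L"
  shows "group (galois_group K L)"
proof -
  let ?C = "carrier (galois_group K L)"
  have eq: "galois_group K L = (BijGroup L)\<lparr>carrier := ?C\<rparr>"
    by (simp add: galois_group_def Let_def)
  have bij: "\<sigma> \<in> Bij L" if "\<sigma> \<in> ?C" for \<sigma> using that by (auto simp: carrier_galois_group Bij_def)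
  have "subgroup ?C (BijGroup L)"
  proof (rule subgroup.intro)
    show "?C \<subseteq> carrier (BijGroup L)" using bij by (auto simp: BijGroup_def)
    show "\<one>\<^bsub>BijGroup L\<^esub> \<in> ?C"
      using KL subring_closed[OF L]
      by (auto simp: BijGroup_def carrier_galois_group hom_on_def bij_betw_def inj_on_def)
  next
    fix \<sigma> \<tau> assume st: "\<sigma> \<in> ?C" "\<tau> \<in> ?C"
    have \<tau>L: "\<tau> a \<in> L" if "a \<in> L" for a using st(2) that by (auto simp: carrier_galois_group dest: bij_betwE)
    have "hom_on L \<sigma>" "hom_on L \<tau>" using st by (auto simp: carrier_galois_group)
    then have "hom_on L (compose L \<sigma> \<tau>)"
      using \<tau>L subring_closed[OF L] unfolding hom_on_def by (auto simp: compose_eq)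
    moreover have "bij_betw (compose L \<sigma> \<tau>) L L"
      using st by (auto simp: carrier_galois_group intro: bij_betw_compose)
    moreover have "compose L \<sigma> \<tau> a = a" if "a \<in> K" for a
      using st that KL by (auto simp: carrier_galois_group compose_eq)
    ultimately show "\<sigma> \<otimes>\<^bsub>BijGroup L\<^esub> \<tau> \<in> ?C"
      using bij[OF st(1)] bij[OF st(2)] by (auto simp: BijGroup_def carrier_galois_group)
  next
    fix \<sigma> assume \<sigma>: "\<sigma> \<in> ?C"
    define \<tau> where "\<tau> = inv_into L \<sigma>"
    have b: "bij_betw \<sigma> L L" and h: "hom_on L \<sigma>" and k: "\<forall>a\<in>K. \<sigma> a = a"
      using \<sigma> by (auto simp: carrier_galois_group)
    have st: "\<sigma> (\<tau> a) = a" "\<tau> a \<in> L" "\<tau> (\<sigma> a) = a" if "a \<in> L" for a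
      using that b unfolding \<tau>_def by (auto simp: bij_betw_def f_inv_into_f inv_into_into)
    have "hom_on L (restrict \<tau> L)" unfolding hom_on_def
    proof (intro conjI ballI)
      show "restrict \<tau> L 1 = 1" using st(3)[of 1] subring_1[OF L] h by (simp add: hom_on_def)
      fix a b assume ab: "a \<in> L" "b \<in> L"
      have "\<tau> (\<sigma> (\<tau> a + \<tau> b)) = \<tau> a + \<tau> b" "\<tau> (\<sigma> (\<tau> a * \<tau> b)) = \<tau> a * \<tau> b"
        using st ab subring_closed[OF L] by auto
      moreover have "\<sigma> (\<tau> a + \<tau> b) = a + b" "\<sigma> (\<tau> a * \<tau> b) = a * b"
        using h st ab by (auto simp: hom_on_def)
      ultimately show "restrict \<tau> L (a + b) = restrict \<tau> L a + restrict \<tau> L b"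
        "restrict \<tau> L (a * b) = restrict \<tau> L a * restrict \<tau> L b"
        using ab subring_closed[OF L] by auto
    qed
    moreover have "bij_betw (restrict \<tau> L) L L"
      using bij_betw_inv_into[OF b] by (simp add: \<tau>_def cong: bij_betw_cong)
    moreover have "restrict \<tau> L a = a" if "a \<in> K" for a
      using st(3)[of a] that KL k by auto
    ultimately have "restrict \<tau> L \<in> ?C" by (auto simp: carrier_galois_group)
    then show "inv\<^bsub>BijGroup L\<^esub> \<sigma> \<in> ?C"
      using inv_BijGroup[OF bij[OF \<sigma>]] by (simp add: \<tau>_def restrict_def)
  qed
  from subgroup.subgroup_is_group[OF this group_BijGroup] show ?thesis using eq by simp
qed

lemma carrier_GL: "carrier (GL TYPE('a::field) m) =
    {A \<in> carrier_mat m m. \<exists>B\<in>carrier_mat m m. B * A = 1\<^sub>m m \<and> A * B = 1\<^sub>m m}"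
  by (simp add: GL_def units_of_carrier Units_def ring_mat_simps)

lemma mult_GL: "A \<otimes>\<^bsub>GL TYPE('a::field) m\<^esub> B = A * B"
  by (simp add: GL_def units_of_mult ring_mat_simps)

lemma group_GL: "group (GL TYPE('a::field) m)"
  unfolding GL_def by (rule monoid.units_group) (rule ring.is_monoid[OF ring_mat])

lemma mult_mat_entry:
  assumes "A \<in> carrier_mat m m" "B \<in> carrier_mat m m" "i < m" "j < m"
  shows "(A * B) $$ (i, j) = (\<Sum>k<m. A $$ (i, k) * B $$ (k, j))"
  using assms by (simp add: scalar_prod_def lessThan_atLeast0)

context vectorial
begin

section \<open>Matrices acting on the root space\<close>

definition basis :: "nat \<Rightarrow> 'b" where "basis = (SOME f. indep m f)"

lemma indep_basis: "indep m basis"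
proof -
  have "indep 0 (\<lambda>_. 0)" by (simp add: indep_def)
  from indep_extend[OF this] have "\<exists>f. indep m f" by auto
  then show ?thesis unfolding basis_def by (rule someI_ex)
qed

lemmas basis_V = indep_V[OF indep_basis]

text \<open>Images of basis vectors are stored in columns, so that matrix products correspond to
  compositions in the same order.\<close>

definition column :: "'a mat \<Rightarrow> nat \<Rightarrow> 'b" where
  "column A j = (\<Sum>i<m. \<iota> (A $$ (i, j)) * basis i)"

lemma column_V: "column A j \<in> V"
  unfolding column_def using basis_V by (auto intro!: V_sum)

lemma column_mult:
  assumes "A \<in> carrier_mat m m" "B \<in> carrier_mat m m" "j < m"
  shows "column (A * B) j = (\<Sum>i<m. \<iota> (B $$ (i, j)) * column A i)"
proof -
  have "column (A * B) j = (\<Sum>k<m. \<Sum>i<m. \<iota> (B $$ (i, j)) * (\<iota> (A $$ (k, i)) * basis k))"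
    unfolding column_def
  proof (intro sum.cong refl)
    fix k assume "k \<in> {..<m}"
    then have "\<iota> ((A * B) $$ (k, j)) = (\<Sum>i<m. \<iota> (A $$ (k, i) * B $$ (i, j)))"
      using mult_mat_entry[OF assms(1,2) _ assms(3)] hom_on_sum[OF UNIV_subring \<iota>] by simp
    then show "\<iota> ((A * B) $$ (k, j)) * basis k = (\<Sum>i<m. \<iota> (B $$ (i, j)) * (\<iota> (A $$ (k, i)) * basis k))"
      by (simp add: \<iota>_mult sum_distrib_left sum_distrib_right mult_ac)
  qed
  also have "\<dots> = (\<Sum>i<m. \<iota> (B $$ (i, j)) * column A i)"
    unfolding column_def sum_distrib_left by (rule sum.swap)
  finally show ?thesis .
qed

lemma column_1: "j < m \<Longrightarrow> column (1\<^sub>m m) j = basis j"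
proof -
  assume j: "j < m"
  have "column (1\<^sub>m m) j = (\<Sum>i<m. if i = j then basis i else 0)"
    unfolding column_def using j by (intro sum.cong) auto
  then show ?thesis using j by simp
qed

lemma column_inj:
  assumes "A \<in> carrier_mat m m" "B \<in> carrier_mat m m" "\<And>j. j < m \<Longrightarrow> column A j = column B j"
  shows "A = B"
proof (rule eq_matI)
  fix i j assume "i < dim_row B" "j < dim_col B"
  then have ij: "i < m" "j < m" using assms(2) by auto
  show "A $$ (i, j) = B $$ (i, j)"
    using indep_eq[OF indep_basis assms(3)[OF ij(2), unfolded column_def] ij(1)] .
qed (use assms in auto)

lemma indep_column:
  assumes "A \<in> carrier (GL TYPE('a) m)"
  shows "indep m (column A)"
  unfolding indep_def
proof (intro conjI allI impI)
  show "column A i \<in> V" for i by (rule column_V)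
  fix g i assume g: "(\<Sum>j<m. \<iota> (g j) * column A j) = 0" and i: "i < m"
  obtain B where A: "A \<in> carrier_mat m m" and B: "B \<in> carrier_mat m m" "B * A = 1\<^sub>m m"
    using assms by (auto simp: carrier_GL)
  \<comment> \<open>Repeating the relation g in every column turns it into the matrix equation A G =
    0, which the left inverse of A solves.\<close>
  define G where "G = mat m m (\<lambda>(k, l). g k)"
  have G: "G \<in> carrier_mat m m" by (simp add: G_def)
  have 0: "column (A * G) j = 0" if "j < m" for j
    unfolding column_mult[OF A G that] using g that by (simp add: G_def)
  have "column (A * G) j = column (0\<^sub>m m m) j" if "j < m" for j
    unfolding 0[OF that] using that by (simp add: column_def)
  then have "A * G = 0\<^sub>m m m" using A G by (intro column_inj) auto
  then have "B * (A * G) = 0\<^sub>m m m" using B by simp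
  then have "G = 0\<^sub>m m m" using A B G by (simp flip: assoc_mult_mat)
  then have "G $$ (i, i) = 0" using i by simp
  then show "g i = 0" using i by (simp add: G_def)
qed

definition acts :: "'a mat \<Rightarrow> ('b \<Rightarrow> 'b) \<Rightarrow> bool" where
  "acts A \<sigma> \<longleftrightarrow> Gal \<sigma> \<and> (\<forall>j<m. \<sigma> (basis j) = column A j)"

lemma acts_exists: "A \<in> carrier (GL TYPE('a) m) \<Longrightarrow> \<exists>\<sigma>. acts A \<sigma>"
  unfolding acts_def by (rule Gal_transitive_on_bases[OF indep_column indep_basis])

lemma Gal_eq_if_basis:
  assumes \<sigma>: "Gal \<sigma>" and \<tau>: "Gal \<tau>" and eq: "\<And>j. j < m \<Longrightarrow> \<sigma> (basis j) = \<tau> (basis j)" and a: "a \<in> M"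
  shows "\<sigma> a = \<tau> a"
proof (rule Gal_eqI[OF \<sigma> \<tau> _ a])
  fix u assume u: "u \<in> V"
  have "\<sigma> (\<Sum>i<m. \<iota> (coord basis i u) * basis i) = \<tau> (\<Sum>i<m. \<iota> (coord basis i u) * basis i)"
  proof -
    have "\<sigma> (\<Sum>i<m. \<iota> (coord basis i u) * basis i) = (\<Sum>i<m. \<iota> (coord basis i u) * \<sigma> (basis i))"
      by (rule Gal_sum[OF \<sigma>]) (simp add: basis_V)
    moreover have "\<tau> (\<Sum>i<m. \<iota> (coord basis i u) * basis i) = (\<Sum>i<m. \<iota> (coord basis i u) * \<tau> (basis i))"
      by (rule Gal_sum[OF \<tau>]) (simp add: basis_V)
    ultimately show ?thesis using eq by simp
  qed
  then show "\<sigma> u = \<tau> u" by (simp add: coord_sum[OF indep_basis u])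
qed

lemma acts_unique: "acts A \<sigma> \<Longrightarrow> acts A \<tau> \<Longrightarrow> a \<in> M \<Longrightarrow> \<sigma> a = \<tau> a"
  by (rule Gal_eq_if_basis) (auto simp: acts_def)

lemma acts_mult:
  assumes "A \<in> carrier_mat m m" "B \<in> carrier_mat m m" "acts A \<sigma>" "acts B \<tau>"
  shows "acts (A * B) (\<sigma> \<circ> \<tau>)"
proof -
  have \<sigma>: "Gal \<sigma>" and \<tau>: "Gal \<tau>" using assms by (auto simp: acts_def)
  have "\<sigma> (\<tau> (basis j)) = column (A * B) j" if j: "j < m" for j
  proof -
    have "\<tau> (basis j) = column B j" using assms(4) j by (simp add: acts_def)
    then have "\<sigma> (\<tau> (basis j)) = (\<Sum>i<m. \<iota> (B $$ (i, j)) * \<sigma> (basis i))"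
      unfolding column_def by (simp only:) (rule Gal_sum[OF \<sigma>], simp add: basis_V)
    also have "\<dots> = (\<Sum>i<m. \<iota> (B $$ (i, j)) * column A i)"
      using assms(3) by (intro sum.cong) (auto simp: acts_def)
    finally show ?thesis unfolding column_mult[OF assms(1,2) j] .
  qed
  then show ?thesis using Gal_comp[OF \<sigma> \<tau>] by (simp add: acts_def)
qed

definition matrix_of :: "('b \<Rightarrow> 'b) \<Rightarrow> 'a mat" where
  "matrix_of \<sigma> = mat m m (\<lambda>(i, j). coord basis i (\<sigma> (basis j)))"

lemma matrix_of_carrier: "matrix_of \<sigma> \<in> carrier_mat m m"
  by (simp add: matrix_of_def)

lemma acts_matrix_of:
  assumes "Gal \<sigma>"
  shows "acts (matrix_of \<sigma>) \<sigma>"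
proof -
  have "column (matrix_of \<sigma>) j = \<sigma> (basis j)" if j: "j < m" for j
  proof -
    have "column (matrix_of \<sigma>) j = (\<Sum>i<m. \<iota> (coord basis i (\<sigma> (basis j))) * basis i)"
      unfolding column_def using j by (intro sum.cong) (auto simp: matrix_of_def)
    then show ?thesis using coord_sum[OF indep_basis Gal_V[OF assms basis_V[OF j]]] by simp
  qed
  then show ?thesis using assms by (simp add: acts_def)
qed

lemma matrix_of_GL:
  assumes "Gal \<sigma>"
  shows "matrix_of \<sigma> \<in> carrier (GL TYPE('a) m)"
proof -
  obtain \<tau> where \<tau>: "Gal \<tau>" "\<forall>a\<in>M. \<sigma> (\<tau> a) = a \<and> \<tau> (\<sigma> a) = a" using Gal_inverse[OF assms] by blast
  let ?A = "matrix_of \<sigma>" and ?B = "matrix_of \<tau>"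
  have M: "basis j \<in> M" if "j < m" for j using basis_V[OF that] V_M by blast
  have "?A * ?B = 1\<^sub>m m"
  proof (rule column_inj)
    fix j assume j: "j < m"
    have "(\<sigma> \<circ> \<tau>) (basis j) = column (?A * ?B) j"
      using acts_mult[OF matrix_of_carrier matrix_of_carrier acts_matrix_of[OF assms] acts_matrix_of[OF \<tau>(1)]] j
      by (simp add: acts_def)
    then show "column (?A * ?B) j = column (1\<^sub>m m) j" using \<tau>(2) M[OF j] column_1[OF j] by simp
  qed (use matrix_of_carrier in \<open>auto intro: mult_carrier_mat\<close>)
  moreover have "?B * ?A = 1\<^sub>m m"
  proof (rule column_inj)
    fix j assume j: "j < m"
    have "(\<tau> \<circ> \<sigma>) (basis j) = column (?B * ?A) j"
      using acts_mult[OF matrix_of_carrier matrix_of_carrier acts_matrix_of[OF \<tau>(1)] acts_matrix_of[OF assms]] j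
      by (simp add: acts_def)
    then show "column (?B * ?A) j = column (1\<^sub>m m) j" using \<tau>(2) M[OF j] column_1[OF j] by simp
  qed (use matrix_of_carrier in \<open>auto intro: mult_carrier_mat\<close>)
  ultimately show ?thesis using matrix_of_carrier by (auto simp: carrier_GL)
qed

section \<open>Restriction from \<open>M\<close> to the field \<open>L\<close> generated by the
  points of the projective space\<close>

definition roots :: "'b set" where "roots = {v ^ (q - 1) | v. v \<in> V \<and> v \<noteq> 0}"

definition L :: "'b set" where "L = gen_field (K \<union> roots)"

lemma is_subfield_L: "is_subfield L"
  unfolding L_def by (rule is_subfield_gen_field)

lemmas is_subring_L = subfieldD[OF is_subfield_L]

lemma K_L: "K \<subseteq> L" and roots_L: "roots \<subseteq> L"
  using gen_field_base[of "K \<union> roots"] by (auto simp: L_def)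

lemma L_least: "is_subfield B \<Longrightarrow> K \<subseteq> B \<Longrightarrow> roots \<subseteq> B \<Longrightarrow> L \<subseteq> B"
  unfolding L_def by (rule gen_field_least) auto

lemma L_M: "L \<subseteq> M"
proof (rule L_least[OF is_subfield_M K_M])
  show "roots \<subseteq> M" unfolding roots_def using V_M by (auto intro!: subring_power[OF is_subring_M])
qed

context
  fixes \<sigma> assumes \<sigma>: "Gal \<sigma>"
begin

lemma Gal_inverse_elt: "a \<in> M \<Longrightarrow> \<sigma> (inverse a) = inverse (\<sigma> a)"
  by (rule hom_on_inverse[OF is_subfield_M Gal_hom[OF \<sigma>]])

lemma Gal_root: assumes "v \<in> V" shows "\<sigma> (v ^ (q - 1)) = \<sigma> v ^ (q - 1)"
  using Gal_power[OF \<sigma>] assms V_M by blast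

lemma Gal_nonzero: "v \<in> V \<Longrightarrow> v \<noteq> 0 \<Longrightarrow> \<sigma> v \<noteq> 0"
  using hom_on_eq_0[OF is_subfield_M Gal_hom[OF \<sigma>]] V_M by blast

lemma Gal_L: assumes "a \<in> L" shows "\<sigma> a \<in> L"
proof -
  have "is_subfield {a \<in> L. \<sigma> a \<in> L}"
    unfolding is_subfield_def is_subring_def
    using subring_closed[OF is_subring_L] subfield_inverse[OF is_subfield_L] L_M
      Gal_1[OF \<sigma>] Gal_diff[OF \<sigma>] Gal_mult[OF \<sigma>] Gal_inverse_elt
    by (auto simp: subset_iff)
  moreover have "K \<subseteq> {a \<in> L. \<sigma> a \<in> L}" using K_L Gal_K[OF \<sigma>] by auto
  moreover have "roots \<subseteq> {a \<in> L. \<sigma> a \<in> L}"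
  proof
    fix y assume y: "y \<in> roots"
    then obtain v where v: "y = v ^ (q - 1)" "v \<in> V" "v \<noteq> 0" by (auto simp: roots_def)
    then have "\<sigma> y \<in> roots" using Gal_root Gal_V[OF \<sigma>] Gal_nonzero by (auto simp: roots_def)
    then show "y \<in> {a \<in> L. \<sigma> a \<in> L}" using y roots_L by blast
  qed
  ultimately have "L \<subseteq> {a \<in> L. \<sigma> a \<in> L}" by (rule L_least)
  then show ?thesis using assms by blast
qed

end

lemma restrict_galois:
  assumes \<sigma>: "Gal \<sigma>"
  shows "restrict \<sigma> L \<in> carrier (galois_group K L)"
proof -
  obtain \<tau> where \<tau>: "Gal \<tau>" "\<forall>a\<in>M. \<sigma> (\<tau> a) = a \<and> \<tau> (\<sigma> a) = a" using Gal_inverse[OF \<sigma>] by blast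
  have "bij_betw \<sigma> L L"
    by (rule bij_betw_byWitness[of _ \<tau>]) (use \<tau> L_M Gal_L[OF \<sigma>] Gal_L[OF \<tau>(1)] in auto)
  then have "bij_betw (restrict \<sigma> L) L L" by (simp cong: bij_betw_cong)
  moreover have "hom_on L (restrict \<sigma> L)"
    using hom_on_subset[OF Gal_hom[OF \<sigma>] L_M] subring_closed[OF is_subring_L]
    unfolding hom_on_def by simp
  moreover have "restrict \<sigma> L a = a" if "a \<in> K" for a
    using that K_L Gal_K[OF \<sigma>] by auto
  ultimately show ?thesis by (simp add: carrier_galois_group)
qed

text \<open>\<open>V\<close> is algebraic over \<open>L\<close>, so \<sigma> extends to
  \<open>M\<close> as a homomorphism into the algebraic closure, and fixing \<open>K\<close> is all
  that \<open>Gal\<close> asks for.\<close>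

lemma galois_extends:
  assumes "\<sigma> \<in> carrier (galois_group K L)"
  shows "\<exists>\<tau>. Gal \<tau> \<and> (\<forall>a\<in>L. \<tau> a = \<sigma> a)"
proof -
  have \<sigma>: "hom_on L \<sigma>" "\<forall>a\<in>K. \<sigma> a = a" using assms by (auto simp: carrier_galois_group)
  have "\<forall>v\<in>set vs. algebraic_over L v"
    using V_algebraic[OF is_subring_L K_L] by (simp add: set_vs)
  from extend_hom_adjoins[OF is_subfield_L \<sigma>(1) this]
  obtain \<tau> where \<tau>: "hom_on (adjoins L vs) \<tau>" "\<forall>a\<in>L. \<tau> a = \<sigma> a" by blast
  have "M \<subseteq> adjoins L vs"
    using adjoins_base[OF is_subring_L, of vs] adjoins_gen[OF is_subring_L, of vs] K_L
    by (intro M_least is_subring_adjoins[OF is_subring_L]) (auto simp: set_vs)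
  from hom_on_subset[OF \<tau>(1) this] have "Gal \<tau>" using \<tau>(2) \<sigma>(2) K_L by (auto simp: Gal_def)
  then show ?thesis using \<tau>(2) by blast
qed

text \<open>The choice is immaterial: the matrix determines the automorphism on \<open>M\<close>,
  hence on \<open>L\<close>.\<close>

definition \<Psi> :: "'a mat \<Rightarrow> 'b \<Rightarrow> 'b" where "\<Psi> A = restrict (SOME \<sigma>. acts A \<sigma>) L"

lemma \<Psi>_eq:
  assumes "acts A \<sigma>"
  shows "\<Psi> A = restrict \<sigma> L"
proof -
  have "acts A (SOME \<sigma>. acts A \<sigma>)" using assms by (rule someI[of "acts A"])
  then show ?thesis unfolding \<Psi>_def using acts_unique[OF _ assms] L_M
    by (intro restrict_ext) (meson subsetD)
qed

lemma group_hom_\<Psi>: "group_hom (GL TYPE('a) m) (galois_group K L) \<Psi>"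
proof -
  have G: "group (galois_group K L)" by (rule group_galois_group[OF is_subring_L K_L])
  have "\<Psi> \<in> hom (GL TYPE('a) m) (galois_group K L)"
  proof (rule homI)
    fix A assume "A \<in> carrier (GL TYPE('a) m)"
    then obtain \<sigma> where "acts A \<sigma>" using acts_exists by blast
    then show "\<Psi> A \<in> carrier (galois_group K L)"
      using \<Psi>_eq restrict_galois by (simp add: acts_def)
  next
    fix A B assume AB: "A \<in> carrier (GL TYPE('a) m)" "B \<in> carrier (GL TYPE('a) m)"
    obtain \<sigma> \<tau> where st: "acts A \<sigma>" "acts B \<tau>" using acts_exists AB by blast
    have c: "A \<in> carrier_mat m m" "B \<in> carrier_mat m m" using AB by (auto simp: carrier_GL)
    have G': "restrict \<sigma> L \<in> carrier (galois_group K L)" "restrict \<tau> L \<in> carrier (galois_group K L)"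
      using st restrict_galois by (auto simp: acts_def)
    have "Gal \<tau>" using st by (simp add: acts_def)
    have "\<Psi> (A * B) = restrict (\<sigma> \<circ> \<tau>) L" by (rule \<Psi>_eq[OF acts_mult[OF c st]])
    also have "\<dots> = compose L (restrict \<sigma> L) (restrict \<tau> L)"
      using Gal_L[OF \<open>Gal \<tau>\<close>] by (auto simp: compose_def fun_eq_iff)
    also have "\<dots> = \<Psi> A \<otimes>\<^bsub>galois_group K L\<^esub> \<Psi> B"
      using mult_galois_group[OF G'] \<Psi>_eq[OF st(1)] \<Psi>_eq[OF st(2)] by simp
    finally show "\<Psi> (A \<otimes>\<^bsub>GL TYPE('a) m\<^esub> B) = \<Psi> A \<otimes>\<^bsub>galois_group K L\<^esub> \<Psi> B" by (simp add: mult_GL)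
  qed
  then show ?thesis using G group_GL by (simp add: group_hom_def group_hom_axioms_def)
qed

lemma \<Psi>_surj: "\<Psi> ` carrier (GL TYPE('a) m) = carrier (galois_group K L)"
proof
  interpret group_hom "GL TYPE('a) m" "galois_group K L" \<Psi> by (rule group_hom_\<Psi>)
  show "\<Psi> ` carrier (GL TYPE('a) m) \<subseteq> carrier (galois_group K L)" by auto
  show "carrier (galois_group K L) \<subseteq> \<Psi> ` carrier (GL TYPE('a) m)"
  proof
    fix \<sigma> assume s: "\<sigma> \<in> carrier (galois_group K L)"
    then obtain \<tau> where \<tau>: "Gal \<tau>" "\<forall>a\<in>L. \<tau> a = \<sigma> a" using galois_extends by blast
    have "\<sigma> \<in> extensional L" using s by (simp add: carrier_galois_group)
    then have "\<sigma> = restrict \<tau> L" using \<tau>(2) by (auto simp: extensional_def fun_eq_iff)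
    also have "\<dots> = \<Psi> (matrix_of \<tau>)" by (rule \<Psi>_eq[symmetric, OF acts_matrix_of[OF \<tau>(1)]])
    finally show "\<sigma> \<in> \<Psi> ` carrier (GL TYPE('a) m)" using matrix_of_GL[OF \<tau>(1)] by blast
  qed
qed

lemma root_eq_imp_scaled:
  assumes "v \<noteq> 0" "u ^ (q - 1) = v ^ (q - 1)"
  shows "\<exists>c. u = \<iota> c * v"
proof -
  have "(u / v) ^ (q - 1) = 1" using assms by (simp add: power_divide)
  then have "(u / v) ^ q = u / v"
    using power_minus_mult[of q "u / v"] q_ge by simp
  then obtain c where "u / v = \<iota> c" using range_\<iota> by blast
  then show ?thesis using assms(1) by (metis nonzero_divide_eq_eq)
qed

text \<open>Fixing \<open>L\<close> means fixing every v^(q-1), that is, mapping every line of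
  \<open>V\<close> to itself, and a linear map with this property is a scalar. Conversely a nonzero
  scalar c disappears in v^(q-1), since c^(q-1) = 1.\<close>

lemma kernel_\<Psi>: "kernel (GL TYPE('a) m) (galois_group K L) \<Psi> = scalar_matrices TYPE('a) m"
proof (intro equalityI subsetI)
  fix A assume A': "A \<in> kernel (GL TYPE('a) m) (galois_group K L) \<Psi>"
  then have A: "A \<in> carrier (GL TYPE('a) m)" and one: "\<Psi> A = (\<lambda>a\<in>L. a)"
    by (auto simp: kernel_def one_galois_group)
  then have Am: "A \<in> carrier_mat m m" by (simp add: carrier_GL)
  obtain \<sigma> where \<sigma>: "acts A \<sigma>" using acts_exists[OF A] by blast
  then have G: "Gal \<sigma>" by (simp add: acts_def)
  have "restrict \<sigma> L = (\<lambda>a\<in>L. a)" using one \<Psi>_eq[OF \<sigma>] by simp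
  then have id: "\<sigma> a = a" if "a \<in> L" for a using that by (metis restrict_apply')
  have sc: "\<exists>c. \<sigma> v = \<iota> c * v" if v: "v \<in> V" "v \<noteq> 0" for v
  proof (rule root_eq_imp_scaled[OF v(2)])
    have "v ^ (q - 1) \<in> roots" using v by (auto simp: roots_def)
    then show "\<sigma> v ^ (q - 1) = v ^ (q - 1)" using id roots_L Gal_root[OF G v(1)] by auto
  qed
  have bnz: "basis j \<noteq> 0" if "j < m" for j
    using coord_basis[OF indep_basis that that] lin_on_V_0[OF lin_on_V_coord[OF indep_basis that]] by auto
  then have "\<forall>j. \<exists>c. j < m \<longrightarrow> \<sigma> (basis j) = \<iota> c * basis j" using sc basis_V by blast
  then obtain c where c: "\<And>j. j < m \<Longrightarrow> \<sigma> (basis j) = \<iota> (c j) * basis j" by metis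
  have m0: "0 < m" using m by simp
  \<comment> \<open>The sum of two basis vectors is also mapped to a multiple of itself; comparing
    coordinates makes the two factors equal.\<close>
  have cc: "c j = c 0" if j: "j < m" for j
  proof (cases "j = 0")
    case False
    note cb = coord_basis[OF indep_basis] and lc = lin_on_V_coord[OF indep_basis]
    define v where "v = basis 0 + basis j"
    have vV: "v \<in> V" unfolding v_def using basis_V m0 j by (intro V_add) auto
    have "coord basis j v = 1"
      unfolding v_def using lin_on_V_add[OF lc[OF j] basis_V[OF m0] basis_V[OF j]] cb[OF j j] cb[OF j m0] False by simp
    then have "v \<noteq> 0" using lin_on_V_0[OF lc[OF j]] by auto
    then obtain d where d: "\<sigma> v = \<iota> d * v" using sc[OF vV] by blast
    have "basis 0 \<in> M" "basis j \<in> M" using basis_V m0 j V_M by blast+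
    then have "\<iota> d * basis 0 + \<iota> d * basis j = \<iota> (c 0) * basis 0 + \<iota> (c j) * basis j"
      using d c[OF m0] c[OF j] by (simp add: v_def Gal_add[OF G] distrib_left)
    then have eq: "coord basis i (\<iota> d * basis 0 + \<iota> d * basis j) =
        coord basis i (\<iota> (c 0) * basis 0 + \<iota> (c j) * basis j)" for i by simp
    have ex: "coord basis i (\<iota> a * basis 0 + \<iota> b * basis j) = a * coord basis i (basis 0) + b * coord basis i (basis j)"
      if "i < m" for i a b
      using lin_on_V_add[OF lc[OF that] V_scale[OF basis_V[OF m0]] V_scale[OF basis_V[OF j]]]
        lin_on_V_scale[OF lc[OF that] basis_V[OF m0]] lin_on_V_scale[OF lc[OF that] basis_V[OF j]] by simp
    have "d = c 0" "d = c j"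
      using eq[of 0] eq[of j] cb[OF m0 m0] cb[OF j j] cb[OF m0 j] cb[OF j m0] False
      by (simp_all add: ex[OF m0] ex[OF j])
    then show ?thesis by simp
  qed simp
  have "A = c 0 \<cdot>\<^sub>m 1\<^sub>m m"
  proof (rule column_inj[OF Am])
    fix j assume j: "j < m"
    have "column (c 0 \<cdot>\<^sub>m 1\<^sub>m m) j = (\<Sum>i<m. if i = j then \<iota> (c 0) * basis i else 0)"
      unfolding column_def using j by (intro sum.cong) auto
    also have "\<dots> = \<iota> (c 0) * basis j" using j by simp
    also have "\<dots> = column A j" using c[OF j] cc[OF j] \<sigma> j by (simp add: acts_def)
    finally show "column A j = column (c 0 \<cdot>\<^sub>m 1\<^sub>m m) j" by simp
  qed simp
  moreover have "c 0 \<noteq> 0"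
    using c[OF m0] Gal_nonzero[OF G basis_V[OF m0] bnz[OF m0]] by auto
  ultimately show "A \<in> scalar_matrices TYPE('a) m" unfolding scalar_matrices_def by blast
next
  fix A assume "A \<in> scalar_matrices TYPE('a) m"
  then obtain c where c: "A = c \<cdot>\<^sub>m 1\<^sub>m m" "c \<noteq> 0" by (auto simp: scalar_matrices_def)
  have "inverse c \<cdot>\<^sub>m 1\<^sub>m m * A = 1\<^sub>m m" "A * (inverse c \<cdot>\<^sub>m 1\<^sub>m m) = 1\<^sub>m m"
    using c by (auto intro!: eq_matI)
  then have A: "A \<in> carrier (GL TYPE('a) m)"
    using c by (auto simp: carrier_GL intro!: bexI[of _ "inverse c \<cdot>\<^sub>m 1\<^sub>m m"])
  then obtain \<sigma> where \<sigma>: "acts A \<sigma>" using acts_exists by blast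
  then have G: "Gal \<sigma>" by (simp add: acts_def)
  have sb: "\<sigma> (basis j) = \<iota> c * basis j" if j: "j < m" for j
  proof -
    have "column A j = (\<Sum>i<m. if i = j then \<iota> c * basis i else 0)"
      unfolding column_def c(1) using j by (intro sum.cong) auto
    then show ?thesis using \<sigma> j by (simp add: acts_def)
  qed
  have sV: "\<sigma> v = \<iota> c * v" if v: "v \<in> V" for v
  proof -
    have "\<sigma> (\<Sum>i<m. \<iota> (coord basis i v) * basis i) = (\<Sum>i<m. \<iota> (coord basis i v) * \<sigma> (basis i))"
      using basis_V by (intro Gal_sum[OF G]) auto
    also have "\<dots> = \<iota> c * (\<Sum>i<m. \<iota> (coord basis i v) * basis i)"
      unfolding sum_distrib_left using sb by (intro sum.cong) auto
    finally show ?thesis by (simp add: coord_sum[OF indep_basis v])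
  qed
  have c1: "\<iota> c ^ (q - 1) = 1"
    using power_minus_mult[of q "\<iota> c"] q_ge c(2) by simp
  have "is_subfield {a \<in> L. \<sigma> a = a}"
    unfolding is_subfield_def is_subring_def
    using subring_closed[OF is_subring_L] subfield_inverse[OF is_subfield_L] L_M
      Gal_1[OF G] Gal_diff[OF G] Gal_mult[OF G] Gal_inverse_elt[OF G]
    by (auto simp: subset_iff)
  moreover have "K \<subseteq> {a \<in> L. \<sigma> a = a}" using K_L Gal_K[OF G] by auto
  moreover have "roots \<subseteq> {a \<in> L. \<sigma> a = a}"
  proof
    fix y assume y: "y \<in> roots"
    then obtain v where v: "y = v ^ (q - 1)" "v \<in> V" by (auto simp: roots_def)
    then have "\<sigma> y = y" using Gal_root[OF G v(2)] sV[OF v(2)] c1 by (simp add: power_mult_distrib)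
    then show "y \<in> {a \<in> L. \<sigma> a = a}" using y roots_L by blast
  qed
  ultimately have "L \<subseteq> {a \<in> L. \<sigma> a = a}" by (rule L_least)
  then have "restrict \<sigma> L = (\<lambda>a\<in>L. a)" by (intro restrict_ext) blast
  then have "\<Psi> A = \<one>\<^bsub>galois_group K L\<^esub>" using \<Psi>_eq[OF \<sigma>] by (simp add: one_galois_group)
  then show "A \<in> kernel (GL TYPE('a) m) (galois_group K L) \<Psi>" using A by (simp add: kernel_def)
qed

theorem galois_group_iso_PGL: "galois_group K L \<cong> PGL TYPE('a) m"
proof -
  interpret group_hom "GL TYPE('a) m" "galois_group K L" \<Psi> by (rule group_hom_\<Psi>)
  have "PGL TYPE('a) m \<cong> galois_group K L"
    using FactGroup_iso[OF \<Psi>_surj] by (simp add: kernel_\<Psi> PGL_def)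
  moreover have "group (PGL TYPE('a) m)"
    using normal.factorgroup_is_group[OF normal_kernel] by (simp add: kernel_\<Psi> PGL_def)
  ultimately show ?thesis using group.iso_sym by blast
qed

section \<open>The zeros of f and their number\<close>

definition N :: nat where "N = (q ^ m - 1) div (q - 1)"

lemma N_eq: "N = (\<Sum>i<m. q ^ i)" and N_mult: "(q - 1) * N = q ^ m - 1"
proof -
  have "(q - 1) * (\<Sum>i<n. q ^ i) + 1 = q ^ n" for n
  proof (induction n)
    case (Suc n)
    have "(q - 1) * (\<Sum>i<Suc n. q ^ i) + 1 = (q - 1) * q ^ n + q ^ n"
      using Suc by (simp add: distrib_left)
    also have "\<dots> = q * q ^ n" using q_ge by (simp add: diff_mult_distrib)
    finally show ?case by simp
  qed simp
  from this[of m] have eq: "(q - 1) * (\<Sum>i<m. q ^ i) = q ^ m - 1" by (metis add_diff_cancel_right')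
  then show "N = (\<Sum>i<m. q ^ i)" unfolding N_def using q_ge by (metis nonzero_mult_div_cancel_left
        diff_is_0_eq not_numeral_le_zero numeral_le_one_iff order_trans semiring_norm(70) zero_neq_one le_trans)
  with eq show "(q - 1) * N = q ^ m - 1" by simp
qed

text \<open>N is 1 plus a multiple of q, so the exponent N acts as 1 in the derivative of f.\<close>

lemma N_pos: "2 \<le> N" and of_nat_N: "of_nat N = (1 :: 'b)"
proof -
  obtain n where n: "m = Suc n" "0 < n" using m by (cases m) auto
  have "N = (\<Sum>i<Suc n. q ^ i)" using N_eq n(1) by simp
  also have "\<dots> = 1 + (\<Sum>i<n. q ^ Suc i)" by (subst sum.lessThan_Suc_shift) simp
  finally have "N = 1 + (\<Sum>i<n. q ^ Suc i)" .
  then have N: "N = 1 + q * (\<Sum>i<n. q ^ i)" by (simp add: sum_distrib_left)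
  then show "of_nat N = (1 :: 'b)" by simp
  have "(\<Sum>i<n. q ^ i) \<noteq> 0" using n(2) q_ge by auto
  then show "2 \<le> N" using N q_ge by (cases "(\<Sum>i<n. q ^ i)") auto
qed

text \<open>Connects the set defined through \<open>V\<close>, on which the Galois action is
  visible, with the polynomial f. A zero y is nonzero because f(0) = t, and it has a (q-1)-th root
  in the algebraic closure.\<close>

lemma roots_eq: "roots = {y. y ^ N + y + t = 0}"
proof -
  have key: "v ^ (q ^ m) + v ^ q + t * v = v * ((v ^ (q - 1)) ^ N + v ^ (q - 1) + t)" for v :: 'b
  proof -
    have "v ^ (q ^ m) = v * v ^ (q ^ m - 1)" "v ^ q = v * v ^ (q - 1)"
      using q_ge by (simp_all flip: power_Suc)
    moreover have "v ^ (q ^ m - 1) = (v ^ (q - 1)) ^ N" by (simp only: N_mult[symmetric] power_mult)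
    ultimately show ?thesis by (simp add: algebra_simps)
  qed
  show ?thesis
  proof (intro equalityI subsetI)
    fix y assume "y \<in> roots"
    then show "y \<in> {y. y ^ N + y + t = 0}" using key by (auto simp: roots_def V_def)
  next
    fix y assume y: "y \<in> {y. y ^ N + y + t = 0}"
    have "0 < q - 1" using q_ge by simp
    from nth_root_exists[OF this] obtain v where v: "v ^ (q - 1) = y" by blast
    have "y \<noteq> 0" using y t_nonzero N_pos by (auto simp: power_0_left)
    then have "v \<noteq> 0" using v q_ge by auto
    moreover have "v \<in> V" unfolding V_def mem_Collect_eq key using y v by simp
    ultimately show "y \<in> roots" using v by (auto simp: roots_def)
  qed
qed

lemma card_roots: "card roots = N"
proof -
  define F where "F = Polynomial.monom 1 N + Polynomial.monom 1 1 + [:t:]"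
  have pF: "poly F y = y ^ N + y + t" for y by (simp add: F_def poly_monom)
  have dF: "degree F = N"
  proof -
    have "degree (Polynomial.monom 1 1 + [:t:]) \<le> 1" by (intro degree_add_le) (auto simp: degree_monom_eq)
    then show ?thesis unfolding F_def add.assoc
      using N_pos by (subst degree_add_eq_left) (auto simp: degree_monom_eq)
  qed
  have "rsquarefree F"
  proof (rule rsquarefree_if_pderiv_nonzero)
    fix y assume "poly F y = 0"
    show "poly (pderiv F) y \<noteq> 0"
    proof
      assume "poly (pderiv F) y = 0"
      then have "y ^ (N - 1) + 1 = 0"
        using of_nat_N by (simp add: F_def pderiv_add pderiv_monom poly_monom pderiv_pCons)
      then have "y * y ^ (N - 1) + y = 0" by (metis distrib_left mult.right_neutral mult_zero_right)
      \<comment> \<open>Multiplying the vanishing derivative y^(N-1) + 1 by y gives f(y) = t, which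
        is not zero.\<close>
      then have "y ^ N + y = 0" using N_pos power_minus_mult[of N y] by (simp add: mult.commute)
      then show False using \<open>poly F y = 0\<close> t_nonzero by (simp add: pF)
    qed
  qed (use dF N_pos in auto)
  from card_roots_rsquarefree[OF this] show ?thesis by (simp add: roots_eq pF dF)
qed

end

section \<open>Points of the curve\<close>

text \<open>The last coordinate 1 forces the scaling factor to be 1.\<close>

lemma weighted_scaling_class_inj:
  assumes "1 \<in> L" and eq: "weighted_scaling h L `` {(x, y, 1)} = weighted_scaling h L `` {(x', y', 1)}"
  shows "x = x' \<and> y = y'"
proof -
  have "((x', y', 1), (1 * x', 1 ^ h * y', 1 * 1)) \<in> weighted_scaling h L"
    unfolding weighted_scaling_def using assms(1) one_neq_zero by blast
  then have "(x', y', 1) \<in> weighted_scaling h L `` {(x, y, 1)}" unfolding eq by simp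
  then obtain c where "(x', y', 1) = (c * x, c ^ h * y, c * 1)" by (auto simp: weighted_scaling_def)
  then show ?thesis by auto
qed

text \<open>Twice the weight is the degree or one more, so at z = 1 the homogenized sum only adds
  vanishing coefficients.\<close>

lemma affine_point_in_cone:
  assumes "1 \<in> L" "x \<in> L" "y \<in> L" "y ^ 2 = poly g x"
  shows "(x, y, 1) \<in> curve_cone g L"
proof -
  have "poly g x = (\<Sum>i\<le>2 * curve_weight g. Polynomial.coeff g i * x ^ i)"
    unfolding poly_altdef by (rule sum.mono_neutral_left) (auto simp: curve_weight_def coeff_eq_0)
  then show ?thesis unfolding curve_cone_def using assms by auto
qed

text \<open>The bound is an injection rather than an inequality of \<open>card\<close>, which would
  be 0 on an infinite set of points.\<close>

lemma curve_points_lepoll: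
  assumes L: "is_subring L" and R: "R \<subseteq> L" "finite R" and d: "d \<in> L" "d \<noteq> - d"
    and g: "\<And>x. x \<in> R \<Longrightarrow> poly g x = d ^ 2"
  shows "lepoll {..<2 * card R} (curve_points g L)"
proof -
  define A where "A = R \<times> {d, - d}"
  define F where "F = (\<lambda>(x, y). weighted_scaling (curve_weight g) L `` {(x, y, 1 :: 'a)})"
  have 1: "1 \<in> L" using subring_1[OF L] .
  have "finite A" "card A = 2 * card R" using R(2) d(2) by (simp_all add: A_def card_cartesian_product)
  then obtain \<beta> where \<beta>: "bij_betw \<beta> {..<2 * card R} A"
    using ex_bij_betw_nat_finite[of A] by (auto simp: lessThan_atLeast0)
  have "inj_on F A"
    unfolding F_def inj_on_def using weighted_scaling_class_inj[OF 1] by fastforce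
  moreover have "F ` A \<subseteq> curve_points g L"
  proof
    fix y assume "y \<in> F ` A"
    then obtain a s where as: "a \<in> R" "s \<in> {d, - d}" "y = F (a, s)" by (auto simp: A_def)
    have "(a, s, 1) \<in> curve_cone g L"
      using as R(1) d(1) subring_uminus[OF L d(1)] g[OF as(1)] by (intro affine_point_in_cone[OF 1]) auto
    then show "y \<in> curve_points g L" unfolding as(3) F_def curve_points_def by (auto intro: quotientI)
  qed
  ultimately have "inj_on (F \<circ> \<beta>) {..<2 * card R} \<and> (F \<circ> \<beta>) ` {..<2 * card R} \<subseteq> curve_points g L"
    using \<beta> by (auto simp: bij_betw_def comp_inj_on image_comp[symmetric])
  then show ?thesis unfolding lepoll_def by blast
qed

theorem theorem3p5:
  fixes p q k m N :: nat
    and f g :: "'a::{field,finite} poly fract poly"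
    and d :: "'a poly fract"
    and L :: "'a poly fract alg_closure set"
  assumes "prime p" and "odd p" and "k \<ge> 1" and "q = p ^ k" and "CARD('a) = q"
    and "m \<ge> 2" and "N = (q ^ m - 1) div (q - 1)"
    and "f = Polynomial.monom 1 N + Polynomial.monom 1 1 + [:ratfun_t:]"
    and "L = splitting_field f"
    and "d \<noteq> 0" and "g = f + [:d ^ 2:]"
    and "rsquarefree (map_poly to_ac g)"
  shows "galois_group (range to_ac) L \<cong> PGL TYPE('a) m
       \<and> lepoll {..<2 * N} (curve_points (map_poly to_ac g) L)"
proof -
  define \<iota> :: "'a \<Rightarrow> 'a poly fract alg_closure" where "\<iota> c = to_ac (Fract [:c:] 1)" for c
  define t :: "'a poly fract alg_closure" where "t = to_ac ratfun_t"
  have \<iota>: "hom_on UNIV \<iota>"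
    by (simp add: hom_on_def \<iota>_def One_fract_def mult.commute flip: to_ac_add to_ac_mult one_pCons)
  have \<iota>0: "\<iota> 0 = 0" by (simp add: \<iota>_def flip: Zero_fract_def)
  \<comment> \<open>Evaluation at t is the embedding of polynomials into their fraction field;
    transcendence of t and the quotient form of elements of \<open>K\<close> both follow from
    this.\<close>
  have ev: "poly (map_poly \<iota> h) t = to_ac (Fract h 1)" for h
  proof (induction h)
    case (pCons c h)
    have "poly (map_poly \<iota> (pCons c h)) t = \<iota> c + t * to_ac (Fract h 1)"
      by (simp add: map_poly_pCons \<iota>0 pCons.IH)
    also have "\<dots> = to_ac (Fract [:c:] 1 + Fract [:0, 1:] 1 * Fract h 1)"
      by (simp only: \<iota>_def t_def ratfun_t_def to_ac_add to_ac_mult)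
    also have "Fract [:c:] 1 + Fract [:0, 1:] 1 * Fract h 1 = Fract (pCons c h) 1" by simp
    finally show ?case .
  qed (simp flip: Zero_fract_def)
  have inj: "to_ac a = to_ac b \<Longrightarrow> a = b" for a b :: "'a poly fract" by simp
  have range: "is_subfield (range (to_ac :: 'a poly fract \<Rightarrow> _))"
    unfolding is_subfield_def is_subring_def
    by (auto simp flip: to_ac_1 to_ac_diff to_ac_mult to_ac_inverse)
  interpret V: vectorial \<iota> t "range to_ac" m p k q
  proof
    show "prime p" "odd p" "CARD('a) = q" "q = p ^ k" "2 \<le> m" by fact+
    show "hom_on UNIV \<iota>" "is_subfield (range (to_ac :: 'a poly fract \<Rightarrow> _))" by fact+
    show "range \<iota> \<subseteq> range to_ac" "t \<in> range to_ac" by (auto simp: \<iota>_def t_def)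
    show "h = 0" if "poly (map_poly \<iota> h) t = 0" for h
      using that unfolding ev by (simp add: Zero_fract_def eq_fract flip: to_ac_0)
    show "\<exists>h h'. a = poly (map_poly \<iota> h) t / poly (map_poly \<iota> h') t" if "a \<in> range to_ac" for a
    proof -
      obtain b where b: "a = to_ac b" using \<open>a \<in> range to_ac\<close> by blast
      obtain h h' where "b = Fract h h'" "h' \<noteq> 0" by (cases b)
      then have "b = Fract h 1 / Fract h' 1" by simp
      then have "a = poly (map_poly \<iota> h) t / poly (map_poly \<iota> h') t"
        unfolding ev b by (simp only: to_ac_divide)
      then show ?thesis by blast
    qed
  qed
  have N: "N = V.N" by (simp add: V.N_def assms(7))
  have pf: "poly (map_poly to_ac f) y = y ^ N + y + t" for y
  proof -
    have "map_poly to_ac f = Polynomial.monom 1 N + Polynomial.monom 1 1 + [:t:]"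
      unfolding assms(8)
      by (rule poly_eqI) (auto simp: coeff_map_poly t_def coeff_pCons split: nat.split)
    then show ?thesis by (simp add: poly_monom)
  qed
  have "{y. poly (map_poly to_ac f) y = 0} = V.roots" by (simp add: V.roots_eq pf N)
  then have L: "L = V.L" unfolding assms(9) splitting_field_def V.L_def by simp
  have pg: "poly (map_poly to_ac g) y = poly (map_poly to_ac f) y + to_ac d ^ 2" for y
  proof -
    have "map_poly to_ac g = map_poly to_ac f + [:to_ac d ^ 2:]"
      unfolding assms(11)
      by (rule poly_eqI) (auto simp: coeff_map_poly coeff_pCons split: nat.split)
    then show ?thesis by simp
  qed
  \<comment> \<open>The points (a, d) and (a, -d) are distinct because d is nonzero and the
    characteristic is the odd prime p.\<close>
  have "to_ac d + to_ac d \<noteq> 0"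
  proof
    assume "to_ac d + to_ac d = 0"
    then have "2 * to_ac d = 0" by (simp only: mult_2)
    moreover have "to_ac d \<noteq> 0" using inj[of d 0] assms(10) unfolding to_ac_0 by blast
    ultimately have "of_nat 2 = (0 :: 'a poly fract alg_closure)"
      using iffD1[OF mult_eq_0_iff] unfolding of_nat_numeral by blast
    then have "CHAR('a poly fract alg_closure) dvd 2" by (simp only: of_nat_eq_0_iff_char_dvd)
    then have "p dvd 2" unfolding V.CHAR_b .
    then have "p \<le> 2" by (rule dvd_imp_le) simp
    then show False using assms(1,2) prime_ge_2_nat[of p] by (cases "p = 2") auto
  qed
  then have dd: "to_ac d \<noteq> - to_ac d" by (metis add.right_inverse)
  have finite: "finite V.roots"
    using V.card_roots V.N_pos by (metis card.infinite not_numeral_le_zero)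
  have "lepoll {..<2 * card V.roots} (curve_points (map_poly to_ac g) V.L)"
  proof (rule curve_points_lepoll[OF V.is_subring_L V.roots_L finite _ dd])
    show "to_ac d \<in> V.L" using V.K_L by blast
    show "poly (map_poly to_ac g) y = to_ac d ^ 2" if "y \<in> V.roots" for y
      using that by (simp add: pg pf V.roots_eq N)
  qed
  then show ?thesis using V.galois_group_iso_PGL by (simp add: L V.card_roots N)
qed

end
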